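(* Let $N\ge5$ be an odd positive integer, let $k=N-2$, and let $$f_k(\tau)=\frac14\sum_{(n,m)\in\mathbb{Z}^2}(-1)^{m(k-1)/2}(n-im)^{k-1}q^{n^2+m^2},\qquad q=e^{2\pi i\tau}.$$ For complex $x$ with $\operatorname{Re}x>-1$ let $$A_{\sigma_N}(x)=\left(\sum_{j=0}^\infty\binom{x}{j}^2\binom{x+j}{j}\right)^{(N-3)/2}.$$ Then $$A_{\sigma_N}\!\left(-\tfrac12\right)=\frac{\alpha_k}{\pi^{k-1}}\,L(f_k,k-1),$$ where $\alpha_k$ is the explicit rational number $$\alpha_k=2^{(k+1)/2}(k-2)\cdot\begin{cases}2/r_{(k-1)/2}, & \text{if } k\equiv1\pmod 4,\\ 1/s_{(k-1)/2}, & \text{if } k\equiv3\pmod4.\end{cases}$$ Here $r_n$ is defined by $r_2=1/5$, $r_3=0$ and $$(2n+1)(n-3)\,r_n=3\sum_{j=2}^{n-2}r_j\,r_{n-j}\qquad\text{for } n\ge4,$$ and $s_n$ is defined by $s_1=1/4$, $s_2=11/80$, $s_3=1/32$ and the same recursion, that is, $(2n+1)(n-3)\,s_n=3\sum_{j=2}^{n-2}s_j\,s_{n-j}$ for $n\ge4$.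
   Context: For complex $x$ and integers $j\ge0$, $\binom{x}{j}=x(x-1)\cdots(x-j+1)/j!$ and $\binom{x+j}{j}=(x+1)(x+2)\cdots(x+j)/j!$; the series $\sum_{j\ge0}\binom{x}{j}^2\binom{x+j}{j}$ converges for $\operatorname{Re}x>-1$. For nonnegative integers $n$, $A_{\sigma_N}(n)=\big(\sum_{j=0}^n\binom{n}{j}^2\binom{n+j}{j}\big)^{(N-3)/2}$ is the leading coefficient of a certain cellular integral of Brown; the function $A_{\sigma_N}(x)$ is the interpolation of this sequence. Writing $f_k(\tau)=\sum_{n\ge1}\gamma_k(n)q^n$ (a modular form of weight $k$), $L(f_k,s)$ denotes the $L$-function given by $\sum_{n\ge1}\gamma_k(n)n^{-s}$ for $\operatorname{Re}s$ large, and by analytic continuation elsewhere. *)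

theory Defs
  imports "HOL-Complex_Analysis.Complex_Analysis"
begin

definition theta_f :: "nat \<Rightarrow> complex \<Rightarrow> complex" where
  "theta_f k \<tau> = 1 / 4 * (\<Sum>\<^sub>\<infinity>(n, m) \<in> (UNIV :: (int \<times> int) set).
     (-1) powi (m * int ((k - 1) div 2)) * (of_int n - \<i> * of_int m) ^ (k - 1)
       * exp (2 * of_real pi * \<i> * \<tau>) powi (n\<^sup>2 + m\<^sup>2))"

definition has_q_expansion :: "(complex \<Rightarrow> complex) \<Rightarrow> (nat \<Rightarrow> complex) \<Rightarrow> bool" where
  "has_q_expansion f \<gamma> \<longleftrightarrow>
     (\<forall>\<tau>. Im \<tau> > 0 \<longrightarrow> (\<lambda>n. \<gamma> n * exp (2 * of_real pi * \<i> * \<tau>) ^ n) sums f \<tau>)"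

definition q_coeff :: "(complex \<Rightarrow> complex) \<Rightarrow> nat \<Rightarrow> complex" where
  "q_coeff f = (THE \<gamma>. has_q_expansion f \<gamma>)"

definition is_L_continuation ::
    "(complex \<Rightarrow> complex) \<Rightarrow> real \<Rightarrow> (complex \<Rightarrow> complex) \<Rightarrow> bool" where
  "is_L_continuation f c F \<longleftrightarrow>
     F holomorphic_on {w. Re w > c} \<and>
     (\<exists>b. \<forall>w. Re w > b \<longrightarrow>
        (\<lambda>n. q_coeff f (Suc n) / of_nat (Suc n) powr w) sums F w)"

text \<open>
  The value at \<open>s\<close> of the analytic continuation to a right half-plane containing \<open>s\<close>.
  It does not depend on the half-plane, and agrees with the continuation to the whole plane
  when there is one; see \<open>L_function_eqI\<close> and \<open>L_function_entire\<close>.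
\<close>
definition L_function :: "(complex \<Rightarrow> complex) \<Rightarrow> complex \<Rightarrow> complex" where
  "L_function f s = (THE z. \<exists>c F. is_L_continuation f c F \<and> c < Re s \<and> z = F s)"

definition A_sigma :: "nat \<Rightarrow> complex \<Rightarrow> complex" where
  "A_sigma N x =
     (\<Sum>j. (x gchoose j)\<^sup>2 * ((x + of_nat j) gchoose j)) ^ ((N - 3) div 2)"

text \<open>The values of \<open>r_seq\<close> at \<open>0\<close> and \<open>1\<close>, and of \<open>s_seq\<close> at \<open>0\<close>, are never used.\<close>

fun r_seq :: "nat \<Rightarrow> rat" where
  "r_seq n =
     (if n = 2 then 1 / 5 else if n \<le> 3 then 0
      else 3 * (\<Sum>j = 2..n - 2. r_seq j * r_seq (n - j))
             / ((2 * of_nat n + 1) * (of_nat n - 3)))"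

fun s_seq :: "nat \<Rightarrow> rat" where
  "s_seq n =
     (if n = 0 then 0 else if n = 1 then 1 / 4 else if n = 2 then 11 / 80
      else if n = 3 then 1 / 32
      else 3 * (\<Sum>j = 2..n - 2. s_seq j * s_seq (n - j))
             / ((2 * of_nat n + 1) * (of_nat n - 3)))"

declare r_seq.simps [simp del] s_seq.simps [simp del]

text \<open>Only used for odd \<open>k\<close>, so the second case is \<open>k\<close> congruent to \<open>3\<close> modulo \<open>4\<close>.\<close>
definition alpha :: "nat \<Rightarrow> rat" where
  "alpha k = 2 ^ ((k + 1) div 2) * (of_nat k - 2) *
     (if k mod 4 = 1 then 2 / r_seq ((k - 1) div 2) else 1 / s_seq ((k - 1) div 2))"

lemma r_seq_values: "r_seq 2 = 1 / 5" "r_seq 3 = 0"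
  by (simp_all add: r_seq.simps)

lemma r_seq_rec:
  assumes "n \<ge> 4"
  shows "(2 * of_nat n + 1) * (of_nat n - 3) * r_seq n
           = 3 * (\<Sum>j = 2..n - 2. r_seq j * r_seq (n - j))"
proof -
  have "(2 * rat_of_nat n + 1) * (of_nat n - 3) \<noteq> 0"
    using assms by (simp add: add_eq_0_iff_both_eq_0)
  then show ?thesis
    using assms by (subst r_seq.simps) simp
qed

lemma s_seq_values: "s_seq 1 = 1 / 4" "s_seq 2 = 11 / 80" "s_seq 3 = 1 / 32"
  by (simp_all add: s_seq.simps)

lemma s_seq_rec:
  assumes "n \<ge> 4"
  shows "(2 * of_nat n + 1) * (of_nat n - 3) * s_seq n
           = 3 * (\<Sum>j = 2..n - 2. s_seq j * s_seq (n - j))"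
proof -
  have "(2 * rat_of_nat n + 1) * (of_nat n - 3) \<noteq> 0"
    using assms by (simp add: add_eq_0_iff_both_eq_0)
  then show ?thesis
    using assms by (subst s_seq.simps) simp
qed

lemma L_continuation_unique:
  assumes F: "is_L_continuation f c F" and G: "is_L_continuation f d G"
    and s: "c < Re s" "d < Re s"
  shows "F s = G s"
proof -
  obtain a where a: "\<And>w. Re w > a \<Longrightarrow>
      (\<lambda>n. q_coeff f (Suc n) / of_nat (Suc n) powr w) sums F w"
    using F unfolding is_L_continuation_def by blast
  obtain b where b: "\<And>w. Re w > b \<Longrightarrow>
      (\<lambda>n. q_coeff f (Suc n) / of_nat (Suc n) powr w) sums G w"
    using G unfolding is_L_continuation_def by blast
  define M where "M = max (max a b) (max c d)"
  define S where "S = {w. Re w > max c d}"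
  show ?thesis
  proof (rule analytic_continuation_open[of "{w. Re w > M}" S F G])
    show "open {w. Re w > M}" "open S"
      unfolding S_def by (rule open_halfspace_Re_gt)+
    show "{w. Re w > M} \<noteq> {}"
      by (auto intro!: exI[of _ "of_real (M + 1)"])
    show "connected S"
      unfolding S_def by (intro convex_connected convex_halfspace_Re_gt)
    show "{w. Re w > M} \<subseteq> S" by (auto simp: S_def M_def)
    show "F holomorphic_on S" "G holomorphic_on S"
      using F G unfolding is_L_continuation_def S_def
      by (auto elim!: holomorphic_on_subset)
    show "s \<in> S" using s by (simp add: S_def)
    show "F w = G w" if "w \<in> {w. Re w > M}" for w
      using that a[of w] b[of w] by (auto simp: M_def intro: sums_unique2)
  qed
qed

lemma L_function_eqI:
  assumes "is_L_continuation f c F" "c < Re s"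
  shows "L_function f s = F s"
  unfolding L_function_def using assms
  by (intro the_equality) (auto intro: L_continuation_unique)

lemma L_function_entire:
  assumes "F holomorphic_on UNIV"
    and "\<And>w. Re w > b \<Longrightarrow> (\<lambda>n. q_coeff f (Suc n) / of_nat (Suc n) powr w) sums F w"
  shows "L_function f s = F s"
proof (rule L_function_eqI)
  show "is_L_continuation f (Re s - 1) F"
    using assms unfolding is_L_continuation_def by (auto intro: holomorphic_on_subset)
qed simp

end

theory Submission
  imports Defs "HOL-Real_Asymp.Real_Asymp"
begin

text \<open>
  For \<open>k = 2 d + 1 > 3\<close> the series for \<open>L(f\<^sub>k, k - 1)\<close> converges absolutely, and since
  \<open>(n - i m) / (n\<^sup>2 + m\<^sup>2) = 1 / (n + i m)\<close> it is a quarter of an Eisenstein series of weight \<open>2 d\<close>: of that of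
  the lattice \<open>Z + i Z\<close> for even \<open>d\<close>, and of twice that of \<open>Z + 2 i Z\<close> for odd \<open>d\<close>, where the
  former vanishes. For \<open>k = 3\<close> the terms with \<open>m = 2 j\<close> and \<open>m = 2 j + 1\<close> are paired; the paired
  series continues the L-function to \<open>Re w > 3/2\<close>, and its value at \<open>2\<close> is \<open>- wp(i) / 4\<close> for
  the Weierstrass function of \<open>Z + 2 i Z\<close>.

  The recursion for \<open>r\<close> and \<open>s\<close> is the one satisfied by the Laurent coefficients of the
  Weierstrass function, so only the first two coefficients have to be found. For \<open>Z + i Z\<close>
  the real half period expresses \<open>wp(1/2) = w\<^sup>2\<close> through the lemniscate constant
  \<open>w = B(1/4, 1/2) / 2\<close>; the two lattices are compared through
  \<open>wp\<^sub>1(z) = wp\<^sub>2(z) + wp\<^sub>2(z - i) - wp\<^sub>2(i)\<close> and the half-period translation formula.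

  Finally \<open>A(-1/2)\<close> is a power of \<open>\<Sum>j. ((1/2)\<^sub>j / j!)\<^sup>3\<close>, a case of Dixon's sum, which equals
  \<open>2 w\<^sup>2 / pi\<^sup>2\<close> by a WZ argument: shifting the first parameter by \<open>2\<close> multiplies the sum by a
  rational factor, and the sum tends to \<open>1\<close> as that parameter grows.
\<close>

subsection \<open>The Weierstrass function of a lattice\<close>

text \<open>With d = (k - 1)/2 and w the lemniscate constant, both sides equal 2^d w^(2d) / pi^(2d).
  The recursion is homogeneous in the weight, so the Eisenstein series involved is a rational
  multiple of w^(2d), and alpha_k is made to cancel that rational. Its factor k - 2 = 2d - 1 is the
  one between an Eisenstein series and a Laurent coefficient. The value s_1 = 1/4 lies outside the
  recursion: it replaces the Eisenstein series of weight 2 of Z + 2iZ, which fails to converge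
  absolutely, by - wp(i)/2 = w^2/4.

  The theory of elliptic functions is reduced to one principle: a periodic function with only
  removable singularities is constant. No zeros or poles are counted. That wp and wp' together
  separate points modulo the lattice is read off from the differential equation; this makes
  half-period values distinct and keeps wp' away from 0 on (0, 1/2).

  The step 2 in Dixon's sum is dictated by its closed form, which contains Gamma functions at a/2:
  shifting a by 2 moves their arguments by integers.\<close>

lemma has_field_derivative_inverse_square:
  fixes a z :: complex
  assumes "z \<noteq> a"
  shows "((\<lambda>z. 1 / (z - a)\<^sup>2) has_field_derivative -2 / (z - a) ^ 3) (at z)"
proof -
  have "((\<lambda>z. inverse (z - a) ^ 2) has_field_derivative (-2 * inverse (z - a) ^ 3)) (at z)"
    using assms by (auto intro!: derivative_eq_intros simp: power2_eq_square power3_eq_cube)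
  then show ?thesis by (simp add: divide_inverse power_inverse)
qed

text \<open>No basis is fixed. \<open>norm_ge_1\<close> gives discreteness and lets powers of the
  norm be compared, \<open>summable_cube\<close> gives all the convergence, and
  \<open>cobounded\<close> stands in for a compact fundamental parallelogram. The bound 1 is the
  normalization that fits Z + iZ and Z + 2iZ.\<close>

locale complex_lattice =
  fixes L :: "complex set"
  assumes zero_in: "0 \<in> L"
    and add_in: "\<omega> \<in> L \<Longrightarrow> \<mu> \<in> L \<Longrightarrow> \<omega> + \<mu> \<in> L"
    and minus_in: "\<omega> \<in> L \<Longrightarrow> - \<omega> \<in> L"
    and norm_ge_1: "\<omega> \<in> L - {0} \<Longrightarrow> 1 \<le> norm \<omega>"
    and summable_cube: "(\<lambda>\<omega>. 1 / norm \<omega> ^ 3) summable_on (L - {0})"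
    and cobounded: "\<exists>R. \<forall>z. \<exists>\<omega>\<in>L. norm (z - \<omega>) \<le> R"
begin

lemma diff_in: "\<omega> \<in> L \<Longrightarrow> \<mu> \<in> L \<Longrightarrow> \<omega> - \<mu> \<in> L"
  using add_in[of "\<omega>" "- \<mu>"] minus_in[of \<mu>] by simp

lemma add_in_iff: "\<mu> \<in> L \<Longrightarrow> z + \<mu> \<in> L \<longleftrightarrow> z \<in> L"
  using add_in[of z \<mu>] diff_in[of "z + \<mu>" \<mu>] by auto

lemma minus_in_iff: "- z \<in> L \<longleftrightarrow> z \<in> L"
  using minus_in[of z] minus_in[of "- z"] by auto

lemma dist_ge_1: "\<omega> \<in> L \<Longrightarrow> \<mu> \<in> L \<Longrightarrow> \<omega> \<noteq> \<mu> \<Longrightarrow> 1 \<le> norm (\<omega> - \<mu>)"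
  using norm_ge_1[of "\<omega> - \<mu>"] diff_in by auto

lemma separated:
  assumes "A \<subseteq> L" "z \<notin> A"
  obtains d where "d > 0" "\<And>\<omega>. \<omega> \<in> A \<Longrightarrow> d \<le> norm (z - \<omega>)"
proof (cases "\<exists>\<mu>\<in>A. norm (z - \<mu>) < 1/2")
  case True
  then obtain \<mu> where \<mu>: "\<mu> \<in> A" "norm (z - \<mu>) < 1/2" by auto
  show ?thesis
  proof (rule that)
    show "norm (z - \<mu>) > 0" using assms \<mu> by auto
    show "norm (z - \<mu>) \<le> norm (z - \<omega>)" if "\<omega> \<in> A" for \<omega>
    proof (cases "\<omega> = \<mu>")
      case False
      then have "1 \<le> norm (\<omega> - \<mu>)" using dist_ge_1 that \<mu> assms by blast
      also have "\<omega> - \<mu> = (z - \<mu>) - (z - \<omega>)" by simp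
      also have "norm \<dots> \<le> norm (z - \<mu>) + norm (z - \<omega>)" by (rule norm_triangle_ineq4)
      finally show ?thesis using \<mu> by linarith
    qed auto
  qed
next
  case False
  then show ?thesis by (intro that[of "1/2"]) (auto simp: not_less)
qed

lemma closed_subset:
  assumes "A \<subseteq> L"
  shows "closed A"
proof -
  have "open (- A)"
    unfolding open_dist
  proof safe
    fix z assume "z \<notin> A"
    with separated[OF assms] obtain d where d: "d > 0" "\<And>\<omega>. \<omega> \<in> A \<Longrightarrow> d \<le> norm (z - \<omega>)" by blast
    show "\<exists>e>0. \<forall>y. dist y z < e \<longrightarrow> y \<in> - A"
      using d by (intro exI[of _ d]) (force simp: dist_norm norm_minus_commute)
  qed
  then show ?thesis by (simp add: closed_def)
qed

text \<open>A summable family has only countably many nonzero terms, and here every term is nonzero.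
  Countability is what makes the complement of the lattice connected.\<close>

lemma countable_lattice: "countable L"
proof -
  have "(\<lambda>\<omega>. norm (1 / norm \<omega> ^ 3)) summable_on (L - {0})"
    using summable_cube by simp
  then have "countable {\<omega>\<in>L - {0}. 1 / norm \<omega> ^ 3 \<noteq> 0}"
    by (rule abs_summable_countable)
  then have "countable (insert 0 {\<omega>\<in>L - {0}. 1 / norm \<omega> ^ 3 \<noteq> 0})" by simp
  then show ?thesis by (rule countable_subset[rotated]) auto
qed

lemma connected_compl: "connected (- L)"
  by (intro path_connected_imp_connected path_connected_complement_countable countable_lattice) auto

lemma open_compl: "open (- L)"
  using closed_subset[of L] by auto

text \<open>Supplies locally uniform majorants for the M-test. Points of norm above
  \<open>2 * R\<close> are at distance at least half their norm from the ball; the others stay at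
  distance \<open>d / 2\<close> from it while their norm is bounded.\<close>

lemma locally_comparable:
  assumes "A \<subseteq> L" "z0 \<notin> A"
  obtains r c where "r > 0" "c > 0"
    "\<And>z \<omega>. z \<in> cball z0 r \<Longrightarrow> \<omega> \<in> A \<Longrightarrow> c * norm \<omega> \<le> norm (z - \<omega>) \<and> z \<noteq> \<omega>"
proof -
  obtain d where d: "d > 0" "\<And>\<omega>. \<omega> \<in> A \<Longrightarrow> d \<le> norm (z0 - \<omega>)" using separated[OF assms] by blast
  define R where "R = norm z0 + d"
  have R: "R > 0" using d by (simp add: R_def add_nonneg_pos)
  define c where "c = min (1/2) (d / (4 * R))"
  show ?thesis
  proof (rule that)
    show "d / 2 > 0" "c > 0" using d R by (auto simp: c_def)
    fix z \<omega> assume z: "z \<in> cball z0 (d/2)" and l: "\<omega> \<in> A"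
    have zR: "norm z \<le> R"
    proof -
      have "norm z \<le> norm z0 + norm (z - z0)" using norm_triangle_ineq[of z0 "z - z0"] by simp
      then show ?thesis using z d by (simp add: R_def dist_norm norm_minus_commute)
    qed
    have dl: "d / 2 \<le> norm (z - \<omega>)"
    proof -
      have "d \<le> norm (z0 - \<omega>)" using d l by auto
      also have "\<dots> \<le> norm (z0 - z) + norm (z - \<omega>)" using norm_triangle_ineq[of "z0 - z" "z - \<omega>"] by simp
      finally show ?thesis using z by (simp add: dist_norm)
    qed
    have "c * norm \<omega> \<le> norm (z - \<omega>)"
    proof (cases "norm \<omega> \<le> 2 * R")
      case True
      have "c * norm \<omega> \<le> d / (4 * R) * (2 * R)"
        using True R d by (intro mult_mono) (auto simp: c_def)
      also have "\<dots> = d / 2" using R by simp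
      finally show ?thesis using dl by linarith
    next
      case False
      have "c * norm \<omega> \<le> 1/2 * norm \<omega>" by (intro mult_right_mono) (auto simp: c_def)
      also have "\<dots> \<le> norm \<omega> - norm z" using False zR by linarith
      also have "\<dots> \<le> norm (z - \<omega>)" by (metis norm_minus_commute norm_triangle_ineq2)
      finally show ?thesis .
    qed
    then show "c * norm \<omega> \<le> norm (z - \<omega>) \<and> z \<noteq> \<omega>" using dl d by auto
  qed
qed

section \<open>Construction, derivative and periodicity of the Weierstrass function\<close>

definition wp_reg :: "complex \<Rightarrow> complex" where
  "wp_reg z = (\<Sum>\<^sub>\<infinity>\<omega>\<in>L - {0}. 1 / (z - \<omega>)\<^sup>2 - 1 / \<omega>\<^sup>2)"

definition wp :: "complex \<Rightarrow> complex" where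
  "wp z = 1 / z\<^sup>2 + wp_reg z"

text \<open>Two majorants of order \<open>1 / norm \<omega> ^ 3\<close>, valid near
  \<open>z0\<close>, yield all three claims: convergence of the series, convergence of the
  differentiated series, and termwise differentiation.\<close>

lemma wp_reg_aux:
  assumes z0: "z0 \<notin> L - {0}"
  shows wp_reg_summable: "(\<lambda>\<omega>. 1 / (z0 - \<omega>)\<^sup>2 - 1 / \<omega>\<^sup>2) summable_on (L - {0})"
    and wp_reg_deriv_summable: "(\<lambda>\<omega>. -2 / (z0 - \<omega>) ^ 3) summable_on (L - {0})"
    and wp_reg_has_derivative: "(wp_reg has_field_derivative (\<Sum>\<^sub>\<infinity>\<omega>\<in>L - {0}. -2 / (z0 - \<omega>) ^ 3)) (at z0)"
proof -
  obtain r c where rc: "r > 0" "c > 0" and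
    cmp: "\<And>z \<omega>. z \<in> cball z0 r \<Longrightarrow> \<omega> \<in> L - {0} \<Longrightarrow> c * norm \<omega> \<le> norm (z - \<omega>) \<and> z \<noteq> \<omega>"
    using locally_comparable[of "L - {0}" z0] z0 by blast
  define R where "R = norm z0 + r"
  have R: "R \<ge> 0" using rc by (simp add: R_def)
  have zR: "norm z \<le> R" if "z \<in> cball z0 r" for z
  proof -
    have "norm z \<le> norm z0 + norm (z - z0)" using norm_triangle_ineq[of z0 "z - z0"] by simp
    then show ?thesis using that by (simp add: R_def dist_norm norm_minus_commute)
  qed
  define M where "M = (\<lambda>\<omega>::complex. R * (2 + R) / c\<^sup>2 * (1 / norm \<omega> ^ 3))"
  have M: "M summable_on (L - {0})" unfolding M_def by (intro summable_on_cmult_right summable_cube)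
  have bound: "norm (1 / (z - \<omega>)\<^sup>2 - 1 / \<omega>\<^sup>2) \<le> M \<omega>" if z: "z \<in> cball z0 r" and l: "\<omega> \<in> L - {0}" for z \<omega>
  proof -
    have l1: "norm \<omega> \<ge> 1" using norm_ge_1[OF l] .
    have ne: "z \<noteq> \<omega>" "\<omega> \<noteq> 0" using cmp[OF z l] l by auto
    \<comment> \<open>Subtracting \<open>1 / \<omega>\<^sup>2\<close> cancels the leading term: the
      numerator is only linear in \<open>\<omega>\<close>, so decay of order 2 improves to order
      3.\<close>
    have "1 / (z - \<omega>)\<^sup>2 - 1 / \<omega>\<^sup>2 = z * (2 * \<omega> - z) / ((z - \<omega>)\<^sup>2 * \<omega>\<^sup>2)"
      using ne by (simp add: divide_simps) (simp add: power2_eq_square algebra_simps)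
    then have "norm (1 / (z - \<omega>)\<^sup>2 - 1 / \<omega>\<^sup>2) = norm z * norm (2 * \<omega> - z) / (norm (z - \<omega>) ^ 2 * norm \<omega> ^ 2)"
      by (simp add: norm_mult norm_divide norm_power)
    also have "\<dots> \<le> R * ((2 + R) * norm \<omega>) / ((c * norm \<omega>) ^ 2 * norm \<omega> ^ 2)"
    proof (intro frac_le mult_mono mult_right_mono power_mono)
      have "norm (2 * \<omega> - z) \<le> norm (2 * \<omega>) + norm z" by (rule norm_triangle_ineq4)
      also have "\<dots> \<le> 2 * norm \<omega> + R * norm \<omega>"
        using zR[OF z] mult_left_mono[OF l1 R] by (simp add: norm_mult)
      finally show "norm (2 * \<omega> - z) \<le> (2 + R) * norm \<omega>" by (simp add: algebra_simps)
      show "c * norm \<omega> \<le> norm (z - \<omega>)" using cmp[OF z l] by simp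
      show "0 < (c * norm \<omega>)\<^sup>2 * (norm \<omega>)\<^sup>2" using rc ne by simp
    qed (use zR[OF z] R rc in auto)
    also have "\<dots> = M \<omega>" using ne rc by (simp add: M_def power_mult_distrib power2_eq_square power3_eq_cube)
    finally show ?thesis .
  qed
  have bound': "norm (-2 / (z - \<omega>) ^ 3) \<le> 2 / c ^ 3 * (1 / norm \<omega> ^ 3)"
    if z: "z \<in> cball z0 r" and l: "\<omega> \<in> L - {0}" for z \<omega>
  proof -
    have "norm (-2 / (z - \<omega>) ^ 3) = 2 / norm (z - \<omega>) ^ 3" by (simp add: norm_divide norm_power)
    also have "\<dots> \<le> 2 / (c * norm \<omega>) ^ 3"
      using cmp[OF z l] l rc by (intro divide_left_mono power_mono mult_pos_pos zero_less_power) auto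
    also have "\<dots> = 2 / c ^ 3 * (1 / norm \<omega> ^ 3)" by (simp add: power_mult_distrib)
    finally show ?thesis .
  qed
  have z0r: "z0 \<in> cball z0 r" using rc by simp
  have "(\<lambda>\<omega>. norm (1 / (z0 - \<omega>)\<^sup>2 - 1 / \<omega>\<^sup>2)) summable_on (L - {0})"
    by (rule summable_on_comparison_test[OF M]) (use bound[OF z0r] in auto)
  then show "(\<lambda>\<omega>. 1 / (z0 - \<omega>)\<^sup>2 - 1 / \<omega>\<^sup>2) summable_on (L - {0})" by (rule abs_summable_summable)
  have "(\<lambda>\<omega>. norm (-2 / (z0 - \<omega>) ^ 3)) summable_on (L - {0})"
    by (rule summable_on_comparison_test[OF summable_on_cmult_right[OF summable_cube, of "2 / c ^ 3"]])
       (use bound'[OF z0r] in auto)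
  then show S': "(\<lambda>\<omega>. -2 / (z0 - \<omega>) ^ 3) summable_on (L - {0})" by (rule abs_summable_summable)
  have "uniform_limit (cball z0 r) (\<lambda>X z. \<Sum>\<omega>\<in>X. 1 / (z - \<omega>)\<^sup>2 - 1 / \<omega>\<^sup>2) (\<lambda>z. \<Sum>\<^sub>\<infinity>\<omega>\<in>L - {0}. 1 / (z - \<omega>)\<^sup>2 - 1 / \<omega>\<^sup>2)
      (finite_subsets_at_top (L - {0}))"
    by (rule Weierstrass_m_test_general[OF bound M]) auto
  then have ul: "uniform_limit (cball z0 r) (\<lambda>X z. \<Sum>\<omega>\<in>X. 1 / (z - \<omega>)\<^sup>2 - 1 / \<omega>\<^sup>2) wp_reg (finite_subsets_at_top (L - {0}))"
    by (simp add: wp_reg_def[abs_def])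
  have der: "((\<lambda>z. \<Sum>\<omega>\<in>X. 1 / (z - \<omega>)\<^sup>2 - 1 / \<omega>\<^sup>2) has_field_derivative (\<Sum>\<omega>\<in>X. -2 / (z - \<omega>) ^ 3)) (at z)"
    if "X \<subseteq> L - {0}" "z \<in> cball z0 r" for X z
  proof (rule DERIV_sum)
    fix \<omega> assume "\<omega> \<in> X"
    then have ne: "z \<noteq> \<omega>" using cmp[OF that(2)] that by auto
    show "((\<lambda>z. 1 / (z - \<omega>)\<^sup>2 - 1 / \<omega>\<^sup>2) has_field_derivative -2 / (z - \<omega>) ^ 3) (at z)"
      using DERIV_diff[OF has_field_derivative_inverse_square[OF ne] DERIV_const] by simp
  qed
  \<comment> \<open>The derivatives of a uniform limit are limits of the derivatives;
    \<open>g'\<close> is then identified with the unordered sum by uniqueness of limits.\<close>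
  obtain g' where g': "\<And>w. w \<in> ball z0 r \<Longrightarrow> (wp_reg has_field_derivative (g' w)) (at w) \<and>
      ((\<lambda>X. \<Sum>\<omega>\<in>X. -2 / (w - \<omega>) ^ 3) \<longlongrightarrow> g' w) (finite_subsets_at_top (L - {0}))"
  proof (rule has_complex_derivative_uniform_limit[OF _ ul _ rc(1)])
    show "\<forall>\<^sub>F X in finite_subsets_at_top (L - {0}).
        continuous_on (cball z0 r) (\<lambda>z. \<Sum>\<omega>\<in>X. 1 / (z - \<omega>)\<^sup>2 - 1 / \<omega>\<^sup>2) \<and>
        (\<forall>w\<in>ball z0 r. ((\<lambda>z. \<Sum>\<omega>\<in>X. 1 / (z - \<omega>)\<^sup>2 - 1 / \<omega>\<^sup>2) has_field_derivative (\<Sum>\<omega>\<in>X. -2 / (w - \<omega>) ^ 3)) (at w))"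
    proof (rule eventually_finite_subsets_at_top_weakI, intro conjI ballI)
      fix X assume X: "X \<subseteq> L - {0}"
      show "continuous_on (cball z0 r) (\<lambda>z. \<Sum>\<omega>\<in>X. 1 / (z - \<omega>)\<^sup>2 - 1 / \<omega>\<^sup>2)"
        using der[OF X] by (intro continuous_at_imp_continuous_on ballI) (blast intro: DERIV_isCont)
    qed (use der in auto)
  qed (auto intro: that)
  have "((\<lambda>X. \<Sum>\<omega>\<in>X. -2 / (z0 - \<omega>) ^ 3) \<longlongrightarrow> (\<Sum>\<^sub>\<infinity>\<omega>\<in>L - {0}. -2 / (z0 - \<omega>) ^ 3)) (finite_subsets_at_top (L - {0}))"
    using has_sum_infsum[OF S'] by (simp add: has_sum_def)
  moreover have "((\<lambda>X. \<Sum>\<omega>\<in>X. -2 / (z0 - \<omega>) ^ 3) \<longlongrightarrow> g' z0) (finite_subsets_at_top (L - {0}))"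
    using g'[of z0] rc by auto
  ultimately have "g' z0 = (\<Sum>\<^sub>\<infinity>\<omega>\<in>L - {0}. -2 / (z0 - \<omega>) ^ 3)"
    by (intro tendsto_unique[of "finite_subsets_at_top (L - {0})"]) auto
  then show "(wp_reg has_field_derivative (\<Sum>\<^sub>\<infinity>\<omega>\<in>L - {0}. -2 / (z0 - \<omega>) ^ 3)) (at z0)"
    using g'[of z0] rc by auto
qed

lemma infsum_insert_0:
  fixes f :: "complex \<Rightarrow> complex"
  assumes "f summable_on (L - {0})"
  shows "(f has_sum (f 0 + infsum f (L - {0}))) L"
proof -
  have "(f has_sum (f 0 + infsum f (L - {0}))) ({0} \<union> (L - {0}))"
    using assms by (intro has_sum_Un_disjoint) (auto intro: has_sum_finiteI)
  also have "{0} \<union> (L - {0}) = L" using zero_in by auto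
  finally show ?thesis .
qed

text \<open>This sum converges absolutely over all of \<open>L\<close> without correcting terms, so
  it can be translated by a lattice vector at once; the subtracted constants in \<open>wp\<close>
  prevent that there.\<close>

definition wp_deriv :: "complex \<Rightarrow> complex" where
  "wp_deriv z = (\<Sum>\<^sub>\<infinity>\<omega>\<in>L. -2 / (z - \<omega>) ^ 3)"

lemma wp_has_derivative:
  assumes z: "z \<notin> L"
  shows "(wp has_field_derivative wp_deriv z) (at z)"
proof -
  have z': "z \<noteq> 0" using z zero_in by auto
  have "((\<lambda>z. 1 / z\<^sup>2) has_field_derivative (-2 / z ^ 3)) (at z)"
    using has_field_derivative_inverse_square[OF z'] by simp
  moreover have "(wp_reg has_field_derivative (\<Sum>\<^sub>\<infinity>\<omega>\<in>L - {0}. -2 / (z - \<omega>) ^ 3)) (at z)"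
    using z by (intro wp_reg_has_derivative) auto
  ultimately have "((\<lambda>z. 1 / z\<^sup>2 + wp_reg z) has_field_derivative (-2 / z ^ 3 + (\<Sum>\<^sub>\<infinity>\<omega>\<in>L - {0}. -2 / (z - \<omega>) ^ 3))) (at z)"
    by (rule DERIV_add)
  also have "-2 / z ^ 3 + (\<Sum>\<^sub>\<infinity>\<omega>\<in>L - {0}. -2 / (z - \<omega>) ^ 3) = wp_deriv z"
    using infsumI[OF infsum_insert_0[OF wp_reg_deriv_summable[of z]]] z by (simp add: wp_deriv_def)
  also have "(\<lambda>z. 1 / z\<^sup>2 + wp_reg z) = wp" by (simp add: wp_def[abs_def])
  finally show ?thesis .
qed

lemma wp_holomorphic: "wp holomorphic_on - L"
  using wp_has_derivative open_compl by (auto simp: holomorphic_on_open)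

lemma deriv_wp: "z \<notin> L \<Longrightarrow> deriv wp z = wp_deriv z"
  by (intro DERIV_imp_deriv wp_has_derivative)

lemma wp_reg_uminus: "wp_reg (- z) = wp_reg z"
proof -
  have "bij_betw uminus (L - {0}) (L - {0})"
    by (rule bij_betwI[of _ _ _ uminus]) (auto simp: minus_in)
  from infsum_reindex_bij_betw[OF this, of "\<lambda>\<omega>. 1 / (- z - \<omega>)\<^sup>2 - 1 / \<omega>\<^sup>2"]
  have "wp_reg (- z) = (\<Sum>\<^sub>\<infinity>\<omega>\<in>L - {0}. 1 / (- z + \<omega>)\<^sup>2 - 1 / \<omega>\<^sup>2)"
    by (simp add: wp_reg_def)
  also have "(\<lambda>\<omega>. (- z + \<omega>)\<^sup>2) = (\<lambda>\<omega>. (z - \<omega>)\<^sup>2)" by (auto simp: power2_eq_square algebra_simps)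
  finally show ?thesis by (simp add: wp_reg_def fun_eq_iff)
qed

lemma wp_uminus: "wp (- z) = wp z"
  by (simp add: wp_def wp_reg_uminus)

lemma wp_deriv_periodic:
  assumes "\<mu> \<in> L"
  shows "wp_deriv (z + \<mu>) = wp_deriv z"
proof -
  have "bij_betw (\<lambda>\<omega>. \<omega> + \<mu>) L L"
    using assms by (intro bij_betwI[of _ _ _ "\<lambda>\<omega>. \<omega> - \<mu>"]) (auto simp: add_in diff_in)
  from infsum_reindex_bij_betw[OF this, of "\<lambda>\<omega>. -2 / (z + \<mu> - \<omega>) ^ 3"]
  show ?thesis by (simp add: wp_deriv_def)
qed

text \<open>The derivative is periodic, so \<open>wp (z + \<mu>) - wp z\<close> is constant on the
  connected complement of the lattice. Evaluated at \<open>- z - \<mu>\<close>, evenness gives the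
  negative of that constant, which is therefore 0. The usual evaluation at
  \<open>- \<mu> / 2\<close> would fail when half of \<open>\<mu>\<close> lies in the
  lattice.\<close>

lemma wp_periodic:
  assumes "\<mu> \<in> L" "z \<notin> L"
  shows "wp (z + \<mu>) = wp z"
proof -
  have "\<exists>c. \<forall>z\<in>-L. wp (z + \<mu>) - wp z = c" if \<mu>: "\<mu> \<in> L" for \<mu>
  proof -
    have der: "((\<lambda>z. wp (z + \<mu>) - wp z) has_field_derivative 0) (at z)" if z: "z \<in> - L" for z
    proof -
      have "(wp has_field_derivative wp_deriv (z + \<mu>)) (at (z + \<mu>))"
        using z \<mu> add_in_iff by (intro wp_has_derivative) auto
      then have "((\<lambda>z. wp (z + \<mu>)) has_field_derivative wp_deriv (z + \<mu>)) (at z)"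
        by (simp only: DERIV_shift)
      from DERIV_diff[OF this wp_has_derivative[of z]] z show ?thesis
        using wp_deriv_periodic[OF \<mu>] by simp
    qed
    show ?thesis
    proof (rule DERIV_zero_connected_constant[OF connected_compl open_compl, of "{}" "\<lambda>z. wp (z + \<mu>) - wp z"])
      show "continuous_on (- L) (\<lambda>z. wp (z + \<mu>) - wp z)"
        using der by (intro continuous_at_imp_continuous_on ballI) (blast intro: DERIV_isCont)
    qed (use der in auto)
  qed
  then obtain c where c: "\<And>z. z \<notin> L \<Longrightarrow> wp (z + \<mu>) - wp z = c" using assms(1) by force
  have 1: "- z \<notin> L" "- z - \<mu> \<notin> L" "z - \<mu> \<notin> L"
    using assms add_in_iff[OF assms(1), of "- z - \<mu>"] add_in_iff[OF assms(1), of "z - \<mu>"] minus_in_iff[of z] by auto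
  have "wp (- z) - wp (- z - \<mu>) = c" using c[OF 1(2)] by simp
  moreover have "wp (- z - \<mu>) = wp (z + \<mu>)" using wp_uminus[of "z + \<mu>"] by simp
  ultimately have "wp z - wp (z + \<mu>) = c" by (simp add: wp_uminus)
  moreover have "wp (z + \<mu>) - wp z = c" using c assms by simp
  ultimately show ?thesis by (simp add: algebra_simps)
qed

lemma wp_deriv_uminus:
  assumes "z \<notin> L"
  shows "wp_deriv (- z) = - wp_deriv z"
proof -
  have 1: "(wp has_field_derivative wp_deriv (- z)) (at (- z))"
    using assms minus_in_iff by (intro wp_has_derivative) auto
  have "((\<lambda>z. wp (- z)) has_field_derivative (wp_deriv (- z) * - 1)) (at z)"
    by (rule DERIV_chain2[of wp "wp_deriv (- z)" uminus]) (auto intro!: derivative_eq_intros 1)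
  then have "(wp has_field_derivative (- wp_deriv (- z))) (at z)" by (simp add: wp_uminus)
  with wp_has_derivative[OF assms] have "wp_deriv z = - wp_deriv (- z)" by (rule DERIV_unique)
  then show ?thesis by simp
qed

lemma wp_deriv_half_period:
  assumes "z \<notin> L" "2 * z \<in> L"
  shows "wp_deriv z = 0"
proof -
  have "wp_deriv (- z) = wp_deriv (- z + 2 * z)" using wp_deriv_periodic[OF assms(2), of "- z"] by simp
  then show ?thesis using wp_deriv_uminus[OF assms(1)] by simp
qed

section \<open>Eisenstein series and the Laurent expansion at the origin\<close>

definition eisenstein :: "nat \<Rightarrow> complex" where
  "eisenstein k = (\<Sum>\<^sub>\<infinity>\<omega>\<in>L - {0}. 1 / \<omega> ^ k)"

lemma eisenstein_abs_summable:
  assumes "k \<ge> 3"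
  shows "(\<lambda>\<omega>. norm (1 / \<omega> ^ k)) summable_on (L - {0})"
proof (rule summable_on_comparison_test[OF summable_cube])
  fix \<omega> assume w: "\<omega> \<in> L - {0}"
  have "norm \<omega> ^ 3 \<le> norm \<omega> ^ k" using assms norm_ge_1[OF w] by (rule power_increasing)
  then show "norm (1 / \<omega> ^ k) \<le> 1 / norm \<omega> ^ 3"
    using w by (auto simp: norm_divide norm_power intro!: divide_left_mono mult_pos_pos)
qed auto

lemma eisenstein_summable: "k \<ge> 3 \<Longrightarrow> (\<lambda>\<omega>. 1 / \<omega> ^ k) summable_on (L - {0})"
  by (rule abs_summable_summable, rule eisenstein_abs_summable)

lemma eisenstein_odd:
  assumes "odd k"
  shows "eisenstein k = 0"
proof -
  have "bij_betw uminus (L - {0}) (L - {0})"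
    by (rule bij_betwI[of _ _ _ uminus]) (auto simp: minus_in)
  from infsum_reindex_bij_betw[OF this, of "\<lambda>\<omega>. 1 / \<omega> ^ k"]
  have "eisenstein k = (\<Sum>\<^sub>\<infinity>\<omega>\<in>L - {0}. - (1 / \<omega> ^ k))"
    using assms by (simp add: eisenstein_def)
  also have "\<dots> = - eisenstein k" by (simp only: infsum_uminus eisenstein_def)
  finally show ?thesis by simp
qed

text \<open>Index 0 is set apart because the subtracted \<open>1 / \<omega>\<^sup>2\<close> removes
  the constant term; the general formula would call for the Eisenstein series of weight 2, which
  does not converge absolutely.\<close>

definition wp_coeff :: "nat \<Rightarrow> complex" where
  "wp_coeff n = (if n = 0 then 0 else of_nat (n + 1) * eisenstein (n + 2))"

lemma wp_coeff_0 [simp]: "wp_coeff 0 = 0"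
  by (simp add: wp_coeff_def)

lemma wp_coeff_odd: "odd n \<Longrightarrow> wp_coeff n = 0"
  by (simp add: wp_coeff_def eisenstein_odd)

text \<open>Each term is expanded as the derivative of a geometric series and the order of summation
  is exchanged. Nonzero lattice points have norm at least 1, so \<open>norm z \<le> 1/2\<close>
  gives the summable double majorant \<open>(n + 1) / 2 ^ n\<close> times
  \<open>1 / norm \<omega> ^ 3\<close>.\<close>

lemma wp_reg_sums:
  assumes z: "norm z \<le> 1/2"
  shows "(\<lambda>n. wp_coeff n * z ^ n) sums wp_reg z"
proof -
  define A where "A = L - {0}"
  \<comment> \<open>The term with \<open>n = 0\<close> of the expansion of
    \<open>1 / (z - \<omega>)\<^sup>2\<close> is exactly the subtracted
    \<open>1 / \<omega>\<^sup>2\<close>; for positive \<open>n\<close> the exponent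
    \<open>n + 2\<close> is at least 3.\<close>
  define f where "f = (\<lambda>(\<omega>, n). if n = 0 then 0 else of_nat (n + 1) * z ^ n / \<omega> ^ (n + 2) :: complex)"
  define h where "h = (\<lambda>n. of_nat (Suc n) * (1/2) ^ n :: real)"
  have "h sums (1 / (1 - 1/2)\<^sup>2)" unfolding h_def by (rule geometric_deriv_sums) auto
  then have h: "(h has_sum 4) UNIV" by (intro sums_nonneg_imp_has_sum) (auto simp: h_def power2_eq_square)
  have "(\<lambda>(\<omega>, n). 1 / norm \<omega> ^ 3 * h n) summable_on (A \<times> UNIV)"
  proof (rule summable_on_SigmaI)
    show "((\<lambda>n. case (\<omega>, n) of (\<omega>, n) \<Rightarrow> 1 / norm \<omega> ^ 3 * h n) has_sum (1 / norm \<omega> ^ 3 * 4)) UNIV" for \<omega> :: complex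
      using has_sum_cmult_right[OF h, of "1 / norm \<omega> ^ 3"] by simp
    show "(\<lambda>\<omega>. 1 / norm \<omega> ^ 3 * 4) summable_on A"
      unfolding A_def by (rule summable_on_cmult_left[OF summable_cube])
  qed (auto simp: h_def)
  then have "(\<lambda>x. norm (f x)) summable_on (A \<times> UNIV)"
  proof (rule summable_on_comparison_test)
    fix x assume "x \<in> A \<times> (UNIV :: nat set)"
    then obtain \<omega> n where x: "x = (\<omega>, n)" and w: "\<omega> \<in> A" by auto
    show "norm (f x) \<le> (case x of (\<omega>, n) \<Rightarrow> 1 / norm \<omega> ^ 3 * h n)"
    proof (cases "n = 0")
      case False
      have w1: "norm \<omega> \<ge> 1" using norm_ge_1 w by (simp add: A_def)
      have "norm (f x) = of_nat (n + 1) * norm z ^ n / norm \<omega> ^ (n + 2)"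
        using False by (simp add: x f_def norm_divide norm_mult norm_power)
          (metis norm_of_nat of_nat_Suc add.commute)
      also have "\<dots> \<le> of_nat (n + 1) * (1/2) ^ n / norm \<omega> ^ 3"
        using z w1 False by (intro frac_le mult_left_mono power_mono power_increasing) auto
      finally show ?thesis by (simp add: x h_def add_ac)
    qed (auto simp: x f_def h_def)
  qed auto
  then have "f summable_on (A \<times> UNIV)" by (rule abs_summable_summable)
  then obtain S where S: "(f has_sum S) (A \<times> UNIV)" by (auto simp: summable_on_def)
  have row: "((\<lambda>n. f (\<omega>, n)) has_sum (1 / (z - \<omega>)\<^sup>2 - 1 / \<omega>\<^sup>2)) UNIV" if w: "\<omega> \<in> A" for \<omega>
  proof (rule norm_summable_imp_has_sum)
    have w1: "norm \<omega> \<ge> 1" and w0: "\<omega> \<noteq> 0" using norm_ge_1 w by (auto simp: A_def)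
    have q: "norm (z / \<omega>) < 1" using z w1 by (auto simp: norm_divide divide_simps)
    have "(\<lambda>n. 1 / \<omega>\<^sup>2 * (of_nat (Suc n) * (z / \<omega>) ^ n)) sums (1 / \<omega>\<^sup>2 * (1 / (1 - z / \<omega>)\<^sup>2))"
      by (intro sums_mult geometric_deriv_sums q)
    also have "1 / \<omega>\<^sup>2 * (1 / (1 - z / \<omega>)\<^sup>2) = 1 / (z - \<omega>)\<^sup>2"
    proof -
      have "1 - z / \<omega> = (\<omega> - z) / \<omega>" using w0 by (simp add: diff_divide_distrib)
      then show ?thesis using w0 by (simp add: power_divide power2_commute)
    qed
    finally have "(\<lambda>n. 1 / \<omega>\<^sup>2 * (of_nat (Suc n) * (z / \<omega>) ^ n) - (if n = 0 then 1 / \<omega>\<^sup>2 else 0)) sums (1 / (z - \<omega>)\<^sup>2 - 1 / \<omega>\<^sup>2)"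
      by (rule sums_diff[OF _ sums_single])
    moreover have "1 / \<omega>\<^sup>2 * (of_nat (Suc n) * (z / \<omega>) ^ n) - (if n = 0 then 1 / \<omega>\<^sup>2 else 0) = f (\<omega>, n)" for n
      by (auto simp: f_def power_divide power_add power2_eq_square)
    ultimately show "(\<lambda>n. f (\<omega>, n)) sums (1 / (z - \<omega>)\<^sup>2 - 1 / \<omega>\<^sup>2)" by simp
    show "summable (\<lambda>n. norm (f (\<omega>, n)))"
    proof (rule summable_comparison_test')
      show "summable h" using has_sum_imp_sums[OF h] by (rule sums_summable)
      show "norm (norm (f (\<omega>, n))) \<le> h n" for n
      proof (cases "n = 0")
        case False
        have "norm (f (\<omega>, n)) = of_nat (n + 1) * norm z ^ n / norm \<omega> ^ (n + 2)"
          using False by (simp add: f_def norm_divide norm_mult norm_power)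
            (metis norm_of_nat of_nat_Suc add.commute)
        also have "\<dots> \<le> of_nat (n + 1) * (1/2) ^ n / 1"
          using z w1 by (intro frac_le mult_left_mono power_mono one_le_power) auto
        finally show ?thesis by (simp add: h_def add_ac)
      qed (auto simp: f_def h_def)
    qed
  qed
  have "((\<lambda>\<omega>. 1 / (z - \<omega>)\<^sup>2 - 1 / \<omega>\<^sup>2) has_sum S) A"
    by (rule has_sum_Sigma'[OF S row])
  then have S_eq: "S = wp_reg z" by (simp add: wp_reg_def A_def infsumI)
  have S': "((\<lambda>(n, \<omega>). f (\<omega>, n)) has_sum S) (UNIV \<times> A)"
    using S by (subst (asm) has_sum_swap)
  have "((\<lambda>n. wp_coeff n * z ^ n) has_sum S) UNIV"
  proof (rule has_sum_Sigma'[OF S'])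
    fix n :: nat
    show "((\<lambda>\<omega>. case (n, \<omega>) of (n, \<omega>) \<Rightarrow> f (\<omega>, n)) has_sum (wp_coeff n * z ^ n)) A"
    proof (cases "n = 0")
      case False
      have "((\<lambda>\<omega>. 1 / \<omega> ^ (n + 2)) has_sum eisenstein (n + 2)) A"
        unfolding eisenstein_def A_def using False by (intro has_sum_infsum eisenstein_summable) auto
      from has_sum_cmult_right[OF this, of "of_nat (n + 1) * z ^ n"] False
      show ?thesis by (simp add: f_def wp_coeff_def mult_ac)
    qed (simp add: f_def)
  qed
  from has_sum_imp_sums[OF this] show ?thesis by (simp add: S_eq)
qed

definition wp_fps :: "complex fps" where
  "wp_fps = Abs_fps wp_coeff"

definition wp_fls :: "complex fls" where
  "wp_fls = fls_X_intpow (-2) + fps_to_fls wp_fps"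

lemma wp_has_laurent: "wp has_laurent_expansion wp_fls"
proof -
  have "wp_reg has_fps_expansion wp_fps"
  proof (rule has_fps_expansionI)
    have "eventually (\<lambda>z. z \<in> ball 0 (1/2 :: real)) (nhds (0::complex))"
      by (intro eventually_nhds_in_open) auto
    then show "eventually (\<lambda>z. (\<lambda>n. fps_nth wp_fps n * z ^ n) sums wp_reg z) (nhds 0)"
      by eventually_elim (use wp_reg_sums in \<open>auto simp: wp_fps_def\<close>)
  qed
  then have "(\<lambda>z. z powi (-2) + wp_reg z) has_laurent_expansion wp_fls"
    unfolding wp_fls_def by (intro laurent_expansion_intros has_laurent_expansion_fps)
  also have "(\<lambda>z. z powi (-2) + wp_reg z) = wp"
    by (auto simp: wp_def power_int_minus divide_inverse fun_eq_iff)
  finally show ?thesis .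
qed

lemma wp_fls_nth: "fls_nth wp_fls k = (if k = -2 then 1 else 0) + (if k < 0 then 0 else wp_coeff (nat k))"
  by (auto simp: wp_fls_def wp_fps_def)

text \<open>Square of a pole plus a power series: the two cross terms shift the coefficients by 2,
  the rest is a Cauchy product. One formula covers polar and regular orders, since the differential
  equation uses the former for its proof and the latter for the recursion.\<close>

lemma wp_fls_sq_nth: "fls_nth (wp_fls\<^sup>2) k = (if k = -4 then 1 else 0) 
    + 2 * (if k + 2 < 0 then 0 else wp_coeff (nat (k + 2)))
    + (if k < 0 then 0 else \<Sum>i\<le>nat k. wp_coeff i * wp_coeff (nat k - i))"
proof -
  define X where "X = (fls_X_intpow (-2) :: complex fls)"
  define P where "P = fps_to_fls wp_fps"
  have "wp_fls\<^sup>2 = X * X + (X * P + P * X) + P * P"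
    unfolding wp_fls_def X_def[symmetric] P_def[symmetric] by (simp only: power2_eq_square ring_distribs add_ac)
  moreover have "fls_nth (X * X) k = (if k = -4 then 1 else 0)"
    unfolding X_def fls_X_intpow_times_fls_X_intpow by auto
  moreover have "fls_nth (X * P) k = (if k + 2 < 0 then 0 else wp_coeff (nat (k + 2)))"
    unfolding X_def fls_X_intpow_times_conv_shift by (auto simp: P_def wp_fps_def)
  moreover have "fls_nth (P * X) k = (if k + 2 < 0 then 0 else wp_coeff (nat (k + 2)))"
    unfolding X_def fls_X_intpow_times_conv_shift by (auto simp: P_def wp_fps_def)
  moreover have "fls_nth (P * P) k = (if k < 0 then 0 else \<Sum>i\<le>nat k. wp_coeff i * wp_coeff (nat k - i))"
    by (simp add: P_def fls_times_fps_to_fls[symmetric] fps_mult_nth wp_fps_def atLeast0AtMost)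
  ultimately show ?thesis by simp
qed

section \<open>Periodic functions with removable singularities\<close>

lemma half_lattice_dist:
  assumes "\<And>x. x \<in> X \<Longrightarrow> 2 * x \<in> L" "x \<in> X" "y \<in> X" "x \<noteq> y"
  shows "norm (x - y) \<ge> 1/2"
proof -
  have "1 \<le> norm (2 * x - 2 * y)" using assms by (intro dist_ge_1) auto
  also have "\<dots> = 2 * norm (x - y)" by (metis norm_mult norm_numeral right_diff_distrib)
  finally show ?thesis by simp
qed

lemma closed_half_lattice:
  assumes "\<And>x. x \<in> X \<Longrightarrow> 2 * x \<in> L"
  shows "closed X"
proof (rule discrete_imp_closed[of "1/2"])
  show "\<forall>x\<in>X. \<forall>y\<in>X. dist y x < 1/2 \<longrightarrow> y = x"
  proof (intro ballI impI, rule ccontr)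
    fix x y assume "x \<in> X" "y \<in> X" "dist y x < 1/2" "y \<noteq> x"
    with half_lattice_dist[OF assms, of X y x] show False by (simp add: dist_norm)
  qed
qed simp

lemma eventually_not_half_lattice:
  assumes "\<And>x. x \<in> X \<Longrightarrow> 2 * x \<in> L"
  shows "eventually (\<lambda>z. z \<notin> X) (at a)"
proof -
  have "closed (X - {a})"
  proof (rule closed_half_lattice)
    fix x assume "x \<in> X - {a}"
    then show "2 * x \<in> L" using assms[of x] by blast
  qed
  then have "open (- (X - {a}))" by (rule open_Compl)
  from eventually_at_in_open[OF this, of a]
  have "eventually (\<lambda>z. z \<in> - (X - {a}) - {a}) (at a)" by simp
  then show ?thesis by (rule eventually_mono) blast
qed

lemma double_in: "\<mu> \<in> L \<Longrightarrow> 2 * \<mu> \<in> L"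
  unfolding mult_2 by (rule add_in)

lemma eventually_not_in_lattice: "eventually (\<lambda>z. z \<notin> L) (at a)"
  by (rule eventually_not_half_lattice[where X = L]) (rule double_in)

text \<open>Filling in the limits gives an entire function; \<open>cobounded\<close> and periodicity
  bound it by its values on a compact ball, and Liouville's theorem applies. The exceptional set
  \<open>X\<close> may lie in half the lattice because the translation formula also has singular
  points at translates by a half period.\<close>

lemma elliptic_const:
  assumes half: "\<And>x. x \<in> X \<Longrightarrow> 2 * x \<in> L"
    and holo: "f holomorphic_on - X"
    and lim: "\<And>x. x \<in> X \<Longrightarrow> \<exists>l. (f \<longlongrightarrow> l) (at x)"
    and per: "\<And>\<mu> z. \<mu> \<in> L \<Longrightarrow> z \<notin> X \<Longrightarrow> z + \<mu> \<notin> X \<and> f (z + \<mu>) = f z"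
  obtains c where "\<And>z. z \<notin> X \<Longrightarrow> f z = c"
proof -
  define g where "g = (\<lambda>z. if z \<in> X then Lim (at z) f else f z)"
  have flim: "(f \<longlongrightarrow> g x) (at x)" if "x \<in> X" for x
  proof -
    from lim[OF that] obtain l where l: "(f \<longlongrightarrow> l) (at x)" by blast
    then have "Lim (at x) f = l" by (intro tendsto_Lim) auto
    with l that show ?thesis by (simp add: g_def)
  qed
  have cl: "closed Y" if "Y \<subseteq> X" for Y
    using that half by (intro closed_half_lattice) auto
  have "g holomorphic_on UNIV"
  proof -
    have "g analytic_on {z}" for z
    proof (cases "z \<in> X")
      case False
      have "g holomorphic_on - X \<longleftrightarrow> f holomorphic_on - X" by (intro holomorphic_cong) (auto simp: g_def)
      moreover have "open (- X)" using cl[of X] by auto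
      ultimately show ?thesis using False holo by (auto simp: analytic_at)
    next
      case True
      define A where "A = - (X - {z})"
      have A: "open A" using cl[of "X - {z}"] unfolding A_def by (intro open_Compl) auto
      have "f holomorphic_on A - {z}" using True by (intro holomorphic_on_subset[OF holo]) (auto simp: A_def)
      from removable_singularity[OF this A flim[OF True]]
      have "(\<lambda>y. if y = z then g z else f y) holomorphic_on A" .
      moreover have "(\<lambda>y. if y = z then g z else f y) holomorphic_on A \<longleftrightarrow> g holomorphic_on A"
        by (intro holomorphic_cong) (auto simp: g_def A_def)
      ultimately show ?thesis using A by (auto simp: analytic_at A_def)
    qed
    then have "g analytic_on UNIV" using analytic_on_analytic_at by blast
    then show ?thesis by (rule analytic_imp_holomorphic)
  qed
  moreover have "bounded (range g)"
  proof -
    obtain R where R: "\<And>z. \<exists>\<omega>\<in>L. norm (z - \<omega>) \<le> R" using cobounded by blast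
    have "compact (g ` cball 0 R)"
      using \<open>g holomorphic_on UNIV\<close> 
      by (intro compact_continuous_image holomorphic_on_imp_continuous_on) (auto elim: holomorphic_on_subset)
    from compact_imp_bounded[OF this] obtain B where B: "\<And>z. z \<in> cball 0 R \<Longrightarrow> norm (g z) \<le> B"
      unfolding bounded_iff by blast
    have fB: "norm (f z) \<le> B" if z: "z \<notin> X" for z
    proof -
      obtain \<omega> where w: "\<omega> \<in> L" "norm (z - \<omega>) \<le> R" using R by blast
      have "z + - \<omega> \<notin> X \<and> f (z + - \<omega>) = f z" using per[OF minus_in[OF w(1)] z] .
      then show ?thesis using B[of "z - \<omega>"] w(2) by (simp add: g_def)
    qed
    have "norm (g z) \<le> B" for z
    proof (cases "z \<in> X")
      case True
      have "eventually (\<lambda>w. w \<notin> X) (at z)"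
        by (rule eventually_not_half_lattice) (rule half)
      then have "eventually (\<lambda>w. norm (f w) \<le> B) (at z)"
        by eventually_elim (rule fB)
      then show ?thesis by (intro Lim_norm_ubound[OF _ flim[OF True]]) auto
    next
      case False
      with fB[of z] show ?thesis by (simp add: g_def)
    qed
    then show ?thesis by (auto simp: bounded_iff)
  qed
  ultimately have "g constant_on UNIV" by (rule Liouville_theorem)
  then obtain c where "\<And>z. g z = c" by (auto simp: constant_on_def)
  then show ?thesis by (intro that[of c]) (metis g_def)
qed

text \<open>Reduces the limits that \<open>elliptic_const\<close> asks for to the one at the origin,
  where Laurent expansions are at hand.\<close>

lemma lim_shift:
  assumes "(f \<longlongrightarrow> l) (at (0 :: complex))" "eventually (\<lambda>z. f (z + a) = f z) (at 0)"
  shows "(f \<longlongrightarrow> l) (at a)"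
  unfolding filterlim_at_to_0[of f _ a]
  by (rule Lim_transform_eventually[OF assms(1)]) (use assms(2) in \<open>simp add: eq_commute\<close>)

section \<open>The differential equation and half periods\<close>

lemma deriv_wp_holomorphic: "deriv wp holomorphic_on - L"
  by (rule holomorphic_deriv[OF wp_holomorphic open_compl])

lemma deriv_wp_has_derivative: "z \<notin> L \<Longrightarrow> (deriv wp has_field_derivative deriv (deriv wp) z) (at z)"
  by (rule holomorphic_derivI[OF deriv_wp_holomorphic open_compl]) auto

lemma wp_has_derivative': "z \<notin> L \<Longrightarrow> (wp has_field_derivative deriv wp z) (at z)"
  by (rule holomorphic_derivI[OF wp_holomorphic open_compl]) auto

lemma deriv2_wp_periodic:
  assumes "\<mu> \<in> L" "z \<notin> L"
  shows "deriv (deriv wp) (z + \<mu>) = deriv (deriv wp) z"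
proof -
  have "eventually (\<lambda>w. w \<in> - L) (nhds z)" using assms open_compl by (intro eventually_nhds_in_open) auto
  then have ev: "eventually (\<lambda>w. deriv wp (w + \<mu>) = deriv wp w) (nhds z)"
    by eventually_elim (use assms add_in_iff[OF assms(1)] wp_deriv_periodic[OF assms(1)] in \<open>auto simp: deriv_wp\<close>)
  have "(deriv wp has_field_derivative deriv (deriv wp) (z + \<mu>)) (at (z + \<mu>))"
    using assms add_in_iff by (intro deriv_wp_has_derivative) auto
  then have "((\<lambda>w. deriv wp (w + \<mu>)) has_field_derivative deriv (deriv wp) (z + \<mu>)) (at z)"
    by (simp only: DERIV_shift)
  then have "deriv (deriv wp) (z + \<mu>) = deriv (\<lambda>w. deriv wp (w + \<mu>)) z"
    by (rule DERIV_imp_deriv[symmetric])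
  also have "\<dots> = deriv (deriv wp) z" by (rule deriv_cong_ev[OF ev refl])
  finally show ?thesis .
qed

lemma wp_ode_fls:
  shows "(\<lambda>z. deriv (deriv wp) z - 6 * (wp z)\<^sup>2 + 10 * wp_coeff 2) has_laurent_expansion
    fls_deriv (fls_deriv wp_fls) - fls_const 6 * wp_fls\<^sup>2 + fls_const (10 * wp_coeff 2)"
  by (intro laurent_expansion_intros wp_has_laurent)

text \<open>The difference of the two sides has no Laurent coefficient of order at most 0: the poles
  of the second derivative and of six times the square cancel, and \<open>10 * wp_coeff 2\<close>
  balances the constant terms, 2 and 12 times \<open>wp_coeff 2\<close>. So it tends to 0 at every
  lattice point and is constant, hence 0.\<close>

lemma wp_ode:
  assumes "z \<notin> L"
  shows "deriv (deriv wp) z = 6 * (wp z)\<^sup>2 - 10 * wp_coeff 2"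
proof -
  define W where "W = (\<lambda>z. deriv (deriv wp) z - 6 * (wp z)\<^sup>2 + 10 * wp_coeff 2)"
  define F where "F = fls_deriv (fls_deriv wp_fls) - fls_const 6 * wp_fls\<^sup>2 + fls_const (10 * wp_coeff 2)"
  have F: "W has_laurent_expansion F" unfolding W_def F_def by (rule wp_ode_fls)
  have F0: "fls_nth F k = 0" if "k \<le> 0" for k
  proof -
    have "k = 0 \<or> k = -1 \<or> k = -2 \<or> k = -3 \<or> k = -4 \<or> k < -4" using that by arith
    then show ?thesis
      using wp_coeff_odd[of 1] by (elim disjE) (simp_all add: F_def wp_fls_sq_nth wp_fls_nth)
  qed
  have "W \<midarrow>0\<rightarrow> fls_nth F 0"
    by (rule has_laurent_expansion_imp_tendsto_0[OF F]) (use F0 in \<open>auto intro!: fls_subdegree_ge0I\<close>)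
  then have W0: "W \<midarrow>0\<rightarrow> 0" using F0[of 0] by simp
  have per: "z + \<mu> \<notin> L \<and> W (z + \<mu>) = W z" if "\<mu> \<in> L" "z \<notin> L" for \<mu> z
    using that add_in_iff by (auto simp: W_def wp_periodic deriv2_wp_periodic)
  obtain c where c: "\<And>z. z \<notin> L \<Longrightarrow> W z = c"
  proof (rule elliptic_const[of L W])
    show "W holomorphic_on - L" unfolding W_def
      by (intro holomorphic_intros holomorphic_deriv wp_holomorphic open_compl)
    show "\<exists>l. (W \<longlongrightarrow> l) (at x)" if "x \<in> L" for x
    proof -
      have "eventually (\<lambda>z. W (z + x) = W z) (at 0)"
        using eventually_not_in_lattice by (rule eventually_mono) (use per that in auto)
      from lim_shift[OF W0 this] show ?thesis by blast
    qed
  qed (use per double_in in auto)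
  have "((\<lambda>_. c) \<longlongrightarrow> 0) (at (0::complex))"
    by (rule Lim_transform_eventually[OF W0]) (use eventually_not_in_lattice[of 0] c in \<open>auto elim!: eventually_mono\<close>)
  then have "c = 0" by (simp add: tendsto_const_iff)
  with c[OF assms] show ?thesis by (simp add: W_def algebra_simps)
qed

text \<open>Comparison of the coefficients of order \<open>k\<close> in the differential equation.
  The cross terms of the square contribute \<open>12 * wp_coeff (k + 2)\<close>, which is moved to
  the left; \<open>k \<ge> 1\<close> keeps clear of the constant term.\<close>

lemma wp_coeff_rec:
  assumes "k \<ge> 1"
  shows "(of_nat ((k + 2) * (k + 1)) - 12) * wp_coeff (k + 2) = 6 * (\<Sum>i\<le>k. wp_coeff i * wp_coeff (k - i))"
proof -
  define F where "F = fls_deriv (fls_deriv wp_fls) - fls_const 6 * wp_fls\<^sup>2 + fls_const (10 * wp_coeff 2)"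
  have "(\<lambda>z. deriv (deriv wp) z - 6 * (wp z)\<^sup>2 + 10 * wp_coeff 2) has_laurent_expansion F"
    unfolding F_def by (rule wp_ode_fls)
  also have "?this \<longleftrightarrow> (\<lambda>_. 0) has_laurent_expansion F"
    by (intro has_laurent_expansion_cong refl)
       (use eventually_not_in_lattice[of 0] wp_ode in \<open>auto elim!: eventually_mono\<close>)
  finally have "F = 0" using has_laurent_expansion_0 has_laurent_expansion_unique by blast
  then have "fls_nth F (int k) = 0" by simp
  moreover have "nat (int k + 2) = k + 2" "nat (2 + int k) = k + 2" by auto
  ultimately show ?thesis using assms
    by (simp add: F_def wp_fls_sq_nth wp_fls_nth algebra_simps)
qed

text \<open>The differential equation times twice the first derivative is an exact derivative. The
  integration constant, classically minus g_3, stays implicit; it is eliminated later by comparing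
  half periods.\<close>

lemma wp_first_integral:
  "\<exists>v. \<forall>z. z \<notin> L \<longrightarrow> (deriv wp z)\<^sup>2 = 4 * wp z ^ 3 - 20 * wp_coeff 2 * wp z + v"
proof -
  define V where "V = (\<lambda>z. (deriv wp z)\<^sup>2 - 4 * wp z ^ 3 + 20 * wp_coeff 2 * wp z)"
  have der: "(V has_field_derivative 0) (at z)" if z: "z \<in> - L" for z
  proof -
    have "(V has_field_derivative (2 * deriv wp z * deriv (deriv wp) z - 12 * (wp z)\<^sup>2 * deriv wp z + 20 * wp_coeff 2 * deriv wp z)) (at z)"
      unfolding V_def using z
      by (auto intro!: derivative_eq_intros wp_has_derivative' deriv_wp_has_derivative)
    also have "2 * deriv wp z * deriv (deriv wp) z - 12 * (wp z)\<^sup>2 * deriv wp z + 20 * wp_coeff 2 * deriv wp z = 0"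
      unfolding wp_ode[of z, OF ComplD[OF z]] by (simp add: algebra_simps)
    finally show ?thesis .
  qed
  obtain v where "\<And>z. z \<in> - L \<Longrightarrow> V z = v"
  proof (rule DERIV_zero_connected_constant[OF connected_compl open_compl, of "{}" V])
    show "continuous_on (- L) V"
      using der by (intro continuous_at_imp_continuous_on ballI) (blast intro: DERIV_isCont)
  qed (use der in auto)
  then show ?thesis by (intro exI[of _ v]) (force simp: V_def algebra_simps)
qed

lemma wp_at_infinity: "filterlim wp at_infinity (at 0)"
proof -
  have "filterlim (\<lambda>z. 1 / z\<^sup>2 :: complex) at_infinity (at 0)"
    by (intro filterlim_divide_at_infinity[of _ 1]) (auto intro!: tendsto_eq_intros simp: filterlim_at eventually_at_filter)
  moreover have "(wp_reg \<longlongrightarrow> wp_reg 0) (at 0)"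
    using DERIV_isCont[OF wp_reg_has_derivative[of 0]] by (simp add: isCont_def)
  ultimately have "filterlim (\<lambda>z. wp_reg z + 1 / z\<^sup>2) at_infinity (at 0)"
    by (intro tendsto_add_filterlim_at_infinity)
  then show ?thesis by (simp add: wp_def[abs_def] add.commute)
qed

text \<open>Both translates solve the same second order equation with the same initial values.\<close>
lemma wp_eq_imp_diff_in:
  assumes a: "a \<notin> L" and b: "b \<notin> L" and eq: "wp a = wp b" and deq: "deriv wp a = deriv wp b"
  shows "a - b \<in> L"
proof (rule ccontr)
  assume ab: "a - b \<notin> L"
  define X where "X = (\<lambda>z. z + a) -` L \<union> (\<lambda>z. z + b) -` L"
  have X: "z \<in> X \<longleftrightarrow> z + a \<in> L \<or> z + b \<in> L" for z
    by (simp add: X_def)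
  have "(\<lambda>z. z + x) -` L \<subseteq> (\<lambda>\<omega>. \<omega> - x) ` L" for x
  proof
    fix z assume "z \<in> (\<lambda>z. z + x) -` L"
    then show "z \<in> (\<lambda>\<omega>. \<omega> - x) ` L" by (intro image_eqI[of _ _ "z + x"]) auto
  qed
  then have "countable ((\<lambda>z. z + x) -` L)" for x
    by (rule countable_subset) (rule countable_image[OF countable_lattice])
  then have "countable X" unfolding X_def by simp
  then have conn: "connected (- X)"
    by (intro path_connected_imp_connected path_connected_complement_countable) auto
  have "closed L" by (rule closed_subset) simp
  then have "closed X"
    unfolding X_def by (intro closed_Un closed_vimage continuous_intros)
  then have op: "open (- X)" by auto
  define d where "d = (\<lambda>z. wp (z + a) - wp (z + b))"
  \<comment> \<open>The nonlinear equations of the two translates subtract to a linear one for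
    \<open>d\<close>, because
    \<open>6 * p\<^sup>2 - 6 * q\<^sup>2 = 6 * (p + q) * (p - q)\<close>.\<close>
  define s where "s = (\<lambda>z. 6 * (wp (z + a) + wp (z + b)))"
  have sh: "(\<lambda>z. f (z + x)) holomorphic_on - X" if "f holomorphic_on - L" "x = a \<or> x = b" for f x
  proof -
    have "f \<circ> (\<lambda>z. z + x) holomorphic_on - X"
      by (rule holomorphic_on_compose_gen[OF _ that(1)]) (use that(2) in \<open>auto intro!: holomorphic_intros simp: X\<close>)
    then show ?thesis by (simp add: o_def)
  qed
  have d_holo: "d holomorphic_on - X" unfolding d_def by (intro holomorphic_intros sh wp_holomorphic) auto
  have s_holo: "s holomorphic_on - X" unfolding s_def by (intro holomorphic_intros sh wp_holomorphic) auto
  have z0: "0 \<in> - X" using a b by (simp add: X)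
  have d1: "deriv d z = deriv wp (z + a) - deriv wp (z + b)" if "z \<in> - X" for z
  proof (rule DERIV_imp_deriv)
    have "z + a \<notin> L" "z + b \<notin> L" using that X by auto
    from this[THEN wp_has_derivative']
    have "((\<lambda>z. wp (z + a)) has_field_derivative deriv wp (z + a)) (at z)"
         "((\<lambda>z. wp (z + b)) has_field_derivative deriv wp (z + b)) (at z)"
      by (simp_all only: DERIV_shift)
    then show "(d has_field_derivative deriv wp (z + a) - deriv wp (z + b)) (at z)"
      unfolding d_def by (rule DERIV_diff)
  qed
  have d2: "deriv (deriv d) z = s z * d z" if "z \<in> - X" for z
  proof -
    have "eventually (\<lambda>w. w \<in> - X) (nhds z)" using that op by (intro eventually_nhds_in_open)
    then have ev: "eventually (\<lambda>w. deriv d w = deriv wp (w + a) - deriv wp (w + b)) (nhds z)"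
      by eventually_elim (rule d1)
    have n: "z + a \<notin> L" "z + b \<notin> L" using that X by auto
    from n[THEN deriv_wp_has_derivative]
    have "((\<lambda>z. deriv wp (z + a)) has_field_derivative deriv (deriv wp) (z + a)) (at z)"
         "((\<lambda>z. deriv wp (z + b)) has_field_derivative deriv (deriv wp) (z + b)) (at z)"
      by (simp_all only: DERIV_shift)
    then have "deriv (\<lambda>w. deriv wp (w + a) - deriv wp (w + b)) z = deriv (deriv wp) (z + a) - deriv (deriv wp) (z + b)"
      by (intro DERIV_imp_deriv DERIV_diff)
    also have "\<dots> = s z * d z"
      unfolding wp_ode[OF n(1)] wp_ode[OF n(2)] s_def d_def by algebra
    finally show ?thesis using deriv_cong_ev[OF ev refl] by simp
  qed
  define D where "D = fps_expansion d 0"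
  define S where "S = fps_expansion s 0"
  have D: "d has_fps_expansion D" and S: "s has_fps_expansion S"
    unfolding D_def S_def using d_holo s_holo op z0
    by (auto intro!: analytic_at_imp_has_fps_expansion_0 simp: analytic_at)
  have SD: "fps_deriv (fps_deriv D) = S * D"
  proof (rule fps_expansion_unique_complex)
    show "deriv (deriv d) has_fps_expansion fps_deriv (fps_deriv D)"
      by (rule has_fps_expansion_deriv[OF has_fps_expansion_deriv[OF D]])
    have "eventually (\<lambda>z. deriv (deriv d) z = s z * d z) (nhds 0)"
      using eventually_nhds_in_open[OF op z0] by eventually_elim (rule d2)
    from has_fps_expansion_cong[OF this refl] has_fps_expansion_mult[OF S D]
    show "deriv (deriv d) has_fps_expansion S * D" by (rule iffD2)
  qed
  have D0: "fps_nth D 0 = 0"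
    using has_fps_expansion_imp_0_eq_fps_nth_0[OF D] eq by (simp add: d_def)
  have D1: "fps_nth D 1 = 0"
    using has_fps_expansion_imp_0_eq_fps_nth_0[OF has_fps_expansion_deriv[OF D]] d1[OF z0] deq by simp
  \<comment> \<open>The equation determines the coefficient of index \<open>m + 2\<close> from those
    up to \<open>m\<close>, so vanishing initial data force \<open>D = 0\<close>.\<close>
  have "fps_nth D n = 0" for n
  proof (induction n rule: less_induct)
    case (less n)
    show ?case
    proof (cases "n < 2")
      case True
      then have "n = 0 \<or> n = 1" by auto
      with D0 D1 show ?thesis by auto
    next
      case False
      define m where "m = n - 2"
      have n: "n = Suc (Suc m)" using False by (simp add: m_def)
      have "fps_nth (fps_deriv (fps_deriv D)) m = 0"
        unfolding SD fps_mult_nth using less n by (intro sum.neutral) auto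
      then have "of_nat (Suc m) * (of_nat (Suc (Suc m)) * fps_nth D n) = 0" by (simp add: n)
      then show ?thesis unfolding mult_eq_0_iff of_nat_eq_0_iff by (elim disjE) simp_all
    qed
  qed
  then have "D = 0" by (simp add: fps_eq_iff)
  with D have dz: "d has_fps_expansion 0" by (simp only:)
  have d0: "d z = 0" if "z \<in> - X" for z
    by (rule has_fps_expansion_0_analytic_continuation[OF dz d_holo op conn z0 that])
  \<comment> \<open>At \<open>- a\<close> the first translate has a pole, while the second stays
    finite because \<open>b - a\<close> is not in the lattice; yet the two agree nearby.\<close>
  have "filterlim (\<lambda>z. wp (z + a)) at_infinity (at (- a))"
    unfolding filterlim_at_to_0[of "\<lambda>z. wp (z + a)" at_infinity "- a"] using wp_at_infinity by simp
  moreover have "((\<lambda>z. wp (z + a)) \<longlongrightarrow> wp (b - a)) (at (- a))"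
  proof (rule Lim_transform_eventually)
    have "isCont wp (b - a)"
      using ab minus_in_iff[of "b - a"] by (intro DERIV_isCont[OF wp_has_derivative]) auto
    then show "((\<lambda>z. wp (z + b)) \<longlongrightarrow> wp (b - a)) (at (- a))"
      by (intro isCont_tendsto_compose[of _ wp]) (auto intro!: tendsto_eq_intros)
    have e1: "eventually (\<lambda>z. z + a \<notin> L) (at (- a))"
      unfolding eventually_at_to_0[of _ "- a"] using eventually_not_in_lattice[of 0] by simp
    have e2: "eventually (\<lambda>z. z + b \<notin> L) (at (- a))"
    proof -
      have "z + - a + b = z + (b - a)" for z by simp
      then show ?thesis
        using eventually_not_in_lattice[of "b - a"]
        unfolding eventually_at_to_0[of _ "- a"] eventually_at_to_0[of _ "b - a"] by (simp only:)
    qed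
    from e1 e2
show "eventually (\<lambda>z. wp (z + b) = wp (z + a)) (at (- a))"
      by eventually_elim (use d0 X in \<open>auto simp: d_def\<close>)
  qed
  ultimately show False using not_tendsto_and_filterlim_at_infinity[OF at_neq_bot] by blast
qed

text \<open>The derivative vanishes at a half period, so \<open>wp (z + w) - wp w\<close> has at
  least a double zero at 0, which cancels the double pole of \<open>wp\<close>. Translation by
  \<open>w\<close> only swaps the factors, so the product is regular at the translates too, hence
  constant. Its value at 0 is half the second derivative of \<open>wp\<close> at
  \<open>w\<close>.\<close>

lemma wp_half_period_translate:
  assumes w: "w \<notin> L" "2 * w \<in> L" and z: "z \<notin> L" "z + w \<notin> L"
  shows "(wp (z + w) - wp w) * (wp z - wp w) = 3 * (wp w)\<^sup>2 - 5 * wp_coeff 2"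
proof -
  define e where "e = wp w"
  define X where "X = {z. z \<in> L \<or> z + w \<in> L}"
  define M where "M = (\<lambda>z. (wp (z + w) - e) * (wp z - e))"
  have half: "2 * x \<in> L" if "x \<in> X" for x
  proof (cases "x \<in> L")
    case False
    then have "x + w \<in> L" using that by (auto simp: X_def)
    then have "2 * (x + w) \<in> L" by (rule double_in)
    then have "2 * x + 2 * w \<in> L" by (simp only: distrib_left)
    then show ?thesis using add_in_iff[OF w(2)] by blast
  qed (rule double_in)
  have per: "z + \<mu> \<notin> X \<and> M (z + \<mu>) = M z" if "\<mu> \<in> L" "z \<notin> X" for \<mu> z
  proof -
    have "z \<notin> L" "z + w \<notin> L" using that by (auto simp: X_def)
    moreover have "z + \<mu> \<notin> L" "z + w + \<mu> \<notin> L" using calculation add_in_iff[OF that(1)] by auto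
    ultimately show ?thesis using wp_periodic[OF that(1), of z] wp_periodic[OF that(1), of "z + w"]
      by (simp add: X_def M_def add_ac)
  qed
  have perw: "M (z + w) = M z" if "z \<notin> X" for z
    using that wp_periodic[OF w(2), of z] by (simp add: X_def M_def mult_2 add_ac mult.commute)
  define U where "U = fps_expansion (\<lambda>z. wp (w + z) - e) 0"
  define u where "u = (\<lambda>z. wp (w + z) - e)"
  define A where "A = (\<lambda>z. w + z) -` (- L)"
  have A: "open A" "0 \<in> A"
    using w open_compl by (auto simp: A_def intro!: open_vimage continuous_intros)
  have der: "(u has_field_derivative deriv wp (w + z)) (at z)"
       "((\<lambda>z. deriv wp (w + z)) has_field_derivative deriv (deriv wp) (w + z)) (at z)" if "z \<in> A" for z
  proof -
    have n: "z + w \<notin> L" using that by (simp add: A_def add.commute)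
    have 1: "((\<lambda>z. wp (z + w)) has_field_derivative deriv wp (z + w)) (at z)"
      using wp_has_derivative'[OF n] by (simp only: DERIV_shift)
    have 2: "((\<lambda>z. deriv wp (z + w)) has_field_derivative deriv (deriv wp) (z + w)) (at z)"
      using deriv_wp_has_derivative[OF n] by (simp only: DERIV_shift)
    show "(u has_field_derivative deriv wp (w + z)) (at z)"
      using DERIV_diff[OF 1 DERIV_const[of e]] by (simp add: u_def add.commute)
    show "((\<lambda>z. deriv wp (w + z)) has_field_derivative deriv (deriv wp) (w + z)) (at z)"
      using 2 by (simp add: add.commute)
  qed
  have "u holomorphic_on A" using der(1) A(1) by (auto simp: holomorphic_on_open)
  then have U: "u has_fps_expansion U" unfolding U_def u_def[symmetric] using A
    by (intro analytic_at_imp_has_fps_expansion_0) (auto simp: analytic_at)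
  have evA: "eventually (\<lambda>z. z \<in> A) (nhds 0)" using A by (intro eventually_nhds_in_open)
  have U1': "(\<lambda>z. deriv wp (w + z)) has_fps_expansion fps_deriv U"
  proof -
    have "eventually (\<lambda>z. deriv u z = deriv wp (w + z)) (nhds 0)"
      using evA by eventually_elim (auto intro: DERIV_imp_deriv der)
    from has_fps_expansion_cong[OF this refl] has_fps_expansion_deriv[OF U] show ?thesis by blast
  qed
  have U2': "(\<lambda>z. deriv (deriv wp) (w + z)) has_fps_expansion fps_deriv (fps_deriv U)"
  proof -
    have "eventually (\<lambda>z. deriv (\<lambda>z. deriv wp (w + z)) z = deriv (deriv wp) (w + z)) (nhds 0)"
      using evA by eventually_elim (auto intro: DERIV_imp_deriv der)
    from has_fps_expansion_cong[OF this refl] has_fps_expansion_deriv[OF U1'] show ?thesis by blast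
  qed
  have U0: "fps_nth U 0 = 0" using has_fps_expansion_imp_0_eq_fps_nth_0[OF U] by (simp add: u_def e_def)
  have U1: "fps_nth U 1 = 0" 
    using has_fps_expansion_imp_0_eq_fps_nth_0[OF U1'] wp_deriv_half_period[OF w] by (simp add: deriv_wp w)
  have U2: "fps_nth U 2 = 3 * e\<^sup>2 - 5 * wp_coeff 2"
  proof -
    have "deriv (deriv wp) w = 2 * fps_nth U 2"
      using has_fps_expansion_imp_0_eq_fps_nth_0[OF U2'] by (simp add: eval_nat_numeral)
    then have "2 * fps_nth U 2 = 2 * (3 * e\<^sup>2 - 5 * wp_coeff 2)"
      unfolding wp_ode[OF w(1)] e_def by simp
    then show ?thesis by algebra
  qed
  define F where "F = fps_to_fls U * (wp_fls - fls_const e)"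
  have F: "M has_laurent_expansion F"
  proof -
    have "(\<lambda>z. u z * (wp z - e)) has_laurent_expansion F" unfolding F_def
      by (intro laurent_expansion_intros has_laurent_expansion_fps U wp_has_laurent)
    then show ?thesis by (simp add: M_def u_def add.commute)
  qed
  define X' where "X' = (fls_X_intpow (-2) :: complex fls)"
  \<comment> \<open>In orders up to 0 only the pole times the expansion of \<open>u\<close>, which
    starts at order 2, can contribute; the other product has no constant term.\<close>
  have F_eq: "F = X' * fps_to_fls U + fps_to_fls (U * (wp_fps - fps_const e))"
  proof -
    have "fps_to_fls (wp_fps - fps_const e) = fps_to_fls wp_fps - fls_const e"
      by (intro fls_eqI) (auto simp: fls_const_def)
    then show ?thesis unfolding fls_times_fps_to_fls F_def wp_fls_def X'_def[symmetric]
      by (simp only: ring_distribs mult.commute add_diff_eq)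
  qed
  have Fn: "fls_nth F k = (if k = 0 then 3 * e\<^sup>2 - 5 * wp_coeff 2 else 0)" if "k \<le> 0" for k
  proof -
    have "fls_nth (X' * fps_to_fls U) k = (if k + 2 < 0 then 0 else fps_nth U (nat (k + 2)))"
      unfolding X'_def fls_X_intpow_times_conv_shift by auto
    moreover have "k = 0 \<or> k = -1 \<or> k = -2 \<or> k < -2" using that by arith
    ultimately show ?thesis using U0 U1 U2 by (auto simp: F_eq)
  qed
  have "M \<midarrow>0\<rightarrow> fls_nth F 0"
    by (rule has_laurent_expansion_imp_tendsto_0[OF F]) (use Fn in \<open>auto intro!: fls_subdegree_ge0I\<close>)
  then have M0: "M \<midarrow>0\<rightarrow> 3 * e\<^sup>2 - 5 * wp_coeff 2" using Fn[of 0] by simp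
  have ev0: "eventually (\<lambda>z. z \<notin> X) (at 0)" by (rule eventually_not_half_lattice[OF half])
  obtain c where c: "\<And>z. z \<notin> X \<Longrightarrow> M z = c"
  proof (rule elliptic_const[OF half])
    show "M holomorphic_on - X"
    proof -
      have "wp \<circ> (\<lambda>z. z + w) holomorphic_on - X"
        by (rule holomorphic_on_compose_gen[OF _ wp_holomorphic]) (auto intro!: holomorphic_intros simp: X_def)
      moreover have "wp holomorphic_on - X" by (rule holomorphic_on_subset[OF wp_holomorphic]) (auto simp: X_def)
      ultimately show ?thesis unfolding M_def by (auto intro!: holomorphic_intros simp: o_def)
    qed
    show "\<exists>l. (M \<longlongrightarrow> l) (at x)" if x: "x \<in> X" for x
    proof (cases "x \<in> L")
      case True
      have "eventually (\<lambda>z. M (z + x) = M z) (at 0)"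
        using ev0 by (rule eventually_mono) (use per True in auto)
      from lim_shift[OF M0 this] show ?thesis by blast
    next
      case False
      then have xw: "x - w \<in> L" using x w diff_in[of "x + w" "2 * w"] by (auto simp: X_def)
      have "eventually (\<lambda>z. M (z + x) = M z) (at 0)"
        using ev0
      proof (rule eventually_mono)
        fix z assume z: "z \<notin> X"
        have "z + (x - w) \<notin> X" "M (z + (x - w)) = M z" using per[OF xw z] by auto
        with perw[of "z + (x - w)"] show "M (z + x) = M z" by simp
      qed
      from lim_shift[OF M0 this] show ?thesis by blast
    qed
  qed (use per in auto)
  have "((\<lambda>_. c) \<longlongrightarrow> 3 * e\<^sup>2 - 5 * wp_coeff 2) (at (0::complex))"
    by (rule Lim_transform_eventually[OF M0]) (use ev0 c in \<open>auto elim!: eventually_mono\<close>)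
  then have "c = 3 * e\<^sup>2 - 5 * wp_coeff 2" by (simp add: tendsto_const_iff)
  with c[of z] z show ?thesis by (simp add: M_def X_def e_def)
qed

text \<open>The derivative vanishes at all three points, so their \<open>wp\<close> values are
  distinct by \<open>wp_eq_imp_diff_in\<close>. They are the roots of a cubic without quadratic term
  and therefore add up to 0.\<close>

lemma wp_half_periods_sum:
  assumes ab: "a \<notin> L" "2 * a \<in> L" "b \<notin> L" "2 * b \<in> L" and c: "c \<notin> L" "2 * c \<in> L"
    and dist: "a - b \<notin> L" "a - c \<notin> L" "b - c \<notin> L"
  shows "wp a + wp b + wp c = 0"
proof -
  obtain v where v: "\<And>z. z \<notin> L \<Longrightarrow> (deriv wp z)\<^sup>2 = 4 * wp z ^ 3 - 20 * wp_coeff 2 * wp z + v"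
    using wp_first_integral by blast
  have d0: "deriv wp a = 0" "deriv wp b = 0" "deriv wp c = 0"
    using ab c by (simp_all add: deriv_wp wp_deriv_half_period)
  have r: "4 * wp a ^ 3 - 20 * wp_coeff 2 * wp a + v = 0" "4 * wp b ^ 3 - 20 * wp_coeff 2 * wp b + v = 0"
      "4 * wp c ^ 3 - 20 * wp_coeff 2 * wp c + v = 0"
    using v[of a] v[of b] v[of c] d0 ab c by simp_all
  have ne: "wp a \<noteq> wp b" "wp a \<noteq> wp c" "wp b \<noteq> wp c"
    using wp_eq_imp_diff_in[of a b] wp_eq_imp_diff_in[of a c] wp_eq_imp_diff_in[of b c] ab c dist d0 by auto
  \<comment> \<open>Two of the cubic equations are subtracted and divided by
    \<open>4 * (x - y)\<close>, which removes the unknown \<open>v\<close>.\<close>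
  have q: "x\<^sup>2 + x * y + y\<^sup>2 = 5 * p" if "4 * x ^ 3 - 20 * p * x + v = 0" "4 * y ^ 3 - 20 * p * y + v = 0" "x \<noteq> y" for x y p :: complex
  proof -
    have "4 * (x - y) * (x\<^sup>2 + x * y + y\<^sup>2 - 5 * p) = 0"
      using that(1,2) by algebra
    then show ?thesis using that(3) by simp
  qed
  have "(wp b - wp c) * (wp a + wp b + wp c) = 0"
    using q[OF r(1) r(2) ne(1)] q[OF r(1) r(3) ne(2)] by algebra
  then show ?thesis using ne by simp
qed

text \<open>Division by 0 gives 0, so the term at \<open>\<mu> = 0\<close> is
  \<open>1 / z\<^sup>2\<close>, and pole and regular part fit into one sum over the whole
  lattice.\<close>

lemma wp_has_sum:
  assumes "z \<notin> L"
  shows "((\<lambda>\<mu>. 1 / (z - \<mu>)\<^sup>2 - 1 / \<mu>\<^sup>2) has_sum wp z) L"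
proof -
  have "((\<lambda>\<mu>. 1 / (z - \<mu>)\<^sup>2 - 1 / \<mu>\<^sup>2) has_sum
      ((1 / (z - 0)\<^sup>2 - 1 / 0\<^sup>2) + (\<Sum>\<^sub>\<infinity>\<mu>\<in>L - {0}. 1 / (z - \<mu>)\<^sup>2 - 1 / \<mu>\<^sup>2))) L"
    using assms by (intro infsum_insert_0 wp_reg_summable) auto
  then show ?thesis by (simp add: wp_def wp_reg_def)
qed

section \<open>Symmetries of the lattice, and the recursion for the coefficients\<close>

lemma bij_cnj:
  assumes "cnj ` L \<subseteq> L"
  shows "bij_betw cnj (L - {0}) (L - {0})" "bij_betw cnj L L"
  using assms by (auto intro!: bij_betwI[of _ _ _ cnj])

lemma wp_reg_cnj:
  assumes "cnj ` L \<subseteq> L"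
  shows "wp_reg (cnj z) = cnj (wp_reg z)"
  using infsum_reindex_bij_betw[OF bij_cnj(1)[OF assms], of "\<lambda>\<omega>. 1 / (cnj z - \<omega>)\<^sup>2 - 1 / \<omega>\<^sup>2"]
  by (simp add: wp_reg_def flip: infsum_cnj)

lemma wp_cnj: "cnj ` L \<subseteq> L \<Longrightarrow> wp (cnj z) = cnj (wp z)"
  by (simp add: wp_def wp_reg_cnj)

lemma wp_deriv_cnj:
  assumes "cnj ` L \<subseteq> L"
  shows "wp_deriv (cnj z) = cnj (wp_deriv z)"
  using infsum_reindex_bij_betw[OF bij_cnj(2)[OF assms], of "\<lambda>\<omega>. -2 / (cnj z - \<omega>) ^ 3"]
  by (simp add: wp_deriv_def flip: infsum_cnj)

lemma bij_mult_ii: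
  assumes "(*) \<i> ` L \<subseteq> L"
  shows "bij_betw ((*) \<i>) (L - {0}) (L - {0})"
proof (rule bij_betwI[of _ _ _ "\<lambda>z. - (\<i> * z)"])
  show "(\<lambda>z. - (\<i> * z)) \<in> L - {0} \<rightarrow> L - {0}"
    using assms minus_in by auto
qed (use assms in \<open>auto simp: mult.assoc[symmetric]\<close>)

lemma wp_mult_ii:
  assumes "(*) \<i> ` L \<subseteq> L"
  shows "wp (\<i> * z) = - wp z"
proof -
  have "wp_reg (\<i> * z) = (\<Sum>\<^sub>\<infinity>\<omega>\<in>L - {0}. 1 / (\<i> * z - \<i> * \<omega>)\<^sup>2 - 1 / (\<i> * \<omega>)\<^sup>2)"
    using infsum_reindex_bij_betw[OF bij_mult_ii[OF assms], of "\<lambda>\<omega>. 1 / (\<i> * z - \<omega>)\<^sup>2 - 1 / \<omega>\<^sup>2"]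
    by (simp add: wp_reg_def)
  also have "\<dots> = (\<Sum>\<^sub>\<infinity>\<omega>\<in>L - {0}. - (1 / (z - \<omega>)\<^sup>2 - 1 / \<omega>\<^sup>2))"
  proof (rule infsum_cong)
    fix \<omega>
    have "(\<i> * z - \<i> * \<omega>)\<^sup>2 = - ((z - \<omega>)\<^sup>2)" "(\<i> * \<omega>)\<^sup>2 = - (\<omega>\<^sup>2)"
      by (simp_all add: power_mult_distrib flip: right_diff_distrib)
    then show "1 / (\<i> * z - \<i> * \<omega>)\<^sup>2 - 1 / (\<i> * \<omega>)\<^sup>2 = - (1 / (z - \<omega>)\<^sup>2 - 1 / \<omega>\<^sup>2)" by simp
  qed
  also have "\<dots> = - wp_reg z" unfolding wp_reg_def by (rule infsum_uminus)
  finally show ?thesis by (simp add: wp_def power_mult_distrib)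
qed

text \<open>Reindexing by multiplication with \<open>\<i>\<close> turns the series into its
  negative, as \<open>\<i> ^ k = - 1\<close>.\<close>

lemma eisenstein_mult_ii:
  assumes "(*) \<i> ` L \<subseteq> L" "k mod 4 = 2"
  shows "eisenstein k = 0"
proof -
  have ik: "\<i> ^ k = - 1"
  proof -
    have "\<i> ^ (4 * (k div 4) + k mod 4) = (\<i> ^ 4) ^ (k div 4) * \<i> ^ (k mod 4)"
      by (simp only: power_add power_mult)
    also have "4 * (k div 4) + k mod 4 = k" by (rule mult_div_mod_eq)
    finally show ?thesis using assms(2) by (simp add: power4_eq_xxxx)
  qed
  have "eisenstein k = (\<Sum>\<^sub>\<infinity>\<omega>\<in>L - {0}. - (1 / \<omega> ^ k))"
    using infsum_reindex_bij_betw[OF bij_mult_ii[OF assms(1)], of "\<lambda>\<omega>. 1 / \<omega> ^ k"] ik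
    by (simp add: eisenstein_def power_mult_distrib)
  also have "\<dots> = - eisenstein k" unfolding eisenstein_def by (rule infsum_uminus)
  finally show ?thesis by simp
qed

text \<open>Coefficients with odd index and with index 0 vanish, so only
  \<open>i = 2 * j - 2\<close> with \<open>j\<close> from 2 to \<open>n - 2\<close> survives. This
  produces the range of summation in \<open>r_seq\<close> and \<open>s_seq\<close>.\<close>

lemma wp_coeff_convolution:
  assumes n: "n \<ge> 4"
  shows "(\<Sum>i\<le>2 * n - 4. wp_coeff i * wp_coeff (2 * n - 4 - i)) =
    (\<Sum>j = 2..n - 2. wp_coeff (2 * j - 2) * wp_coeff (2 * (n - j) - 2))"
proof -
  define h where "h = (\<lambda>j::nat. 2 * j - 2)"
  have inj: "inj_on h {2..n - 2}" by (auto simp: inj_on_def h_def)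
  have "(\<Sum>i\<le>2 * n - 4. wp_coeff i * wp_coeff (2 * n - 4 - i)) =
      (\<Sum>i\<in>h ` {2..n - 2}. wp_coeff i * wp_coeff (2 * n - 4 - i))"
  proof (rule sum.mono_neutral_right)
    show "h ` {2..n - 2} \<subseteq> {..2 * n - 4}" using n by (auto simp: h_def)
    show "\<forall>i\<in>{..2 * n - 4} - h ` {2..n - 2}. wp_coeff i * wp_coeff (2 * n - 4 - i) = 0"
    proof
      fix i assume i: "i \<in> {..2 * n - 4} - h ` {2..n - 2}"
      show "wp_coeff i * wp_coeff (2 * n - 4 - i) = 0"
      proof (cases "odd i")
        case True
        then show ?thesis by (simp add: wp_coeff_odd)
      next
        case False
        then obtain l where l: "i = 2 * l" by (auto elim!: evenE)
        have "l = 0 \<or> l = n - 2 \<or> (1 \<le> l \<and> l \<le> n - 3)" using i l by auto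
        moreover have "\<not> (1 \<le> l \<and> l \<le> n - 3)"
        proof
          assume "1 \<le> l \<and> l \<le> n - 3"
          then have "i = h (l + 1)" "l + 1 \<in> {2..n - 2}" using n by (auto simp: h_def l)
          then show False using i by blast
        qed
        ultimately have "l = 0 \<or> l = n - 2" by blast
        moreover have "2 * n - 4 - 2 * (n - 2) = 0" by simp
        ultimately show ?thesis by (elim disjE) (simp_all add: l)
      qed
    qed
  qed simp
  also have "\<dots> = (\<Sum>j = 2..n - 2. wp_coeff (h j) * wp_coeff (2 * n - 4 - h j))"
    by (simp add: sum.reindex[OF inj])
  also have "\<dots> = (\<Sum>j = 2..n - 2. wp_coeff (2 * j - 2) * wp_coeff (2 * (n - j) - 2))"
  proof (rule sum.cong)
    fix j assume "j \<in> {2..n - 2}"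
    then have "2 * n - 4 - h j = 2 * (n - j) - 2" using n by (auto simp: h_def)
    then show "wp_coeff (h j) * wp_coeff (2 * n - 4 - h j) = wp_coeff (2 * j - 2) * wp_coeff (2 * (n - j) - 2)"
      by (simp add: h_def)
  qed simp
  finally show ?thesis .
qed

text \<open>The recursion is homogeneous when \<open>wp_coeff (2 * n - 2)\<close> is given weight
  \<open>2 * n\<close>, so a scale \<open>w\<close> passes through it and the first two coefficients
  decide everything.\<close>

lemma wp_coeff_eq_seq:
  fixes q :: "nat \<Rightarrow> rat" and w :: real
  assumes rec: "\<And>n. n \<ge> 4 \<Longrightarrow> (2 * of_nat n + 1) * (of_nat n - 3) * q n = 3 * (\<Sum>j = 2..n - 2. q j * q (n - j))"
    and base: "wp_coeff 2 = of_rat (q 2) * of_real w ^ 4" "wp_coeff 4 = of_rat (q 3) * of_real w ^ 6"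
    and n: "n \<ge> 2"
  shows "wp_coeff (2 * n - 2) = of_rat (q n) * of_real w ^ (2 * n)"
  using n
proof (induction n rule: less_induct)
  case (less n)
  define W where "W = complex_of_real w"
  consider "n = 2" | "n = 3" | "n \<ge> 4" using less.prems by linarith
  then show ?case
  proof cases
    case 3
    define m where "m = n - 4"
    have m: "n = m + 4" using 3 by (simp add: m_def)
    have "(\<Sum>j = 2..n - 2. wp_coeff (2 * j - 2) * wp_coeff (2 * (n - j) - 2)) =
        (\<Sum>j = 2..n - 2. of_rat (q j * q (n - j)) * W ^ (2 * n))"
    proof (rule sum.cong)
      fix j assume j: "j \<in> {2..n - 2}"
      have "wp_coeff (2 * j - 2) = of_rat (q j) * W ^ (2 * j)"
        "wp_coeff (2 * (n - j) - 2) = of_rat (q (n - j)) * W ^ (2 * (n - j))"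
        unfolding W_def using j 3 by (intro less.IH; auto)+
      moreover have "W ^ (2 * j) * W ^ (2 * (n - j)) = W ^ (2 * n)"
      proof -
        have "2 * j + 2 * (n - j) = 2 * n" using j 3 by auto
        then show ?thesis by (simp only: power_add[symmetric])
      qed
      ultimately show "wp_coeff (2 * j - 2) * wp_coeff (2 * (n - j) - 2) = of_rat (q j * q (n - j)) * W ^ (2 * n)"
        by (simp add: of_rat_mult mult_ac)
    qed simp
    also have "\<dots> = of_rat (\<Sum>j = 2..n - 2. q j * q (n - j)) * W ^ (2 * n)"
      by (simp only: of_rat_sum sum_distrib_right)
    finally have S: "(\<Sum>i\<le>2 * n - 4. wp_coeff i * wp_coeff (2 * n - 4 - i)) = of_rat (\<Sum>j = 2..n - 2. q j * q (n - j)) * W ^ (2 * n)"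
      unfolding wp_coeff_convolution[OF 3] .
    define K where "K = (2 * of_nat n + 1 :: complex) * (of_nat n - 3)"
    have K: "K \<noteq> 0"
    proof -
      have "2 * of_nat n + 1 = (of_nat (2 * n + 1) :: complex)" "of_nat n - 3 = (of_nat (m + 1) :: complex)"
        by (simp_all add: m)
      then have "K = of_nat ((2 * n + 1) * (m + 1))" unfolding K_def by (simp only: of_nat_mult)
      then show ?thesis by (simp only: of_nat_eq_0_iff) simp
    qed
    have e: "2 * n - 4 + 2 = 2 * n - 2" using 3 by simp
    \<comment> \<open>At \<open>k = 2 * n - 4\<close> the factor
      \<open>(k + 2) * (k + 1) - 12\<close> of the coefficient recursion equals
      \<open>2 * (2 * n + 1) * (n - 3)\<close>; dividing by 2 also turns its 6 into the 3 of
      \<open>r_seq\<close> and \<open>s_seq\<close>.\<close>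
    have "of_nat ((2 * n - 4 + 2) * (2 * n - 4 + 1)) - 12 = 2 * K"
    proof -
      have "2 * n - 4 + 2 = 2 * m + 6" "2 * n - 4 + 1 = 2 * m + 5" by (simp_all add: m)
      then show ?thesis by (simp only: K_def m) (simp add: algebra_simps)
    qed
    then have "2 * K * wp_coeff (2 * n - 2) = 6 * (\<Sum>i\<le>2 * n - 4. wp_coeff i * wp_coeff (2 * n - 4 - i))"
      using wp_coeff_rec[of "2 * n - 4"] 3 unfolding e by simp
    also have "\<dots> = 2 * of_rat (3 * (\<Sum>j = 2..n - 2. q j * q (n - j))) * W ^ (2 * n)"
      unfolding S by (simp add: of_rat_mult)
    also have "of_rat (3 * (\<Sum>j = 2..n - 2. q j * q (n - j))) = K * of_rat (q n)"
      unfolding rec[OF 3, symmetric] K_def by (simp add: of_rat_mult of_rat_add of_rat_diff)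
    finally have "(2 * K) * wp_coeff (2 * n - 2) = (2 * K) * (of_rat (q n) * W ^ (2 * n))" by (simp add: mult_ac)
    then show ?thesis using K by (simp add: W_def)
  qed (use base in simp_all)
qed

lemma wp_coeff_eisenstein:
  assumes "n \<ge> 2"
  shows "wp_coeff (2 * n - 2) = (2 * of_nat n - 1) * eisenstein (2 * n)"
proof -
  define m where "m = n - 2"
  have m: "n = m + 2" using assms by (simp add: m_def)
  show ?thesis by (simp add: m wp_coeff_def algebra_simps)
qed

end

subsection \<open>Rectangular lattices\<close>

lemma summable_on_int_powr:
  assumes "s > 1"
  shows "(\<lambda>n::int. (1 + real_of_int \<bar>n\<bar>) powr (- s)) summable_on UNIV"
proof -
  define f where "f = (\<lambda>n::int. (1 + real_of_int \<bar>n\<bar>) powr (- s))"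
  have "summable (\<lambda>n. real n powr (- s))" using assms by (simp add: summable_real_powr_iff)
  then have S': "summable (\<lambda>n. real (Suc n) powr (- s))" by (subst summable_Suc_iff)
  then have S: "(\<lambda>n. real (Suc n) powr (- s)) summable_on UNIV"
    by (intro summable_nonneg_imp_summable_on) auto
  have "f summable_on (range int)"
    by (subst summable_on_reindex) (use S in \<open>auto simp: o_def f_def inj_on_def\<close>)
  moreover have "f summable_on ((\<lambda>n. - int (Suc n)) ` UNIV)"
  proof (subst summable_on_reindex)
    show "inj (\<lambda>n. - int (Suc n))" by (auto simp: inj_on_def)
    have "summable (\<lambda>n. real (Suc (Suc n)) powr (- s))"
      using S' by (subst summable_Suc_iff[of "\<lambda>n. real (Suc n) powr (- s)"])
    then have "(\<lambda>n. real (Suc (Suc n)) powr (- s)) summable_on UNIV"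
      by (intro summable_nonneg_imp_summable_on) auto
    then show "(f \<circ> (\<lambda>n. - int (Suc n))) summable_on UNIV" by (simp add: o_def f_def add_ac)
  qed
  ultimately have "f summable_on (range int \<union> (\<lambda>n. - int (Suc n)) ` UNIV)"
    by (rule summable_on_Un_disjoint) auto
  also have "range int \<union> (\<lambda>n. - int (Suc n)) ` UNIV = UNIV"
  proof -
    have "x \<in> range int \<union> (\<lambda>n. - int (Suc n)) ` UNIV" for x
      by (cases x rule: int_cases) auto
    then show ?thesis by blast
  qed
  finally show ?thesis by (simp add: f_def)
qed

definition norm_form :: "int \<times> int \<Rightarrow> int" where
  "norm_form p = (fst p)\<^sup>2 + (snd p)\<^sup>2"

lemma norm_form_nonneg: "norm_form p \<ge> 0"
  by (simp add: norm_form_def)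

lemma norm_form_eq_0_iff: "norm_form p = 0 \<longleftrightarrow> p = (0, 0)"
  by (cases p) (simp add: norm_form_def sum_power2_eq_zero_iff)

lemma norm_form_ge_1: "p \<noteq> (0, 0) \<Longrightarrow> norm_form p \<ge> 1"
  using norm_form_nonneg[of p] norm_form_eq_0_iff[of p] by linarith

text \<open>Away from the origin \<open>(1 + \<bar>n\<bar>) * (1 + \<bar>m\<bar>) \<le> 4 *
  (n\<^sup>2 + m\<^sup>2)\<close>, which leaves a product of two one-dimensional series. The origin
  contributes \<open>0 powr (- s) = 0\<close>.\<close>

lemma summable_norm_form:
  assumes s: "s > 1"
  shows "(\<lambda>p. real_of_int (norm_form p) powr (- s)) summable_on UNIV"
proof -
  define f where "f = (\<lambda>n::int. (1 + real_of_int \<bar>n\<bar>) powr (- s))"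
  have f: "f summable_on UNIV" unfolding f_def by (rule summable_on_int_powr[OF s])
  have "(\<lambda>(n, m). f n * f m) summable_on (UNIV \<times> UNIV)"
  proof (rule summable_on_SigmaI)
    show "((\<lambda>m. case (n, m) of (n, m) \<Rightarrow> f n * f m) has_sum (f n * infsum f UNIV)) UNIV" for n
      using has_sum_cmult_right[OF has_sum_infsum[OF f], of "f n"] by simp
    show "(\<lambda>n. f n * infsum f UNIV) summable_on UNIV" by (rule summable_on_cmult_left[OF f])
  qed (auto simp: f_def)
  then have "(\<lambda>p. 4 powr s * (case p of (n, m) \<Rightarrow> f n * f m)) summable_on UNIV"
    by (intro summable_on_cmult_right) simp
  then show ?thesis
  proof (rule summable_on_comparison_test)
    fix p :: "int \<times> int"
    obtain n m where p: "p = (n, m)" by force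
    show "real_of_int (norm_form p) powr (- s) \<le> 4 powr s * (case p of (n, m) \<Rightarrow> f n * f m)"
    proof (cases "p = (0, 0)")
      case False
      define a where "a = real_of_int \<bar>n\<bar>"
      define b where "b = real_of_int \<bar>m\<bar>"
      define N where "N = real_of_int (norm_form p)"
      have N: "N = a\<^sup>2 + b\<^sup>2" by (simp add: N_def norm_form_def p a_def b_def)
      have N1: "N \<ge> 1" using norm_form_ge_1[OF False] by (simp add: N_def)
      have ab: "a \<ge> 0" "b \<ge> 0" by (auto simp: a_def b_def)
      have "a\<^sup>2 + b\<^sup>2 - 2 * a * b \<ge> 0" using zero_le_power2[of "a - b"] by (simp add: power2_diff)
      moreover have "real_of_int \<bar>k\<bar> \<le> (real_of_int \<bar>k\<bar>)\<^sup>2" for k :: int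
      proof (cases "k = 0")
        case False
        then have "1 \<le> real_of_int \<bar>k\<bar>" by linarith
        then show ?thesis by (rule self_le_power) simp
      qed simp
      then have "a \<le> a\<^sup>2" "b \<le> b\<^sup>2" unfolding a_def b_def by blast+
      ultimately have "(1 + a) * (1 + b) \<le> 4 * N" using N N1 by (simp add: algebra_simps)
      then have "(4 * N) powr (- s) \<le> ((1 + a) * (1 + b)) powr (- s)"
        using s ab by (intro powr_mono2') (auto intro!: mult_pos_pos)
      then have "4 powr s * (4 * N) powr (- s) \<le> 4 powr s * ((1 + a) * (1 + b)) powr (- s)"
        by (intro mult_left_mono) auto
      moreover have "4 powr s * (4 * N) powr (- s) = N powr (- s)"
        using N1 by (simp add: powr_mult powr_minus)
      ultimately have "N powr (- s) \<le> 4 powr s * ((1 + a) * (1 + b)) powr (- s)" by linarith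
      then show ?thesis unfolding N_def[symmetric]
        using ab by (simp add: p f_def powr_mult a_def b_def)
    qed (auto simp: norm_form_def f_def)
  qed auto
qed

definition lattice_point :: "nat \<Rightarrow> int \<times> int \<Rightarrow> complex" where
  "lattice_point h p = of_int (fst p) + \<i> * of_nat h * of_int (snd p)"

definition rect_lattice :: "nat \<Rightarrow> complex set" where
  "rect_lattice h = range (lattice_point h)"

lemma Re_lattice_point [simp]: "Re (lattice_point h p) = of_int (fst p)"
  and Im_lattice_point [simp]: "Im (lattice_point h p) = of_nat h * of_int (snd p)"
  by (simp_all add: lattice_point_def)

lemma in_rect_lattice_iff:
  assumes "h > 0"
  shows "z \<in> rect_lattice h \<longleftrightarrow> Re z \<in> \<int> \<and> Im z / of_nat h \<in> \<int>"
proof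
  assume "z \<in> rect_lattice h"
  then show "Re z \<in> \<int> \<and> Im z / of_nat h \<in> \<int>" using assms by (auto simp: rect_lattice_def)
next
  assume "Re z \<in> \<int> \<and> Im z / of_nat h \<in> \<int>"
  then obtain n m where "Re z = of_int n" "Im z / of_nat h = of_int m" by (auto elim!: Ints_cases)
  then have "z = lattice_point h (n, m)" using assms by (simp add: complex_eq_iff field_simps)
  then show "z \<in> rect_lattice h" by (simp add: rect_lattice_def)
qed

lemma inj_lattice_point: "h > 0 \<Longrightarrow> inj (lattice_point h)"
  by (auto simp: inj_on_def complex_eq_iff prod_eq_iff)

lemma bij_lattice_point: "h > 0 \<Longrightarrow> bij_betw (lattice_point h) (UNIV - {(0, 0)}) (rect_lattice h - {0})"
proof -
  assume h: "h > 0"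
  have "bij_betw (lattice_point h) (UNIV - {(0, 0)}) (lattice_point h ` (UNIV - {(0, 0)}))"
    using inj_lattice_point[OF h] by (intro inj_on_imp_bij_betw) (auto simp: inj_on_def)
  also have "lattice_point h ` (UNIV - {(0, 0)}) = rect_lattice h - {lattice_point h (0, 0)}"
    using inj_lattice_point[OF h] by (simp add: rect_lattice_def image_set_diff)
  also have "lattice_point h (0, 0) = 0" by (simp add: lattice_point_def)
  finally show ?thesis .
qed

lemma norm_lattice_point_ge:
  assumes "h > 0"
  shows "sqrt (of_int (norm_form p)) \<le> norm (lattice_point h p)"
proof -
  have "real h \<ge> 1" using assms by simp
  then have "1 * (of_int (snd p))\<^sup>2 \<le> (real h)\<^sup>2 * (of_int (snd p))\<^sup>2"
    by (intro mult_right_mono one_le_power) auto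
  then show ?thesis unfolding norm_form_def cmod_def Re_lattice_point Im_lattice_point
    by (simp add: power_mult_distrib)
qed

lemma complex_lattice_rect_lattice:
  assumes h: "h > 0"
  shows "complex_lattice (rect_lattice h)"
proof
  show "0 \<in> rect_lattice h" "\<And>x y. x \<in> rect_lattice h \<Longrightarrow> y \<in> rect_lattice h \<Longrightarrow> x + y \<in> rect_lattice h"
    "\<And>x. x \<in> rect_lattice h \<Longrightarrow> - x \<in> rect_lattice h"
    using h by (simp_all add: in_rect_lattice_iff add_divide_distrib)
  show "1 \<le> norm z" if z: "z \<in> rect_lattice h - {0}" for z
  proof -
    obtain p where p: "z = lattice_point h p" using z by (auto simp: rect_lattice_def)
    have "p \<noteq> (0, 0)" using p z by (auto simp: lattice_point_def)
    then have "1 \<le> sqrt (of_int (norm_form p))" using norm_form_ge_1 by auto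
    also have "\<dots> \<le> norm z" unfolding p by (rule norm_lattice_point_ge[OF h])
    finally show ?thesis .
  qed
  have "(\<lambda>p. real_of_int (norm_form p) powr (- (3/2))) summable_on (UNIV - {(0, 0)})"
    by (rule summable_on_subset_banach[OF summable_norm_form]) auto
  then have "(\<lambda>p. 1 / norm (lattice_point h p) ^ 3) summable_on (UNIV - {(0, 0)})"
  proof (rule summable_on_comparison_test)
    fix p :: "int \<times> int" assume p: "p \<in> UNIV - {(0, 0)}"
    define N where "N = real_of_int (norm_form p)"
    have N: "N \<ge> 1" using norm_form_ge_1 p by (simp add: N_def)
    have "1 / norm (lattice_point h p) ^ 3 \<le> 1 / sqrt N ^ 3"
    proof (rule frac_le)
      show "sqrt N ^ 3 \<le> norm (lattice_point h p) ^ 3"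
        using norm_lattice_point_ge[OF h, of p] N by (intro power_mono) (simp_all add: N_def)
      show "0 < sqrt N ^ 3" using N by simp
    qed simp_all
    also have "sqrt N ^ 3 = N powr (3/2)"
    proof -
      have "sqrt N = N powr (1/2)" using N by (simp add: powr_half_sqrt)
      then have "sqrt N ^ 3 = (N powr (1/2)) ^ 3" by (rule arg_cong)
      also have "\<dots> = N powr (3/2)" using N by (subst powr_power) auto
      finally show ?thesis .
    qed
    also have "1 / N powr (3/2) = N powr (- (3/2))" by (rule powr_minus_divide[symmetric])
    finally show "1 / norm (lattice_point h p) ^ 3 \<le> real_of_int (norm_form p) powr (- (3/2))"
      unfolding N_def .
  qed auto
  then show "(\<lambda>z. 1 / norm z ^ 3) summable_on (rect_lattice h - {0})"
    by (rule summable_on_reindex_bij_betw[OF bij_lattice_point[OF h], THEN iffD1])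
  show "\<exists>R. \<forall>z. \<exists>w\<in>rect_lattice h. norm (z - w) \<le> R"
  proof (intro exI[of _ "1 + real h"] allI)
    fix z
    define w where "w = lattice_point h (\<lfloor>Re z\<rfloor>, \<lfloor>Im z / h\<rfloor>)"
    have "\<bar>Re (z - w)\<bar> \<le> 1" unfolding w_def by simp linarith
    moreover have "\<bar>Im (z - w)\<bar> \<le> real h"
    proof -
      have "Im (z - w) = real h * (Im z / h - \<lfloor>Im z / h\<rfloor>)" using h by (simp add: w_def algebra_simps)
      moreover have "\<bar>Im z / h - \<lfloor>Im z / h\<rfloor>\<bar> \<le> 1" by linarith
      ultimately show ?thesis by (simp add: abs_mult mult_left_le)
    qed
    ultimately have "norm (z - w) \<le> 1 + real h" using cmod_le[of "z - w"] by linarith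
    moreover have "w \<in> rect_lattice h" by (simp add: w_def rect_lattice_def)
    ultimately show "\<exists>w\<in>rect_lattice h. norm (z - w) \<le> 1 + real h" by blast
  qed
qed

definition square_lattice :: "complex set" where
  "square_lattice = rect_lattice 1"

definition wide_lattice :: "complex set" where
  "wide_lattice = rect_lattice 2"

interpretation L1: complex_lattice square_lattice
  unfolding square_lattice_def by (rule complex_lattice_rect_lattice) simp

interpretation L2: complex_lattice wide_lattice
  unfolding wide_lattice_def by (rule complex_lattice_rect_lattice) simp

lemma in_L1_iff: "z \<in> square_lattice \<longleftrightarrow> Re z \<in> \<int> \<and> Im z \<in> \<int>"
  unfolding square_lattice_def by (simp add: in_rect_lattice_iff)

lemma in_L2_iff: "z \<in> wide_lattice \<longleftrightarrow> Re z \<in> \<int> \<and> Im z / 2 \<in> \<int>"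
  unfolding wide_lattice_def by (simp add: in_rect_lattice_iff)

lemma frac_not_Ints: "0 < x \<Longrightarrow> x < 1 \<Longrightarrow> x \<notin> (\<int> :: real set)"
  by (auto elim!: Ints_cases)

section \<open>The real half period of Z + iZ\<close>

lemma cnj_L1: "cnj ` square_lattice \<subseteq> square_lattice"
  by (auto simp: in_L1_iff)

lemma ii_L1: "(*) \<i> ` square_lattice \<subseteq> square_lattice"
  by (auto simp: in_L1_iff)

lemma real_notin_L1: "0 < t \<Longrightarrow> t < 1 \<Longrightarrow> complex_of_real t \<notin> square_lattice"
  by (simp add: in_L1_iff frac_not_Ints)

definition wpr :: "real \<Rightarrow> real" where
  "wpr t = Re (L1.wp (of_real t))"

definition wpr' :: "real \<Rightarrow> real" where
  "wpr' t = Re (L1.wp_deriv (of_real t))"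

lemma of_real_Re_eq: "cnj z = z \<Longrightarrow> of_real (Re z) = z"
  by (simp add: complex_eq_iff)

lemma of_real_wpr: "of_real (wpr t) = L1.wp (of_real t)"
  unfolding wpr_def using L1.wp_cnj[OF cnj_L1, of "of_real t"] by (intro of_real_Re_eq) simp

lemma of_real_wpr': "of_real (wpr' t) = L1.wp_deriv (of_real t)"
  unfolding wpr'_def using L1.wp_deriv_cnj[OF cnj_L1, of "of_real t"] by (intro of_real_Re_eq) simp

lemma wpr_has_derivative:
  assumes "0 < t" "t < 1"
  shows "(wpr has_real_derivative wpr' t) (at t)"
proof -
  have "((\<lambda>t. L1.wp (of_real t)) has_vector_derivative L1.wp_deriv (of_real t)) (at t)"
    using real_notin_L1[OF assms] by (intro has_vector_derivative_real_field L1.wp_has_derivative)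
  from bounded_linear.has_vector_derivative[OF bounded_linear_Re this]
  show ?thesis unfolding has_real_derivative_iff_has_vector_derivative wpr_def[abs_def] wpr'_def .
qed

lemma half_in_L1: "2 * (1/2 :: complex) \<in> square_lattice" "1/2 \<notin> square_lattice"
  using real_notin_L1[of "1/2"] by (auto simp: in_L1_iff)

text \<open>If the derivative vanished at \<open>t\<close>, then \<open>t\<close> and
  \<open>- t\<close> would share the value and the derivative of \<open>wp\<close>, and
  \<open>2 * t\<close> would be a lattice point strictly between 0 and 1.\<close>

lemma wpr'_nonzero:
  assumes "0 < t" "t < 1/2"
  shows "wpr' t \<noteq> 0"
proof
  assume 0: "wpr' t = 0"
  define z where "z = complex_of_real t"
  have z: "z \<notin> square_lattice" "- z \<notin> square_lattice"
    using real_notin_L1[of t] assms L1.minus_in_iff by (auto simp: z_def)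
  have d: "L1.wp_deriv z = 0" using 0 of_real_wpr'[of t] by (simp add: z_def)
  then have "L1.wp_deriv (- z) = 0" using L1.wp_deriv_uminus[OF z(1)] by simp
  with d z have "z - - z \<in> square_lattice"
    by (intro L1.wp_eq_imp_diff_in) (auto simp: L1.wp_uminus L1.deriv_wp)
  then have "complex_of_real (2 * t) \<in> square_lattice" by (simp add: z_def)
  then show False using real_notin_L1[of "2 * t"] assms by simp
qed

text \<open>At the half periods \<open>1/2\<close> and \<open>\<i> * (1/2)\<close> the derivative
  vanishes and the values of \<open>wp\<close> are opposite. The rest of the cubic is odd, so the
  integration constant equals its own negative. Classically, g_3 = 0 by multiplication with
  \<open>\<i>\<close>.\<close>

lemma first_integral_L1:
  assumes "z \<notin> square_lattice"
  shows "(L1.wp_deriv z)\<^sup>2 = 4 * L1.wp z ^ 3 - 20 * L1.wp_coeff 2 * L1.wp z"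
proof -
  obtain v where v: "\<And>z. z \<notin> square_lattice \<Longrightarrow> (deriv L1.wp z)\<^sup>2 = 4 * L1.wp z ^ 3 - 20 * L1.wp_coeff 2 * L1.wp z + v"
    using L1.wp_first_integral by blast
  define a where "a = (1/2 :: complex)"
  have a: "a \<notin> square_lattice" "\<i> * a \<notin> square_lattice" "2 * a \<in> square_lattice" "2 * (\<i> * a) \<in> square_lattice"
    using frac_not_Ints[of "1/2"] by (auto simp: a_def in_L1_iff)
  have 1: "4 * L1.wp a ^ 3 - 20 * L1.wp_coeff 2 * L1.wp a + v = 0"
    using v[OF a(1)] L1.wp_deriv_half_period[OF a(1,3)] a by (simp add: L1.deriv_wp)
  have 2: "4 * L1.wp (\<i> * a) ^ 3 - 20 * L1.wp_coeff 2 * L1.wp (\<i> * a) + v = 0"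
    using v[OF a(2)] L1.wp_deriv_half_period[OF a(2,4)] a by (simp add: L1.deriv_wp)
  have "v = 0" using 1 2 unfolding L1.wp_mult_ii[OF ii_L1] by algebra
  with v[OF assms] show ?thesis using assms by (simp add: L1.deriv_wp)
qed

definition e1 :: real where
  "e1 = wpr (1/2)"

lemma wp_half: "L1.wp (1/2) = of_real e1"
  unfolding e1_def of_real_wpr by simp

text \<open>The half period \<open>b = (1 + \<i>) / 2\<close> satisfies
  \<open>\<i> * b = b - 1\<close>, which forces \<open>L1.wp b = 0\<close>. Inequivalent half
  periods cannot share a value, so the value at \<open>1/2\<close> is not 0.\<close>

lemma e1_nonzero: "e1 \<noteq> 0"
proof
  assume "e1 = 0"
  then have 1: "L1.wp (1/2) = 0" by (simp add: wp_half)
  define b where "b = (1 + \<i>) / 2"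
  have b: "b \<notin> square_lattice" "2 * b \<in> square_lattice"
    using frac_not_Ints[of "1/2"] by (auto simp: b_def in_L1_iff)
  have one: "- 1 \<in> square_lattice" by (simp add: in_L1_iff)
  have "\<i> * b = b + - 1" by (simp add: b_def complex_eq_iff)
  then have "- L1.wp b = L1.wp b"
    using L1.wp_mult_ii[OF ii_L1, of b] L1.wp_periodic[OF one b(1)] by simp
  then have "L1.wp b = 0" by simp
  then have "1/2 - b \<in> square_lattice"
    using 1 b half_in_L1 L1.wp_deriv_half_period[OF half_in_L1(2,1)] L1.wp_deriv_half_period[OF b]
    by (intro L1.wp_eq_imp_diff_in) (auto simp: L1.deriv_wp)
  then show False using frac_not_Ints[of "1/2"] by (simp add: b_def in_L1_iff)
qed

lemma wp_coeff_2_L1: "L1.wp_coeff 2 = of_real (e1\<^sup>2 / 5)"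
proof -
  have "0 = 4 * L1.wp (1/2) ^ 3 - 20 * L1.wp_coeff 2 * L1.wp (1/2)"
    using first_integral_L1[OF half_in_L1(2)] L1.wp_deriv_half_period[OF half_in_L1(2,1)] by simp
  then have "4 * of_real e1 * ((of_real e1)\<^sup>2 - 5 * L1.wp_coeff 2) = 0"
    unfolding wp_half by algebra
  then have "(of_real e1)\<^sup>2 - 5 * L1.wp_coeff 2 = 0"
    using e1_nonzero by (simp only: mult_eq_0_iff of_real_eq_0_iff) simp
  then have "L1.wp_coeff 2 = (of_real e1)\<^sup>2 / 5" by algebra
  then show ?thesis by simp
qed

lemma wpr'_sq:
  assumes "0 < t" "t < 1"
  shows "(wpr' t)\<^sup>2 = 4 * wpr t * ((wpr t)\<^sup>2 - e1\<^sup>2)"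
proof -
  have "complex_of_real ((wpr' t)\<^sup>2) = of_real (4 * wpr t * ((wpr t)\<^sup>2 - e1\<^sup>2))"
    using first_integral_L1[OF real_notin_L1[OF assms]]
    by (simp add: wp_coeff_2_L1 flip: of_real_wpr of_real_wpr') (simp add: power2_eq_square power3_eq_cube algebra_simps)
  then show ?thesis by (simp only: of_real_eq_iff)
qed

lemma wpr_at_top: "filterlim wpr at_top (at_right 0)"
proof -
  have "filterlim (\<lambda>t. 1 / t\<^sup>2 :: real) at_top (at_right 0)" by real_asymp
  moreover have "((\<lambda>t. Re (L1.wp_reg (of_real t))) \<longlongrightarrow> Re (L1.wp_reg (of_real 0))) (at_right 0)"
  proof -
    have c: "isCont L1.wp_reg (of_real 0)"
      using DERIV_isCont[OF L1.wp_reg_has_derivative[of 0]] by simp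
    have "isCont complex_of_real 0" by (intro continuous_intros)
    from isCont_Re[OF isCont_o2[OF this c]] show ?thesis by (simp add: isCont_def filterlim_at_split)
  qed
  ultimately have "filterlim (\<lambda>t. Re (L1.wp_reg (of_real t)) + 1 / t\<^sup>2) at_top (at_right 0)"
    by (rule filterlim_tendsto_add_at_top[rotated])
  also have "(\<lambda>t. Re (L1.wp_reg (of_real t)) + 1 / t\<^sup>2) = wpr"
  proof
    fix t
    have "complex_of_real t ^ 2 = of_real (t\<^sup>2)" by simp
    then have "1 / (complex_of_real t)\<^sup>2 = of_real (1 / t\<^sup>2)" by (simp del: of_real_power)
    then show "Re (L1.wp_reg (of_real t)) + 1 / t\<^sup>2 = wpr t"
      by (simp add: wpr_def L1.wp_def)
  qed
  finally show ?thesis .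
qed

lemma wpr_larger:
  assumes "0 < s"
  obtains r where "0 < r" "r < s" "wpr r > B"
proof -
  have "eventually (\<lambda>t. wpr t > B) (at_right 0)"
    using wpr_at_top by (auto simp: filterlim_at_top_dense)
  moreover have "eventually (\<lambda>t. t \<in> {0<..<s}) (at_right (0 :: real))"
    using assms by (rule eventually_at_right_real)
  ultimately have "eventually (\<lambda>t. wpr t > B \<and> t \<in> {0<..<s}) (at_right 0)"
    by eventually_elim auto
  then obtain r where "wpr r > B \<and> r \<in> {0<..<s}"
    using eventually_happens'[of "at_right (0 :: real)"] by auto
  then show ?thesis by (intro that[of r]) auto
qed

lemma wpr_continuous: "0 < a \<Longrightarrow> b < 1 \<Longrightarrow> continuous_on {a..b} wpr"
  by (intro continuous_at_imp_continuous_on ballI DERIV_isCont[OF wpr_has_derivative]) auto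

text \<open>Otherwise the pole at 0 and the intermediate value theorem give a point
  \<open>p \<le> s\<close> with the same value as \<open>t\<close>, and Rolle's theorem a zero of
  the derivative strictly between 0 and 1/2.\<close>

lemma wpr_decreasing:
  assumes "0 < s" "s < t" "t \<le> 1/2"
  shows "wpr t < wpr s"
proof (rule ccontr)
  assume le: "\<not> wpr t < wpr s"
  obtain r where r: "0 < r" "r < s" "wpr r > wpr t" using wpr_larger[OF assms(1)] by blast
  have "\<exists>p\<ge>r. p \<le> s \<and> wpr p = wpr t"
    using r le wpr_continuous[of r s] assms by (intro IVT2') auto
  then obtain p where p: "r \<le> p" "p \<le> s" "wpr p = wpr t" by blast
  have "\<exists>z>p. z < t \<and> (wpr has_real_derivative 0) (at z)"
  proof (rule Rolle)
    show "p < t" "wpr p = wpr t" using p assms by auto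
    show "continuous_on {p..t} wpr" using p r assms by (intro wpr_continuous) auto
    show "wpr differentiable (at x)" if "p < x" "x < t" for x
      using wpr_has_derivative[of x] that p r assms by (auto simp: real_differentiable_def)
  qed
  then obtain z where z: "z > p" "z < t" "(wpr has_real_derivative 0) (at z)" by blast
  then have "wpr' z = 0" using wpr_has_derivative[of z] DERIV_unique p r assms by fastforce
  then show False using wpr'_nonzero[of z] z p r assms by simp
qed

text \<open>If \<open>e1\<close> were negative, \<open>wpr\<close> would take the value
  \<open>- e1 / 2\<close> on its way down from the pole. There the cubic
  \<open>4 * x * (x\<^sup>2 - e1\<^sup>2)\<close> is negative, although it is the square of a real
  number.\<close>

lemma e1_pos: "e1 > 0"
proof (rule ccontr)
  assume "\<not> e1 > 0"
  with e1_nonzero have neg: "e1 < 0" by simp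
  obtain r where r: "0 < r" "r < 1/2" "wpr r > - e1 / 2" using wpr_larger[of "1/2"] by auto
  have "\<exists>p\<ge>r. p \<le> 1/2 \<and> wpr p = - e1 / 2"
    using r neg wpr_continuous[of r "1/2"] by (intro IVT2') (auto simp: e1_def)
  then obtain p where p: "r \<le> p" "p \<le> 1/2" "wpr p = - e1 / 2" by blast
  have "(wpr' p)\<^sup>2 = 4 * (- e1 / 2) * ((- e1 / 2)\<^sup>2 - e1\<^sup>2)" using wpr'_sq[of p] p r by simp
  then have "(wpr' p)\<^sup>2 = (3/2) * (e1 * e1\<^sup>2)" by (simp add: power2_eq_square)
  moreover have "e1 * e1\<^sup>2 < 0" using neg by (intro mult_neg_pos) auto
  ultimately show False using zero_le_power2[of "wpr' p"] by linarith
qed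

lemma wpr_gt_e1: "0 < t \<Longrightarrow> t < 1/2 \<Longrightarrow> wpr t > e1"
  unfolding e1_def by (rule wpr_decreasing) auto

lemma wpr'_eq:
  assumes "0 < t" "t < 1/2"
  shows "wpr' t = - (2 * sqrt (wpr t * ((wpr t)\<^sup>2 - e1\<^sup>2)))"
proof -
  have "wpr' t \<le> 0"
  proof (rule ccontr)
    assume "\<not> wpr' t \<le> 0"
    then obtain d where d: "d > 0" "\<And>h. h > 0 \<Longrightarrow> h < d \<Longrightarrow> wpr t < wpr (t + h)"
      using DERIV_pos_inc_right[OF wpr_has_derivative[of t]] assms by auto
    define h where "h = min (d / 2) (1/2 - t)"
    have "h > 0" "h < d" "h \<le> 1/2 - t" using d assms by (auto simp: h_def)
    then show False using d(2)[of h] wpr_decreasing[of t "t + h"] assms by auto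
  qed
  moreover have "(wpr' t)\<^sup>2 = (2 * sqrt (wpr t * ((wpr t)\<^sup>2 - e1\<^sup>2)))\<^sup>2"
  proof -
    have "wpr t * ((wpr t)\<^sup>2 - e1\<^sup>2) \<ge> 0"
      using wpr_gt_e1[OF assms] e1_pos by (intro mult_nonneg_nonneg) (auto intro!: power_mono)
    then show ?thesis using wpr'_sq[of t] assms by (simp add: power_mult_distrib)
  qed
  moreover have "0 \<le> 2 * sqrt (wpr t * ((wpr t)\<^sup>2 - e1\<^sup>2))"
    using wpr_gt_e1[OF assms] e1_pos by (auto intro!: power_mono)
  moreover have "x = - y" if "x \<le> 0" "x\<^sup>2 = y\<^sup>2" "0 \<le> y" for x y :: real
    using that by (auto simp: power2_eq_iff)
  ultimately show ?thesis by blast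
qed

text \<open>The substitution \<open>u = (e1 / wpr t)\<^sup>2\<close> maps (0, 1/2) to (0, 1) and, by
  the first order equation of \<open>wpr\<close>, turns the Beta integrand into the constant
  \<open>4 * sqrt e1\<close>. Over an interval of length 1/2 this integrates to
  \<open>2 * sqrt e1\<close>.\<close>

lemma sqrt_e1: "sqrt e1 = Beta (1/4) (1/2) / 2"
proof -
  define f where "f = (\<lambda>u::real. u powr (-3/4) * (1 - u) powr (-1/2))"
  define g where "g = (\<lambda>t. (e1 / wpr t)\<^sup>2)"
  \<comment> \<open>The derivative of \<open>g\<close>, written through \<open>g\<close> alone so
    that its continuity and the cancellation against \<open>f\<close> become visible.\<close>
  define g' where "g' = (\<lambda>t. 4 * sqrt e1 * (g t powr (3/4) * (1 - g t) powr (1/2)))"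
  have y: "wpr t > e1" "wpr t > 0" if "0 < t" "t < 1/2" for t
    using wpr_gt_e1[OF that] e1_pos by auto
  have g01: "0 < g t" "g t < 1" if t: "0 < t" "t < 1/2" for t
  proof -
    have "0 < e1 / wpr t" "e1 / wpr t < 1" using y[OF t] e1_pos by auto
    then show "0 < g t" "g t < 1" unfolding g_def by (auto intro: power_less_one_iff[THEN iffD2])
  qed
  have g'_eq: "2 * (e1 / wpr t) * (- (e1 * wpr' t) / (wpr t * wpr t)) = g' t" if t: "0 < t" "t < 1/2" for t
  proof -
    define w where "w = wpr t"
    define q where "q = e1 / w"
    have w: "w > e1" "w > 0" using y[OF t] by (auto simp: w_def)
    have q: "q > 0" "q < 1" using w e1_pos by (auto simp: q_def)
    have p1: "(q\<^sup>2) powr (3/4) = q * sqrt q"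
    proof -
      have "(q\<^sup>2) powr (3/4) = q powr (1 + 1/2)"
        using q by (simp add: powr_powr flip: powr_numeral)
      also have "\<dots> = q powr 1 * q powr (1/2)" by (rule powr_add)
      finally show ?thesis using q by (simp add: powr_half_sqrt)
    qed
    have p2: "(1 - q\<^sup>2) powr (1/2) = sqrt (w\<^sup>2 - e1\<^sup>2) / w"
    proof -
      have "q\<^sup>2 \<le> 1" using q by (simp add: power_le_one)
      then have 1: "(1 - q\<^sup>2) powr (1/2) = sqrt (1 - q\<^sup>2)" by (simp add: powr_half_sqrt)
      have 2: "1 - q\<^sup>2 = (w\<^sup>2 - e1\<^sup>2) / w\<^sup>2" using w by (simp add: q_def power_divide diff_divide_distrib)
      show ?thesis unfolding 1 unfolding 2 using w by (simp add: real_sqrt_divide)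
    qed
    have gt: "g' t = 4 * sqrt e1 * (q * (sqrt e1 / sqrt w) * (sqrt (w\<^sup>2 - e1\<^sup>2) / w))"
    proof -
      have "g t = q\<^sup>2" by (simp add: g_def q_def w_def)
      moreover have "sqrt q = sqrt e1 / sqrt w" by (simp add: q_def real_sqrt_divide)
      ultimately show ?thesis unfolding g'_def using p1 p2 by simp
    qed
    have wt: "wpr' t = - (2 * (sqrt w * sqrt (w\<^sup>2 - e1\<^sup>2)))"
      using wpr'_eq[OF t] by (simp add: w_def real_sqrt_mult)
    \<comment> \<open>Here \<open>r\<close>, \<open>s\<close> and \<open>T\<close> stand for
      \<open>sqrt w\<close>, \<open>sqrt e1\<close> and
      \<open>sqrt (w\<^sup>2 - e1\<^sup>2)\<close>; the squares of the first two are all that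
      enters.\<close>
    have alg: "2 * q * (- (E * - (2 * (r * T))) / (W * W)) = 4 * s * (q * (s / r) * (T / W))"
      if "r > 0" "r * r = W" "s * s = E" for r s T W E :: real
      using that(1) unfolding that(2,3)[symmetric] by simp
    have "2 * q * (- (e1 * - (2 * (sqrt w * sqrt (w\<^sup>2 - e1\<^sup>2)))) / (w * w)) = g' t"
      unfolding gt using w e1_pos by (intro alg) simp_all
    then show ?thesis by (simp only: wt flip: w_def q_def)
  qed
  have isCont_wpr: "isCont wpr t" if "0 < t" "t < 1" for t
    using wpr_has_derivative[OF that] by (rule DERIV_isCont)
  have isCont_g: "isCont g t" if "0 < t" "t < 1/2" for t
    unfolding g_def using y[OF that] that by (intro continuous_intros isCont_wpr) auto
  have prod: "f (g t) * g' t = 4 * sqrt e1" if t: "0 < t" "t < 1/2" for t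
  proof -
    have "g t powr (-3/4) * g t powr (3/4) = 1" "(1 - g t) powr (-1/2) * (1 - g t) powr (1/2) = 1"
      using g01[OF t] by (simp_all flip: powr_add)
    moreover have "f (g t) * g' t = 4 * sqrt e1 * (g t powr (-3/4) * g t powr (3/4)) * ((1 - g t) powr (-1/2) * (1 - g t) powr (1/2))"
      unfolding f_def g'_def by (simp only: mult_ac)
    ultimately show ?thesis by (simp only: mult_1_right)
  qed
  have integ: "set_integrable lborel (einterval (ereal 0) (ereal (1/2))) (\<lambda>t. f (g t) * g' t)"
  proof -
    have "set_integrable lborel {0<..<1/2} (\<lambda>t. f (g t) * g' t) \<longleftrightarrow> set_integrable lborel {0<..<1/2} (\<lambda>t::real. 4 * sqrt e1)"
      by (intro set_integrable_cong refl) (auto simp: prod)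
    moreover have "integrable lborel (indicat_real {0<..<1/2 :: real})"
      by (intro integrable_real_indicator emeasure_bounded_finite) auto
    then have "set_integrable lborel {0<..<1/2} (\<lambda>t::real. 4 * sqrt e1)"
      by (simp add: set_integrable_def)
    ultimately show ?thesis by (simp only: einterval_eq)
  qed
  have gA: "(g \<longlongrightarrow> 0) (at_right 0)"
  proof -
    have "((\<lambda>t. e1 / wpr t) \<longlongrightarrow> 0) (at_right 0)"
      by (rule tendsto_divide_0[OF tendsto_const filterlim_at_top_imp_at_infinity[OF wpr_at_top]])
    from tendsto_power[OF this, of 2] show ?thesis by (simp add: g_def)
  qed
  have gB: "(g \<longlongrightarrow> 1) (at_left (1/2))"
  proof -
    have "isCont g (1/2)"
      unfolding g_def using e1_pos by (intro continuous_intros isCont_wpr) (auto simp: e1_def)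
    then have "(g \<longlongrightarrow> g (1/2)) (at_left (1/2))" by (simp add: isCont_def filterlim_at_split)
    moreover have "g (1/2) = 1" using e1_pos by (simp add: g_def e1_def)
    ultimately show ?thesis by simp
  qed
  have dg: "DERIV g t :> g' t" if "ereal 0 < ereal t" "ereal t < ereal (1/2)" for t
  proof -
      have t: "0 < t" "t < 1/2" using that by auto
      have "DERIV (\<lambda>t. e1 / wpr t) t :> - (e1 * wpr' t) / (wpr t * wpr t)"
        using wpr_has_derivative[of t] y[OF t] t by (auto intro!: derivative_eq_intros)
      from DERIV_power[OF this, of 2]
      have "DERIV g t :> 2 * (e1 / wpr t) * (- (e1 * wpr' t) / (wpr t * wpr t))"
        by (simp add: g_def mult_ac)
      then show ?thesis using g'_eq[OF t] by simp
  qed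
  have cf: "isCont f (g t)" if "ereal 0 < ereal t" "ereal t < ereal (1/2)" for t
      unfolding f_def using g01[of t] that by (intro continuous_intros) auto
  have cg: "isCont g' t" if "ereal 0 < ereal t" "ereal t < ereal (1/2)" for t
      unfolding g'_def using g01[of t] that isCont_g[of t] by (intro continuous_intros) auto
  have lA: "((ereal \<circ> g \<circ> real_of_ereal) \<longlongrightarrow> ereal 0) (at_right (ereal 0))"
      using gA by (simp add: ereal_tendsto_simps)
  have lB: "((ereal \<circ> g \<circ> real_of_ereal) \<longlongrightarrow> ereal 1) (at_left (ereal (1/2)))"
      using gB by (simp add: ereal_tendsto_simps)
  have nn: "0 \<le> f (g t)" "0 \<le> g' t" for t
    using e1_pos by (auto simp: f_def g'_def)
  have lt: "ereal 0 < ereal (1/2)" by simp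
  \<comment> \<open>The nonnegative form of the substitution rule also yields integrability of
    \<open>f\<close>, which is unbounded at both ends of (0, 1).\<close>
  note sub = interval_integral_substitution_nonneg[OF lt dg cf cg nn lA lB integ]
  have "(LBINT t=ereal 0..ereal (1/2). f (g t) * g' t) = (LBINT t=ereal 0..ereal (1/2). 4 * sqrt e1)"
    by (intro interval_integral_cong) (auto simp: prod)
  also have "\<dots> = 2 * sqrt e1" by simp
  finally have i1: "(LBINT u=ereal 0..ereal 1. f u) = 2 * sqrt e1" using sub(2) by simp
  have "((\<lambda>t. t powr (1/4 - 1) * (1 - t) powr (1/2 - 1)) has_integral Beta (1/4) (1/2 :: real)) {0..1}"
    by (rule has_integral_Beta_real) auto
  then have "(f has_integral Beta (1/4) (1/2)) {0<..<1}"
    by (simp add: f_def has_integral_Icc_iff_Ioo)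
  then have "integral {0<..<1} f = Beta (1/4) (1/2)" by (rule integral_unique)
  moreover have "(LBINT u=ereal 0..ereal 1. f u) = integral {0<..<1} f"
    using set_borel_integral_eq_integral(2)[OF sub(1)] by (simp add: interval_lebesgue_integral_def)
  ultimately show ?thesis using i1 by simp
qed

definition lemniscate :: real where
  "lemniscate = Beta (1/4) (1/2) / 2"

lemma e1_eq: "e1 = lemniscate\<^sup>2"
  using real_sqrt_pow2[of e1] e1_pos by (simp add: sqrt_e1 lemniscate_def)

section \<open>Passage from Z + iZ to Z + 2iZ\<close>

lemma wide_subset_square: "z \<in> wide_lattice \<Longrightarrow> z \<in> square_lattice"
proof -
  assume z: "z \<in> wide_lattice"
  then have "2 * (Im z / 2) \<in> \<int>" by (intro Ints_mult) (auto simp: in_L2_iff)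
  then show ?thesis using z by (simp add: in_L1_iff in_L2_iff)
qed

lemma square_lattice_eq: "square_lattice - {0} = (wide_lattice - {0}) \<union> (\<lambda>\<mu>. \<mu> + \<i>) ` wide_lattice"
proof (intro equalityI subsetI)
  fix z assume z: "z \<in> square_lattice - {0}"
  then obtain m where m: "Im z = of_int m" by (auto simp: in_L1_iff elim!: Ints_cases)
  show "z \<in> (wide_lattice - {0}) \<union> (\<lambda>\<mu>. \<mu> + \<i>) ` wide_lattice"
  proof (cases "even m")
    case True
    then obtain k where "m = 2 * k" by blast
    then show ?thesis using z m by (simp add: in_L1_iff in_L2_iff)
  next
    case False
    then obtain k where "m = 2 * k + 1" by (auto elim!: oddE)
    then have "z - \<i> \<in> wide_lattice" using z m by (simp add: in_L1_iff in_L2_iff)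
    then show ?thesis by (intro UnI2 image_eqI[of _ _ "z - \<i>"]) auto
  qed
next
  fix z assume "z \<in> (wide_lattice - {0}) \<union> (\<lambda>\<mu>. \<mu> + \<i>) ` wide_lattice"
  then show "z \<in> square_lattice - {0}"
  proof
    assume "z \<in> (\<lambda>\<mu>. \<mu> + \<i>) ` wide_lattice"
    then obtain \<mu> where \<mu>: "\<mu> \<in> wide_lattice" "z = \<mu> + \<i>" by auto
    then have "z \<in> square_lattice" using wide_subset_square[of \<mu>] by (simp add: in_L1_iff)
    moreover have "z \<noteq> 0"
    proof
      assume "z = 0"
      then have "\<mu> = - \<i>" using \<mu> by (simp add: eq_neg_iff_add_eq_0)
      then have "- (1/2) \<in> (\<int> :: real set)" using \<mu> by (simp add: in_L2_iff)
      then show False using frac_not_Ints[of "1/2"] by (simp add: minus_in_Ints_iff)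
    qed
    ultimately show ?thesis by simp
  qed (use wide_subset_square in auto)
qed

lemma ii_notin_wide: "\<i> \<notin> wide_lattice" "- \<i> \<notin> wide_lattice" "2 * \<i> \<in> wide_lattice"
  using frac_not_Ints[of "1/2"] L2.minus_in_iff[of \<i>] by (auto simp: in_L2_iff)

lemma wide_disjoint: "(wide_lattice - {0}) \<inter> (\<lambda>\<mu>. \<mu> + \<i>) ` wide_lattice = {}"
proof -
  have "\<mu> + \<i> \<notin> wide_lattice" if "\<mu> \<in> wide_lattice" for \<mu>
    using L2.add_in_iff[OF that, of \<i>] ii_notin_wide by (simp add: add.commute)
  then show ?thesis by auto
qed

lemma minus_ii_notin_wide: "z \<notin> square_lattice \<Longrightarrow> z - \<i> \<notin> wide_lattice"
  using wide_subset_square[of "z - \<i>"] by (auto simp: in_L1_iff)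

text \<open>The square lattice is the disjoint union of the wide one and its translate by
  \<open>\<i>\<close>. On the translate, the terms are those of \<open>L2.wp (z - \<i>)\<close>
  minus those of \<open>L2.wp (- \<i>)\<close>, the latter exchanging the subtracted constants
  \<open>1 / \<mu>\<^sup>2\<close> for \<open>1 / (\<mu> + \<i>)\<^sup>2\<close>.\<close>

lemma wp_square_wide:
  assumes z: "z \<notin> square_lattice"
  shows "L1.wp z = L2.wp z + L2.wp (z - \<i>) - L2.wp \<i>"
proof -
  define F where "F = (\<lambda>z \<mu>. 1 / (z - \<mu>)\<^sup>2 - 1 / \<mu>\<^sup>2 :: complex)"
  have n: "z \<notin> wide_lattice" "z - \<i> \<notin> wide_lattice"
    using z wide_subset_square minus_ii_notin_wide by blast+
  have 1: "(F z has_sum L2.wp_reg z) (wide_lattice - {0})"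
    unfolding F_def L2.wp_reg_def using n by (intro has_sum_infsum L2.wp_reg_summable) auto
  have wp: "(F w has_sum L2.wp w) wide_lattice" if "w \<notin> wide_lattice" for w
    unfolding F_def using that by (rule L2.wp_has_sum)
  have "((\<lambda>\<mu>. F (z - \<i>) \<mu> - F (- \<i>) \<mu>) has_sum (L2.wp (z - \<i>) - L2.wp (- \<i>))) wide_lattice"
  proof -
    have "((\<lambda>\<mu>. - F (- \<i>) \<mu>) has_sum (- L2.wp (- \<i>))) wide_lattice"
      unfolding has_sum_uminus minus_minus by (rule wp[OF ii_notin_wide(2)])
    from has_sum_add[OF wp[OF n(2)] this] show ?thesis by simp
  qed
  moreover have "F (z - \<i>) \<mu> - F (- \<i>) \<mu> = F z (\<mu> + \<i>)" for \<mu>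
  proof -
    have "(- \<i> - \<mu>)\<^sup>2 = (\<mu> + \<i>)\<^sup>2" by (simp add: power2_eq_square algebra_simps)
    then show ?thesis unfolding F_def by (simp add: algebra_simps)
  qed
  ultimately have "((F z \<circ> (\<lambda>\<mu>. \<mu> + \<i>)) has_sum (L2.wp (z - \<i>) - L2.wp \<i>)) wide_lattice"
    by (simp add: o_def L2.wp_uminus)
  then have 2: "(F z has_sum (L2.wp (z - \<i>) - L2.wp \<i>)) ((\<lambda>\<mu>. \<mu> + \<i>) ` wide_lattice)"
    by (subst has_sum_reindex) (auto simp: inj_on_def)
  have "(F z has_sum (L2.wp_reg z + (L2.wp (z - \<i>) - L2.wp \<i>))) (square_lattice - {0})"
    unfolding square_lattice_eq by (rule has_sum_Un_disjoint[OF 1 2 wide_disjoint])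
  then have "L1.wp_reg z = L2.wp_reg z + (L2.wp (z - \<i>) - L2.wp \<i>)"
    unfolding L1.wp_reg_def F_def by (rule infsumI)
  then show ?thesis by (simp add: L1.wp_def L2.wp_def)
qed

text \<open>The values at the half periods \<open>1/2\<close>, \<open>1/2 - \<i>\<close> and
  \<open>\<i>\<close> of the wide lattice add up to 0, while the first two minus the third give
  \<open>L1.wp (1/2)\<close>, which is \<open>lemniscate\<^sup>2\<close>. So the latter is minus
  twice the third value.\<close>

lemma wp_ii: "L2.wp \<i> = - of_real (lemniscate\<^sup>2 / 2)"
proof -
  define a where "a = (1/2 :: complex)"
  have h: "1/2 \<notin> (\<int> :: real set)" "1/4 \<notin> (\<int> :: real set)" "- (1/2) \<notin> (\<int> :: real set)"
    using frac_not_Ints[of "1/2"] frac_not_Ints[of "1/4"] by (auto simp: minus_in_Ints_iff)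
  have m1: "- 1 \<in> (\<int> :: real set)" by simp
  have "L2.wp a + L2.wp (a - \<i>) + L2.wp \<i> = 0"
  proof (rule L2.wp_half_periods_sum)
    show "a \<notin> wide_lattice" "a - \<i> \<notin> wide_lattice" "\<i> \<notin> wide_lattice" "a - (a - \<i>) \<notin> wide_lattice"
      "a - \<i> \<notin> wide_lattice" "a - \<i> - \<i> \<notin> wide_lattice"
      using h by (simp_all add: a_def in_L2_iff)
    show "2 * a \<in> wide_lattice" "2 * (a - \<i>) \<in> wide_lattice" "2 * \<i> \<in> wide_lattice"
      using m1 by (simp_all add: a_def in_L2_iff)
  qed
  moreover have "L1.wp a = L2.wp a + L2.wp (a - \<i>) - L2.wp \<i>"
    using half_in_L1 by (intro wp_square_wide) (simp add: a_def)
  moreover have "L1.wp a = of_real (lemniscate\<^sup>2)"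
    unfolding a_def wp_half e1_eq by simp
  ultimately have "of_real (lemniscate\<^sup>2) = - 2 * L2.wp \<i>" by algebra
  then show ?thesis by simp
qed

text \<open>The comparison of the two functions and the half-period translation formula combine to
  \<open>(L1.wp z - L2.wp z) * (L2.wp z - e) = D\<close> with a constant \<open>D\<close>. The poles
  in the first factor cancel and its expansion starts at order 2; the coefficients of order 0 and 2
  of the product are the two equations.\<close>

lemma wp_coeff_differences:
  defines "e \<equiv> L2.wp \<i>"
  shows "L1.wp_coeff 2 - L2.wp_coeff 2 = 3 * e\<^sup>2 - 5 * L2.wp_coeff 2"
    and "L1.wp_coeff 4 - L2.wp_coeff 4 = e * (3 * e\<^sup>2 - 5 * L2.wp_coeff 2)"
proof -
  define D where "D = 3 * e\<^sup>2 - 5 * L2.wp_coeff 2"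
  define A where "A = L1.wp_fps - L2.wp_fps"
  define Q where "Q = L2.wp_fps - fps_const e"
  define X where "X = (fls_X_intpow (-2) :: complex fls)"
  have rel: "(L1.wp z - L2.wp z) * (L2.wp z - e) = D" if z: "z \<notin> square_lattice" for z
  proof -
    have n: "z \<notin> wide_lattice" "z - \<i> \<notin> wide_lattice" "z + \<i> \<notin> wide_lattice"
      using z wide_subset_square minus_ii_notin_wide wide_subset_square[of "z + \<i>"] by (auto simp: in_L1_iff)
    have "L2.wp (z - \<i>) = L2.wp (z + \<i>)"
      using L2.wp_periodic[OF ii_notin_wide(3) n(2)] by (simp add: algebra_simps)
    then have "L1.wp z - L2.wp z = L2.wp (z + \<i>) - e"
      using wp_square_wide[OF z] by (simp add: e_def)
    then show ?thesis
      using L2.wp_half_period_translate[OF ii_notin_wide(1,3) n(1,3)] by (simp add: e_def D_def)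
  qed
  have "(\<lambda>z. (L1.wp z - L2.wp z) * (L2.wp z - e)) has_laurent_expansion
      (L1.wp_fls - L2.wp_fls) * (L2.wp_fls - fls_const e)"
    by (intro laurent_expansion_intros L1.wp_has_laurent L2.wp_has_laurent)
  also have "?this \<longleftrightarrow> (\<lambda>_. D) has_laurent_expansion (L1.wp_fls - L2.wp_fls) * (L2.wp_fls - fls_const e)"
    by (intro has_laurent_expansion_cong refl eventually_mono[OF L1.eventually_not_in_lattice[of 0] rel])
  finally have "(L1.wp_fls - L2.wp_fls) * (L2.wp_fls - fls_const e) = fls_const D"
    by (rule has_laurent_expansion_unique[OF _ has_laurent_expansion_const])
  moreover have "L1.wp_fls - L2.wp_fls = fps_to_fls A"
    by (intro fls_eqI) (simp add: L1.wp_fls_nth L2.wp_fls_nth A_def L1.wp_fps_def L2.wp_fps_def)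
  moreover have "L2.wp_fls - fls_const e = X + fps_to_fls Q"
    by (intro fls_eqI) (auto simp: L2.wp_fls_def X_def Q_def fls_const_def)
  ultimately have eq: "X * fps_to_fls A + fps_to_fls (A * Q) = fls_const D"
    by (simp only: fls_times_fps_to_fls ring_distribs mult.commute)
  have An: "fps_nth A n = L1.wp_coeff n - L2.wp_coeff n" for n
    by (simp add: A_def L1.wp_fps_def L2.wp_fps_def)
  have A01: "fps_nth A 0 = 0" "fps_nth A 1 = 0"
    using L1.wp_coeff_odd[of 1] L2.wp_coeff_odd[of 1] by (simp_all add: An)
  have Q0: "fps_nth Q 0 = - e" by (simp add: Q_def L2.wp_fps_def)
  have nth: "fls_nth (X * fps_to_fls A) k = (if k + 2 < 0 then 0 else fps_nth A (nat (k + 2)))" for k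
    unfolding X_def fls_X_intpow_times_conv_shift by auto
  have "fls_nth (X * fps_to_fls A + fps_to_fls (A * Q)) 0 = D" unfolding eq by simp
  then have 2: "fps_nth A 2 = D" unfolding fls_plus_nth nth by (simp add: A01)
  then show "L1.wp_coeff 2 - L2.wp_coeff 2 = 3 * e\<^sup>2 - 5 * L2.wp_coeff 2" by (simp add: An D_def)
  have "fls_nth (X * fps_to_fls A + fps_to_fls (A * Q)) 2 = 0" unfolding eq by simp
  moreover have "fps_nth (A * Q) 2 = - (e * D)"
    using A01 Q0 2 by (simp add: fps_mult_nth numeral_2_eq_2)
  ultimately have "fps_nth A 4 = e * D" unfolding fls_plus_nth nth by (simp add: add_eq_0_iff)
  then show "L1.wp_coeff 4 - L2.wp_coeff 4 = e * (3 * e\<^sup>2 - 5 * L2.wp_coeff 2)" by (simp add: An D_def)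
qed

lemma wp_coeff_L1: "L1.wp_coeff 2 = of_real (lemniscate ^ 4 / 5)" "L1.wp_coeff 4 = 0"
proof -
  show "L1.wp_coeff 2 = of_real (lemniscate ^ 4 / 5)"
    unfolding wp_coeff_2_L1 e1_eq by simp
  show "L1.wp_coeff 4 = 0"
    using L1.eisenstein_mult_ii[OF ii_L1, of 6] by (simp add: L1.wp_coeff_def)
qed

text \<open>With \<open>e = - (w\<^sup>2 / 2)\<close> the first difference gives
  \<open>4 * L2.wp_coeff 2 = (3/4 - 1/5) * w ^ 4\<close>, the origin of
  \<open>s_seq 2 = 11/80\<close>. Then \<open>3/4 - 5 * 11/80 = 1/16\<close>, and half of this is
  \<open>s_seq 3 = 1/32\<close>.\<close>

lemma wp_coeff_L2: "L2.wp_coeff 2 = of_real (11 / 80 * lemniscate ^ 4)" "L2.wp_coeff 4 = of_real (lemniscate ^ 6 / 32)"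
proof -
  define w where "w = complex_of_real lemniscate"
  have e: "L2.wp \<i> = - (w\<^sup>2 / 2)" by (simp add: wp_ii w_def)
  have c1: "L1.wp_coeff 2 = w ^ 4 / 5" by (simp add: wp_coeff_L1 w_def)
  have w4: "(w\<^sup>2 / 2)\<^sup>2 = w ^ 4 / 4" by (simp add: power_divide)
  have "4 * L2.wp_coeff 2 = 3 * (w ^ 4 / 4) - w ^ 4 / 5"
  proof -
    have "4 * c = B - A" if "A - c = B - 5 * c" for A B c :: complex
      using that by (simp add: algebra_simps)
    then show ?thesis using wp_coeff_differences(1) unfolding e c1 power2_minus w4 .
  qed
  moreover have "c = 11 / 80 * y" if "4 * c = 3 * (y / 4) - y / 5" for c y :: complex
  proof -
    have "c = (3 * (y / 4) - y / 5) / 4" using that by (metis nonzero_mult_div_cancel_left zero_neq_numeral)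
    also have "\<dots> = 11 / 80 * y" by (simp add: field_simps)
    finally show ?thesis .
  qed
  ultimately have c2: "L2.wp_coeff 2 = 11 / 80 * w ^ 4" by blast
  then show "L2.wp_coeff 2 = of_real (11 / 80 * lemniscate ^ 4)" by (simp add: w_def)
  have "- L2.wp_coeff 4 = - (w\<^sup>2 / 2) * (3 * (w ^ 4 / 4) - 5 * (11 / 80 * w ^ 4))"
    using wp_coeff_differences(2) unfolding e c2 wp_coeff_L1(2) power2_minus w4 by simp
  also have "\<dots> = - (w\<^sup>2 * w ^ 4 / 32)"
  proof -
    have "- (x / 2) * (3 * (y / 4) - 5 * (11 / 80 * y)) = - (x * y / 32)" for x y :: complex
      by (simp add: field_simps)
    then show ?thesis .
  qed
  also have "w\<^sup>2 * w ^ 4 = w ^ 6" by (simp flip: power_add)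
  finally show "L2.wp_coeff 4 = of_real (lemniscate ^ 6 / 32)" by (simp add: w_def)
qed

subsection \<open>Theta series and their L-functions\<close>

lemma eisenstein_L1:
  assumes "n \<ge> 2"
  shows "(2 * of_nat n - 1) * L1.eisenstein (2 * n) = of_rat (r_seq n) * of_real lemniscate ^ (2 * n)"
proof -
  have "L1.wp_coeff (2 * n - 2) = of_rat (r_seq n) * of_real lemniscate ^ (2 * n)"
  proof (rule L1.wp_coeff_eq_seq[OF r_seq_rec _ _ assms])
    show "L1.wp_coeff 2 = of_rat (r_seq 2) * of_real lemniscate ^ 4"
      by (simp add: wp_coeff_L1 r_seq_values of_rat_divide)
    show "L1.wp_coeff 4 = of_rat (r_seq 3) * of_real lemniscate ^ 6"
      by (simp add: wp_coeff_L1 r_seq_values)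
  qed
  then show ?thesis using L1.wp_coeff_eisenstein[OF assms] by simp
qed

lemma eisenstein_L2:
  assumes "n \<ge> 2"
  shows "(2 * of_nat n - 1) * L2.eisenstein (2 * n) = of_rat (s_seq n) * of_real lemniscate ^ (2 * n)"
proof -
  have "L2.wp_coeff (2 * n - 2) = of_rat (s_seq n) * of_real lemniscate ^ (2 * n)"
  proof (rule L2.wp_coeff_eq_seq[OF s_seq_rec _ _ assms])
    show "L2.wp_coeff 2 = of_rat (s_seq 2) * of_real lemniscate ^ 4"
      by (simp add: wp_coeff_L2 s_seq_values of_rat_divide)
    show "L2.wp_coeff 4 = of_rat (s_seq 3) * of_real lemniscate ^ 6"
      by (simp add: wp_coeff_L2 s_seq_values of_rat_divide)
  qed
  then show ?thesis using L2.wp_coeff_eisenstein[OF assms] by simp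
qed

lemma r_seq_nonneg: "r_seq n \<ge> 0"
proof (induction n rule: less_induct)
  case (less n)
  have "(\<Sum>j = 2..n - 2. r_seq j * r_seq (n - j)) \<ge> 0" if "n > 3"
    by (intro sum_nonneg mult_nonneg_nonneg less.IH) (use that in auto)
  then show ?case by (subst r_seq.simps) (auto intro!: divide_nonneg_nonneg mult_nonneg_nonneg)
qed

text \<open>The product of \<open>r_seq 2\<close> with the preceding even-indexed value keeps the
  sum positive; at odd indices the sequence vanishes. Positivity matters because
  \<open>alpha\<close> divides by these values, and a division by 0 would give 0.\<close>

lemma r_seq_pos:
  assumes "n > 0"
  shows "r_seq (2 * n) > 0"
  using assms
proof (induction n)
  case (Suc n)
  show ?case
  proof (cases "n = 0")
    case True
    then show ?thesis using r_seq_values(1) by (simp add: numeral_2_eq_2)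
  next
    case False
    have "0 < r_seq 2 * r_seq (2 * Suc n - 2)"
      using Suc.IH False r_seq_values(1) by simp
    also have "\<dots> \<le> (\<Sum>j = 2..2 * Suc n - 2. r_seq j * r_seq (2 * Suc n - j))"
      using False by (intro member_le_sum[of 2 _ "\<lambda>j. r_seq j * r_seq (2 * Suc n - j)"] mult_nonneg_nonneg r_seq_nonneg) auto
    finally have "(\<Sum>j = 2..2 * Suc n - 2. r_seq j * r_seq (2 * Suc n - j)) > 0" .
    moreover have "rat_of_nat (2 * Suc n) - 3 > 0" using False by simp
    moreover have "2 * rat_of_nat (2 * Suc n) + 1 > 0" by (simp add: add_nonneg_pos)
    ultimately show ?thesis
      using False by (subst r_seq.simps) (auto intro!: divide_pos_pos mult_pos_pos simp del: of_nat_mult of_nat_Suc mult_Suc_right)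
  qed
qed simp

lemma s_seq_pos: "n \<ge> 1 \<Longrightarrow> s_seq n > 0"
proof (induction n rule: less_induct)
  case (less n)
  show ?case
  proof (cases "n \<le> 3")
    case True
    with less.prems have "n = 1 \<or> n = 2 \<or> n = 3" by auto
    then show ?thesis using s_seq_values by auto
  next
    case False
    have "(\<Sum>j = 2..n - 2. s_seq j * s_seq (n - j)) > 0"
      using False by (intro sum_pos mult_pos_pos less.IH) auto
    moreover have "rat_of_nat n - 3 > 0" "2 * rat_of_nat n + 1 > 0" using False by (auto simp: add_nonneg_pos)
    ultimately show ?thesis
      using False by (subst s_seq.simps) (auto intro!: divide_pos_pos mult_pos_pos)
  qed
qed

section \<open>Lattice sums as q-expansions and Dirichlet series\<close>

lemma finite_norm_form: "finite {p. norm_form p = N}"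
proof (rule finite_subset)
  show "{p. norm_form p = N} \<subseteq> {-\<bar>N\<bar>..\<bar>N\<bar>} \<times> {-\<bar>N\<bar>..\<bar>N\<bar>}"
  proof
    fix p assume "p \<in> {p. norm_form p = N}"
    then have N: "(fst p)\<^sup>2 + (snd p)\<^sup>2 = N" by (simp add: norm_form_def)
    have sq: "\<bar>x\<bar> \<le> x\<^sup>2" for x :: int
    proof (cases "x = 0")
      case False
      then have "\<bar>x\<bar> \<le> \<bar>x\<bar>\<^sup>2" by (intro self_le_power) auto
      then show ?thesis by simp
    qed simp
    have "\<bar>fst p\<bar> \<le> \<bar>N\<bar>" "\<bar>snd p\<bar> \<le> \<bar>N\<bar>"
      using sq[of "fst p"] sq[of "snd p"] N zero_le_power2[of "fst p"] zero_le_power2[of "snd p"] by linarith+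
    then show "p \<in> {-\<bar>N\<bar>..\<bar>N\<bar>} \<times> {-\<bar>N\<bar>..\<bar>N\<bar>}" by (auto simp: mem_Times_iff abs_le_iff)
  qed
qed simp

text \<open>An unordered sum may be grouped freely; grouping by \<open>n\<^sup>2 + m\<^sup>2\<close>
  serves the q-expansion and the Dirichlet series alike.\<close>

lemma sums_by_norm_form:
  fixes f :: "int \<times> int \<Rightarrow> complex"
  assumes "(f has_sum S) UNIV"
  shows "(\<lambda>N. \<Sum>p | norm_form p = int N. f p) sums S"
proof -
  define B where "B = (\<lambda>N. {p. norm_form p = int N})"
  define h where "h = (\<lambda>p. (nat (norm_form p), p))"
  have img: "h ` UNIV = Sigma UNIV B"
    using norm_form_nonneg by (force simp: h_def B_def image_iff)
  have "inj h" by (auto simp: inj_on_def h_def)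
  then have "((\<lambda>x. f (snd x)) has_sum S) (h ` UNIV)"
    using assms by (simp add: has_sum_reindex o_def h_def)
  then have S: "((\<lambda>x. f (snd x)) has_sum S) (Sigma UNIV B)" by (simp only: img)
  have "((\<lambda>N. \<Sum>p\<in>B N. f p) has_sum S) UNIV"
  proof (rule has_sum_Sigma'[OF S])
    show "((\<lambda>p. f (snd (N, p))) has_sum (\<Sum>p\<in>B N. f p)) (B N)" for N
      using finite_norm_form[of "int N"] by (simp add: B_def)
  qed
  then show ?thesis unfolding B_def by (rule has_sum_imp_sums)
qed

lemma holomorphic_on_infsum:
  fixes f :: "'a \<Rightarrow> complex \<Rightarrow> complex"
  assumes S: "open S" and holo: "\<And>i. i \<in> I \<Longrightarrow> f i holomorphic_on S"
    and bound: "\<And>z. z \<in> S \<Longrightarrow> \<exists>r>0. \<exists>M. cball z r \<subseteq> S \<and> M summable_on I \<and> (\<forall>i\<in>I. \<forall>w\<in>cball z r. norm (f i w) \<le> M i)"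
  shows "(\<lambda>w. \<Sum>\<^sub>\<infinity>i\<in>I. f i w) holomorphic_on S"
proof -
  have "(\<lambda>w. \<Sum>\<^sub>\<infinity>i\<in>I. f i w) analytic_on {z}" if z: "z \<in> S" for z
  proof -
    obtain r M where r: "r > 0" "cball z r \<subseteq> S" "M summable_on I"
      and M: "\<And>i w. i \<in> I \<Longrightarrow> w \<in> cball z r \<Longrightarrow> norm (f i w) \<le> M i"
      using bound[OF z] by blast
    have ul: "uniform_limit (cball z r) (\<lambda>X w. \<Sum>i\<in>X. f i w) (\<lambda>w. \<Sum>\<^sub>\<infinity>i\<in>I. f i w) (finite_subsets_at_top I)"
      by (rule Weierstrass_m_test_general[OF M r(3)])
    have "\<forall>\<^sub>F X in finite_subsets_at_top I. continuous_on (cball z r) (\<lambda>w. \<Sum>i\<in>X. f i w) \<and> (\<lambda>w. \<Sum>i\<in>X. f i w) holomorphic_on ball z r"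
    proof (rule eventually_finite_subsets_at_top_weakI)
      fix X assume "X \<subseteq> I"
      then have "(\<lambda>w. \<Sum>i\<in>X. f i w) holomorphic_on S" using holo by (intro holomorphic_on_sum) auto
      then show "continuous_on (cball z r) (\<lambda>w. \<Sum>i\<in>X. f i w) \<and> (\<lambda>w. \<Sum>i\<in>X. f i w) holomorphic_on ball z r"
        using r(2) ball_subset_cball[of z r]
        by (meson holomorphic_on_imp_continuous_on holomorphic_on_subset order_trans)
    qed
    from holomorphic_uniform_limit[OF this ul]
    have "(\<lambda>w. \<Sum>\<^sub>\<infinity>i\<in>I. f i w) holomorphic_on ball z r" by auto
    then show ?thesis unfolding analytic_at using r(1) by (intro exI[of _ "ball z r"]) auto
  qed
  then have "(\<lambda>w. \<Sum>\<^sub>\<infinity>i\<in>I. f i w) analytic_on S" using analytic_on_analytic_at by blast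
  then show ?thesis by (rule analytic_imp_holomorphic)
qed

text \<open>No \<open>\<tau>\<close> gives \<open>q = 0\<close>, so the two power series are known
  to agree on the punctured unit disc only; comparing Laurent expansions at 0 still identifies all
  coefficients. This justifies the definite description in \<open>q_coeff\<close>.\<close>

lemma q_expansion_unique:
  assumes "has_q_expansion f \<gamma>" "has_q_expansion f \<delta>"
  shows "\<gamma> = \<delta>"
proof -
  have sums: "\<exists>v. (\<lambda>n. \<gamma> n * q ^ n) sums v \<and> (\<lambda>n. \<delta> n * q ^ n) sums v" if q: "q \<noteq> 0" "norm q < 1" for q
  proof -
    define \<tau> where "\<tau> = Ln q / (2 * of_real pi * \<i>)"
    have e: "exp (2 * of_real pi * \<i> * \<tau>) = q" using q by (simp add: \<tau>_def)
    have "norm q = exp (- (2 * pi * Im \<tau>))" unfolding e[symmetric] by (simp add: norm_exp_eq_Re)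
    then have "Im \<tau> > 0" using q(2) by (simp add: zero_less_mult_iff)
    with assms show ?thesis unfolding has_q_expansion_def e[symmetric] by blast
  qed
  define F where "F = (\<lambda>\<gamma> q. \<Sum>n. \<gamma> n * q ^ n :: complex)"
  have ev: "eventually (\<lambda>q. q \<in> ball 0 1) (nhds (0 :: complex))" by (intro eventually_nhds_in_open) auto
  have exp: "F \<gamma> has_fps_expansion Abs_fps \<gamma>" 
    if "\<And>q. q \<noteq> 0 \<Longrightarrow> norm q < 1 \<Longrightarrow> summable (\<lambda>n. \<gamma> n * q ^ n)" for \<gamma> :: "nat \<Rightarrow> complex"
  proof (rule has_fps_expansionI)
    show "eventually (\<lambda>q. (\<lambda>n. fps_nth (Abs_fps \<gamma>) n * q ^ n) sums F \<gamma> q) (nhds 0)"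
      using ev
    proof eventually_elim
      case (elim q)
      have "summable (\<lambda>n. \<gamma> n * q ^ n)"
      proof (cases "q = 0")
        case False
        with that[of q] elim show ?thesis by simp
      qed (simp add: summable_0_powser)
      then show ?case by (simp add: F_def summable_sums)
    qed
  qed
  have 1: "F \<gamma> has_laurent_expansion fps_to_fls (Abs_fps \<gamma>)" and 2: "F \<delta> has_laurent_expansion fps_to_fls (Abs_fps \<delta>)"
    by (intro has_laurent_expansion_fps exp; use sums in \<open>blast intro: sums_summable\<close>)+
  have "eventually (\<lambda>q. q \<in> ball 0 1 - {0}) (at (0 :: complex))" by (intro eventually_at_in_open) auto
  then have "eventually (\<lambda>q. F \<gamma> q = F \<delta> q) (at 0)"
  proof eventually_elim
    case (elim q)
    then obtain v where "(\<lambda>n. \<gamma> n * q ^ n) sums v" "(\<lambda>n. \<delta> n * q ^ n) sums v" using sums[of q] by auto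
    then show ?case by (simp add: F_def sums_iff)
  qed
  from has_laurent_expansion_cong[OF this refl] 1 have "F \<delta> has_laurent_expansion fps_to_fls (Abs_fps \<gamma>)" by blast
  from has_laurent_expansion_unique[OF this 2] have "Abs_fps \<gamma> = Abs_fps \<delta>"
    by (metis fls_regpart_fps_trivial)
  then have "fps_nth (Abs_fps \<gamma>) n = fps_nth (Abs_fps \<delta>) n" for n by (rule arg_cong)
  then show ?thesis by (simp add: fun_eq_iff)
qed

lemma q_coeff_eqI: "has_q_expansion f \<gamma> \<Longrightarrow> q_coeff f = \<gamma>"
  unfolding q_coeff_def by (rule the_equality) (auto intro: q_expansion_unique)

text \<open>The parameter \<open>d\<close> stands for \<open>(k - 1) div 2\<close>, so the power is
  \<open>k - 1\<close>.\<close>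

definition theta_term :: "nat \<Rightarrow> int \<times> int \<Rightarrow> complex" where
  "theta_term d p = (-1) powi (snd p * int d) * (of_int (fst p) - \<i> * of_int (snd p)) ^ (2 * d)"

lemma norm_theta_term: "norm (theta_term d p) = real_of_int (norm_form p) ^ d"
proof -
  have "norm (of_int (fst p) - \<i> * of_int (snd p)) ^ 2 = real_of_int (norm_form p)"
    by (simp add: cmod_power2 norm_form_def)
  then show ?thesis
    by (simp add: theta_term_def norm_mult norm_power_int norm_power power_mult)
qed

lemma theta_term_0: "d > 0 \<Longrightarrow> theta_term d (0, 0) = 0"
  by (simp add: theta_term_def)

text \<open>With \<open>y\<close> the \<open>m\<close>-th root of \<open>r\<close>, the expression
  is the \<open>m\<close>-th power of \<open>n * y ^ n\<close>, which tends to 0.\<close>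

lemma poly_times_power_bounded:
  fixes r :: real
  assumes "0 \<le> r" "r < 1" "m > 0"
  shows "\<exists>C. \<forall>n. real n ^ m * r ^ n \<le> C"
proof -
  define y where "y = root m r"
  have y: "y \<ge> 0" "y < 1" "y ^ m = r" using assms by (auto simp: y_def)
  have "(\<lambda>n. of_nat n * y ^ n) \<longlonglongrightarrow> 0" using y by (intro powser_times_n_limit_0) auto
  from tendsto_power[OF this, of m] have "(\<lambda>n. (real n * y ^ n) ^ m) \<longlonglongrightarrow> 0 ^ m" .
  then have "Bseq (\<lambda>n. (real n * y ^ n) ^ m)" by (intro convergent_imp_Bseq) (auto simp: convergent_def)
  then obtain C where C: "\<And>n. norm ((real n * y ^ n) ^ m) \<le> C" by (auto simp: Bseq_def)
  have "real n ^ m * r ^ n \<le> C" for n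
  proof -
    have "(real n * y ^ n) ^ m = real n ^ m * r ^ n"
      unfolding power_mult_distrib y(3)[symmetric] by (simp add: mult.commute flip: power_mult)
    then show ?thesis using C[of n] by simp
  qed
  then show ?thesis by blast
qed

definition theta_coeff :: "nat \<Rightarrow> nat \<Rightarrow> complex" where
  "theta_coeff d N = 1 / 4 * (\<Sum>p | norm_form p = int N. theta_term d p)"

lemma theta_f_q_expansion:
  assumes d: "d > 0" and k: "k = 2 * d + 1"
  shows "has_q_expansion (theta_f k) (theta_coeff d)"
  unfolding has_q_expansion_def
proof (intro allI impI)
  fix \<tau> assume \<tau>: "Im \<tau> > 0"
  define q where "q = exp (2 * of_real pi * \<i> * \<tau>)"
  have q: "q \<noteq> 0" "norm q < 1" using \<tau> by (auto simp: q_def norm_exp_eq_Re)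
  define f where "f = (\<lambda>p. theta_term d p * q powi norm_form p)"
  \<comment> \<open>The exponent \<open>d\<close> absorbs the size of \<open>theta_term\<close>; the
    extra 2 leaves the majorant \<open>norm_form p powr (- 2)\<close>, beyond the critical exponent
    1.\<close>
  obtain C where C: "\<And>n. real n ^ (d + 2) * norm q ^ n \<le> C"
    using poly_times_power_bounded[of "norm q" "d + 2"] q(2) by fastforce
  have "(\<lambda>p. C * real_of_int (norm_form p) powr (- 2)) summable_on UNIV"
    by (intro summable_on_cmult_right summable_norm_form) simp
  then have "(\<lambda>p. norm (f p)) summable_on UNIV"
  proof (rule summable_on_comparison_test)
    fix p
    show "norm (f p) \<le> C * real_of_int (norm_form p) powr (- 2)"
    proof (cases "p = (0, 0)")
      case True
      then show ?thesis by (simp add: f_def theta_term_0[OF d] norm_form_def)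
    next
      case False
      define N where "N = nat (norm_form p)"
      have N: "norm_form p = int N" "N > 0" using norm_form_ge_1[OF False] by (auto simp: N_def)
      have "norm (f p) = real N ^ d * norm q ^ N"
        by (simp add: f_def norm_mult norm_theta_term norm_power N)
      also have "\<dots> = (real N ^ (d + 2) * norm q ^ N) / real N ^ 2"
        using N by (simp add: power_add power2_eq_square)
      also have "\<dots> \<le> C / real N ^ 2" by (intro divide_right_mono C) simp
      also have "\<dots> = C * real_of_int (norm_form p) powr (- 2)"
      proof -
        have "real N powr (- 2) = inverse (real N powr 2)" by (rule powr_minus)
        also have "real N powr 2 = real N ^ 2" using N by (intro powr_numeral) simp
        finally show ?thesis by (simp add: N(1) divide_inverse)
      qed
      finally show ?thesis .
    qed
  qed simp
  then have f: "(f has_sum infsum f UNIV) UNIV" by (rule has_sum_infsum[OF abs_summable_summable])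
  have "theta_f k \<tau> = 1 / 4 * infsum f UNIV"
  proof -
    have "(k - 1) div 2 = d" "k - 1 = 2 * d" using k by auto
    then show ?thesis unfolding theta_f_def f_def theta_term_def norm_form_def q_def
      by (simp add: case_prod_unfold)
  qed
  moreover have "(\<lambda>N. 1 / 4 * (\<Sum>p | norm_form p = int N. f p)) sums (1 / 4 * infsum f UNIV)"
    by (intro sums_mult sums_by_norm_form f)
  moreover have "(\<lambda>N. 1 / 4 * (\<Sum>p | norm_form p = int N. f p)) = (\<lambda>N. theta_coeff d N * q ^ N)"
    by (simp add: fun_eq_iff theta_coeff_def f_def sum_distrib_right mult.assoc)
  ultimately show "(\<lambda>n. theta_coeff d n * exp (2 * of_real pi * \<i> * \<tau>) ^ n) sums theta_f k \<tau>"
    unfolding q_def[symmetric] by (simp only:)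
qed

lemma dirichlet_term_norm:
  assumes "p \<noteq> (0, 0)"
  shows "norm (theta_term d p / of_int (norm_form p) powr w) = real_of_int (norm_form p) powr (- (Re w - d))"
proof -
  define N where "N = real_of_int (norm_form p)"
  have N: "N > 0" using norm_form_ge_1[OF assms] by (simp add: N_def)
  have "norm (complex_of_real N powr w) = N powr Re w" using N by (simp add: norm_powr_real_powr)
  then have "norm (theta_term d p / of_int (norm_form p) powr w) = N ^ d / N powr Re w"
    by (simp add: norm_divide norm_theta_term N_def)
  also have "\<dots> = N powr (real d - Re w)" using N by (simp add: powr_diff powr_realpow)
  finally show ?thesis by (simp add: N_def)
qed

lemma dirichlet_abs_summable:
  assumes d: "d > 0" and w: "Re w > real d + 1"
  shows "(\<lambda>p. norm (theta_term d p / of_int (norm_form p) powr w)) summable_on UNIV"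
proof -
  have "(\<lambda>p. real_of_int (norm_form p) powr (- (Re w - d))) summable_on UNIV"
    using w by (intro summable_norm_form) simp
  then show ?thesis
  proof (rule summable_on_comparison_test)
    fix p
    show "norm (theta_term d p / of_int (norm_form p) powr w) \<le> real_of_int (norm_form p) powr (- (Re w - d))"
      using dirichlet_term_norm[of p d w] by (cases "p = (0, 0)") (simp_all add: theta_term_0[OF d])
  qed simp
qed

lemma dirichlet_sums:
  assumes d: "d > 0" and k: "k = 2 * d + 1" and w: "Re w > real d + 1"
  shows "(\<lambda>n. q_coeff (theta_f k) (Suc n) / of_nat (Suc n) powr w) sums
    (1 / 4 * (\<Sum>\<^sub>\<infinity>p. theta_term d p / of_int (norm_form p) powr w))"
proof -
  define f where "f = (\<lambda>p. theta_term d p / of_int (norm_form p) powr w)"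
  have "(f has_sum infsum f UNIV) UNIV"
    unfolding f_def by (rule has_sum_infsum[OF abs_summable_summable[OF dirichlet_abs_summable[OF d w]]])
  then have "(\<lambda>N. 1 / 4 * (\<Sum>p | norm_form p = int N. f p)) sums (1 / 4 * infsum f UNIV)"
    by (intro sums_mult sums_by_norm_form)
  moreover have "(\<lambda>N. 1 / 4 * (\<Sum>p | norm_form p = int N. f p)) = (\<lambda>N. theta_coeff d N / of_nat N powr w)"
    by (simp add: fun_eq_iff theta_coeff_def f_def sum_divide_distrib mult.commute)
  ultimately have s: "(\<lambda>N. theta_coeff d N / of_nat N powr w) sums (1 / 4 * infsum f UNIV)" by (simp only:)
  \<comment> \<open>As \<open>0 powr w = 0\<close> and division by 0 gives 0, the series over all
    \<open>N\<close> may start at 1, as the L-series does.\<close>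
  have "theta_coeff d 0 / of_nat 0 powr w = 0" by simp
  with s have "(\<lambda>n. theta_coeff d (Suc n) / of_nat (Suc n) powr w) sums (1 / 4 * infsum f UNIV)"
    using sums_Suc_iff[of "\<lambda>N. theta_coeff d N / of_nat N powr w" "1 / 4 * infsum f UNIV"] by (simp only: add_0_right)
  moreover have "q_coeff (theta_f k) = theta_coeff d"
    by (rule q_coeff_eqI[OF theta_f_q_expansion[OF d k]])
  ultimately show ?thesis by (simp only: f_def)
qed

lemma dirichlet_holomorphic:
  assumes d: "d > 0"
  shows "(\<lambda>w. 1 / 4 * (\<Sum>\<^sub>\<infinity>p. theta_term d p / of_int (norm_form p) powr w)) holomorphic_on {w. Re w > real d + 1}"
proof (rule holomorphic_on_mult[OF holomorphic_on_const], rule holomorphic_on_infsum)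
  show "open {w. Re w > real d + 1}" by (rule open_halfspace_Re_gt)
  fix p :: "int \<times> int"
  show "(\<lambda>w. theta_term d p / of_int (norm_form p) powr w) holomorphic_on {w. Re w > real d + 1}"
    using norm_form_eq_0_iff[of p] by (cases "p = (0, 0)") (auto intro!: holomorphic_intros simp: theta_term_0[OF d])
next
  fix z assume z: "z \<in> {w. Re w > real d + 1}"
  define r where "r = (Re z - d - 1) / 2"
  have r: "r > 0" using z by (simp add: r_def)
  have Re: "Re w - d \<ge> 1 + r" if "w \<in> cball z r" for w
  proof -
    have "Re (z - w) \<le> norm (z - w)" by (rule complex_Re_le_cmod)
    also have "\<dots> \<le> r" using that by (simp add: dist_norm)
    finally have "Re z - Re w \<le> r" by simp
    moreover have "2 * r = Re z - d - 1" by (simp add: r_def)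
    ultimately show ?thesis by linarith
  qed
  show "\<exists>r>0. \<exists>M. cball z r \<subseteq> {w. Re w > real d + 1} \<and> M summable_on UNIV \<and>
      (\<forall>p\<in>UNIV. \<forall>w\<in>cball z r. norm (theta_term d p / of_int (norm_form p) powr w) \<le> M p)"
  proof (intro exI[of _ r] exI[of _ "\<lambda>p. real_of_int (norm_form p) powr (- (1 + r))"] conjI ballI r)
    show "cball z r \<subseteq> {w. Re w > real d + 1}" using Re r by force
    show "(\<lambda>p. real_of_int (norm_form p) powr (- (1 + r))) summable_on UNIV"
      using r by (intro summable_norm_form) simp
    fix p w assume w: "w \<in> cball z r"
    show "norm (theta_term d p / of_int (norm_form p) powr w) \<le> real_of_int (norm_form p) powr (- (1 + r))"
    proof (cases "p = (0, 0)")
      case False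
      then show ?thesis unfolding dirichlet_term_norm[OF False] using Re[OF w] norm_form_ge_1[OF False]
        by (intro powr_mono) auto
    qed (simp add: theta_term_0[OF d])
  qed
qed

lemma theta_term_div_norm_form:
  assumes "d > 0"
  shows "theta_term d p / of_int (norm_form p) ^ (2 * d) = (-1) powi (snd p * int d) * (1 / lattice_point 1 p ^ (2 * d))"
proof (cases "p = (0, 0)")
  case False
  define a where "a = of_int (fst p) - \<i> * of_int (snd p)"
  have "a * lattice_point 1 p = of_int (norm_form p)"
    by (simp add: a_def lattice_point_def norm_form_def power2_eq_square algebra_simps)
  then have e: "of_int (norm_form p) ^ (2 * d) = a ^ (2 * d) * lattice_point 1 p ^ (2 * d)"
    by (metis power_mult_distrib)
  have "complex_of_int (norm_form p) \<noteq> 0" using False norm_form_eq_0_iff by simp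
  then have "a \<noteq> 0" using e assms by (auto simp: power_0_left)
  then show ?thesis unfolding theta_term_def a_def[symmetric] e by simp
qed (use assms in \<open>simp add: theta_term_0 lattice_point_def\<close>)

text \<open>The point \<open>2 * d\<close> lies in the half-plane \<open>Re w > d + 1\<close> of
  absolute convergence exactly when \<open>d \<ge> 2\<close>, so the L-value is the value of the
  series itself.\<close>

lemma L_function_eisenstein:
  assumes d: "d \<ge> 2" and k: "k = 2 * d + 1"
  shows "L_function (theta_f k) (of_nat k - 1) =
    1 / 4 * (\<Sum>\<^sub>\<infinity>p\<in>UNIV - {(0, 0)}. (-1) powi (snd p * int d) * (1 / lattice_point 1 p ^ (2 * d)))"
proof -
  define F where "F = (\<lambda>w. 1 / 4 * (\<Sum>\<^sub>\<infinity>p. theta_term d p / of_int (norm_form p) powr w))"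
  have d0: "d > 0" using d by simp
  have s: "of_nat k - 1 = (of_nat (2 * d) :: complex)" using k by simp
  have "is_L_continuation (theta_f k) (real d + 1) F"
    unfolding is_L_continuation_def F_def
    using dirichlet_holomorphic[OF d0] dirichlet_sums[OF d0 k] by blast
  moreover have "real d + 1 < Re (of_nat k - 1)" unfolding s using d by simp
  ultimately have 1: "L_function (theta_f k) (of_nat k - 1) = F (of_nat (2 * d))"
    unfolding s by (intro L_function_eqI[of _ "real d + 1"]) auto
  have "(\<Sum>\<^sub>\<infinity>p. theta_term d p / of_int (norm_form p) powr of_nat (2 * d)) =
     (\<Sum>\<^sub>\<infinity>p\<in>UNIV - {(0, 0)}. (-1) powi (snd p * int d) * (1 / lattice_point 1 p ^ (2 * d)))"
  proof (rule infsum_cong_neutral)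
    fix p :: "int \<times> int" assume "p \<in> UNIV \<inter> (UNIV - {(0, 0)})"
    then have "complex_of_int (norm_form p) \<noteq> 0" using norm_form_eq_0_iff by simp
    then have "of_int (norm_form p) powr of_nat (2 * d) = complex_of_int (norm_form p) ^ (2 * d)"
      by (intro powr_nat') simp
    then show "theta_term d p / of_int (norm_form p) powr of_nat (2 * d) = (-1) powi (snd p * int d) * (1 / lattice_point 1 p ^ (2 * d))"
      using theta_term_div_norm_form[OF d0, of p] by simp
  qed (auto simp: theta_term_0[OF d0])
  then have "F (of_nat (2 * d)) = 1 / 4 * (\<Sum>\<^sub>\<infinity>p\<in>UNIV - {(0, 0)}. (-1) powi (snd p * int d) * (1 / lattice_point 1 p ^ (2 * d)))"
    by (simp only: F_def)
  with 1 show ?thesis by (rule trans)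
qed

section \<open>Weight 3: continuation by pairing rows\<close>

definition dirichlet_pair :: "complex \<Rightarrow> int \<times> int \<Rightarrow> complex" where
  "dirichlet_pair w p = theta_term 1 (fst p, 2 * snd p) / of_int (norm_form (fst p, 2 * snd p)) powr w +
     theta_term 1 (fst p, 2 * snd p + 1) / of_int (norm_form (fst p, 2 * snd p + 1)) powr w"

text \<open>For \<open>d = 1\<close> the rows \<open>2 * j\<close> and \<open>2 * j + 1\<close>
  carry opposite signs, so a pair is a difference of values of \<open>\<phi>\<close> at distance 1.
  Differentiating \<open>\<phi>\<close> gains a factor of order \<open>\<rho> powr (- 1/2)\<close>,
  which makes the pairs summable for \<open>Re w > 3/2\<close> instead of
  \<open>Re w > 2\<close>.\<close>

lemma dirichlet_pair_bound:
  assumes p: "p \<noteq> (0, 0)" and w: "Re w \<ge> 1/2"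
  shows "norm (dirichlet_pair w p) \<le> 2 * (1 + norm w) * real_of_int (norm_form p) powr (1/2 - Re w)"
proof -
  obtain n j where pnj: "p = (n, j)" by force
  define N where "N = real_of_int (norm_form p)"
  have N: "N \<ge> 1" "N = (real_of_int n)\<^sup>2 + (real_of_int j)\<^sup>2"
    using norm_form_ge_1[OF p] by (simp_all only: N_def of_int_1_le_iff) (simp add: pnj norm_form_def)
  define \<phi> where "\<phi> = (\<lambda>\<zeta>. (of_int n - \<i> * \<zeta>)\<^sup>2 * ((of_int n)\<^sup>2 + \<zeta>\<^sup>2) powr (- w))"
  define \<phi>' where "\<phi>' = (\<lambda>\<zeta>. - 2 * \<i> * (of_int n - \<i> * \<zeta>) * ((of_int n)\<^sup>2 + \<zeta>\<^sup>2) powr (- w)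
      + (of_int n - \<i> * \<zeta>)\<^sup>2 * (- w * ((of_int n)\<^sup>2 + \<zeta>\<^sup>2) powr (- w - 1) * (2 * \<zeta>)))"
  define a where "a = complex_of_real (of_int (2 * j))"
  define b where "b = complex_of_real (of_int (2 * j + 1))"
  define B where "B = 2 * (1 + norm w) * N powr (1/2 - Re w)"
  have pair: "dirichlet_pair w p = \<phi> a - \<phi> b"
  proof -
    have "(-1) powi (2 * j) = (1 :: complex)" "(-1) powi (2 * j + 1) = (- 1 :: complex)"
      by (simp_all add: power_int_minus_left_even power_int_minus_left_odd)
    then show ?thesis
      by (simp add: dirichlet_pair_def theta_term_def norm_form_def pnj \<phi>_def a_def b_def powr_minus divide_inverse)
  qed
  have seg: "\<exists>x. \<zeta> = of_real x \<and> of_int (2 * j) \<le> x \<and> x \<le> of_int (2 * j) + 1" if \<zeta>: "\<zeta> \<in> closed_segment a b" for \<zeta>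
  proof -
    from \<zeta> obtain u where u: "0 \<le> u" "u \<le> 1" "\<zeta> = (1 - u) *\<^sub>R a + u *\<^sub>R b"
      unfolding in_segment by blast
    define A where "A = real_of_int (2 * j)"
    have "a = of_real A" "b = of_real (A + 1)" by (simp_all add: a_def b_def A_def)
    then have "\<zeta> = of_real ((1 - u) * A + u * (A + 1))"
      using u(3) by (simp only: scaleR_conv_of_real of_real_mult of_real_add)
    also have "(1 - u) * A + u * (A + 1) = A + u" by (simp add: algebra_simps)
    finally have "\<zeta> = of_real (A + u)" .
    moreover have "A \<le> A + u" "A + u \<le> A + 1" using u(1,2) by simp_all
    ultimately show ?thesis unfolding A_def by blast
  qed
  have key: "(\<phi> has_field_derivative \<phi>' \<zeta>) (at \<zeta> within closed_segment a b) \<and> norm (\<phi>' \<zeta>) \<le> B"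
    if \<zeta>: "\<zeta> \<in> closed_segment a b" for \<zeta>
  proof -
    obtain x where x: "\<zeta> = of_real x" "of_int (2 * j) \<le> x" "x \<le> of_int (2 * j) + 1" using seg[OF \<zeta>] by blast
    define \<rho> where "\<rho> = (real_of_int n)\<^sup>2 + x\<^sup>2"
    \<comment> \<open>Between \<open>2 * j\<close> and \<open>2 * j + 1\<close> the absolute value
      never falls below \<open>\<bar>j\<bar>\<close>: for \<open>j \<ge> 0\<close> since
      \<open>2 * j \<ge> j\<close>, for \<open>j \<le> - 1\<close> since
      \<open>2 * j + 1 \<le> j\<close>. So the bound can be stated in terms of
      \<open>norm_form p\<close>.\<close>
    have "(real_of_int j)\<^sup>2 \<le> x\<^sup>2"
    proof (cases "j \<ge> 0")
      case True
      then have "0 \<le> real_of_int j" "real_of_int j \<le> x" using x by auto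
      then show ?thesis by (intro power_mono)
    next
      case False
      then have "real_of_int j \<le> - 1" by linarith
      then have "0 \<le> - real_of_int j" "- real_of_int j \<le> - x" using x by auto
      then have "(- real_of_int j)\<^sup>2 \<le> (- x)\<^sup>2" by (intro power_mono)
      then show ?thesis by simp
    qed
    then have \<rho>N: "N \<le> \<rho>" by (simp add: N \<rho>_def)
    then have \<rho>: "\<rho> > 0" using N by simp
    have \<rho>c: "(of_int n)\<^sup>2 + \<zeta>\<^sup>2 = complex_of_real \<rho>" by (simp add: x(1) \<rho>_def)
    have nR: "complex_of_real \<rho> \<notin> \<real>\<^sub>\<le>\<^sub>0" using \<rho> by (simp add: complex_nonpos_Reals_iff)
    have "((\<lambda>\<zeta>. (of_int n)\<^sup>2 + \<zeta>\<^sup>2) has_field_derivative 2 * \<zeta>) (at \<zeta>)"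
      by (auto intro!: derivative_eq_intros)
    from DERIV_chain2[OF has_field_derivative_powr this, of "- w"] nR
    have d1: "((\<lambda>\<zeta>. ((of_int n)\<^sup>2 + \<zeta>\<^sup>2) powr (- w)) has_field_derivative
        - w * ((of_int n)\<^sup>2 + \<zeta>\<^sup>2) powr (- w - 1) * (2 * \<zeta>)) (at \<zeta>)"
      unfolding \<rho>c by simp
    have "((\<lambda>\<zeta>. (of_int n - \<i> * \<zeta>)\<^sup>2) has_field_derivative - 2 * \<i> * (of_int n - \<i> * \<zeta>)) (at \<zeta>)"
      by (auto intro!: derivative_eq_intros simp: algebra_simps)
    from DERIV_mult[OF this d1]
    have "(\<phi> has_field_derivative \<phi>' \<zeta>) (at \<zeta>)"
      unfolding \<phi>_def \<phi>'_def by (simp add: mult_ac add_ac)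
    then have 1: "(\<phi> has_field_derivative \<phi>' \<zeta>) (at \<zeta> within closed_segment a b)"
      by (rule has_field_derivative_at_within)
    have na: "norm (of_int n - \<i> * \<zeta>) = sqrt \<rho>"
      by (simp add: cmod_def x(1) \<rho>_def)
    have np: "norm (complex_of_real \<rho> powr s) = \<rho> powr Re s" for s
      using \<rho> by (simp add: norm_powr_real_powr)
    have xr: "norm \<zeta> \<le> sqrt \<rho>" by (simp add: x(1) \<rho>_def real_le_rsqrt)
    have "norm (\<phi>' \<zeta>) \<le> norm (- 2 * \<i> * (of_int n - \<i> * \<zeta>) * complex_of_real \<rho> powr (- w))
       + norm ((of_int n - \<i> * \<zeta>)\<^sup>2 * (- w * complex_of_real \<rho> powr (- w - 1) * (2 * \<zeta>)))"
      unfolding \<phi>'_def \<rho>c by (rule norm_triangle_ineq)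
    also have "norm (- 2 * \<i> * (of_int n - \<i> * \<zeta>) * complex_of_real \<rho> powr (- w)) = 2 * (sqrt \<rho> * \<rho> powr (- Re w))"
      by (simp add: norm_mult na np)
    also have "norm ((of_int n - \<i> * \<zeta>)\<^sup>2 * (- w * complex_of_real \<rho> powr (- w - 1) * (2 * \<zeta>)))
        = 2 * norm w * ((sqrt \<rho>)\<^sup>2 * \<rho> powr (- Re w - 1)) * norm \<zeta>"
      by (simp add: norm_mult norm_power na np mult_ac)
    also have "(sqrt \<rho>)\<^sup>2 * \<rho> powr (- Re w - 1) = \<rho> powr (- Re w)"
    proof -
      have "\<rho> powr (- Re w - 1) = \<rho> powr (- Re w) / \<rho> powr 1" by (rule powr_diff)
      then show ?thesis using \<rho> by simp
    qed
    also have "2 * (sqrt \<rho> * \<rho> powr (- Re w)) + 2 * norm w * \<rho> powr (- Re w) * norm \<zeta>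
        \<le> 2 * (sqrt \<rho> * \<rho> powr (- Re w)) + 2 * norm w * \<rho> powr (- Re w) * sqrt \<rho>"
      using xr by (intro add_left_mono mult_left_mono) auto
    also have "\<dots> = 2 * (1 + norm w) * (sqrt \<rho> * \<rho> powr (- Re w))" by (simp add: algebra_simps)
    also have "sqrt \<rho> * \<rho> powr (- Re w) = \<rho> powr (1/2 - Re w)"
    proof -
      have "sqrt \<rho> = \<rho> powr (1/2)" using \<rho> by (simp add: powr_half_sqrt)
      then have "sqrt \<rho> * \<rho> powr (- Re w) = \<rho> powr (1/2) * \<rho> powr (- Re w)" by (rule arg_cong)
      also have "\<dots> = \<rho> powr (1/2 - Re w)" by (simp only: powr_add[symmetric]) simp
      finally show ?thesis .
    qed
    also have "2 * (1 + norm w) * \<rho> powr (1/2 - Re w) \<le> B"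
      unfolding B_def using w \<rho>N N by (intro mult_left_mono powr_mono2') auto
    finally show ?thesis using 1 by blast
  qed
  have "norm (\<phi> a - \<phi> b) \<le> B * norm (a - b)"
    by (rule field_differentiable_bound[of "closed_segment a b" \<phi> \<phi>']) (use key in auto)
  moreover have "norm (a - b) = 1" by (simp add: a_def b_def)
  ultimately show ?thesis by (simp add: pair B_def N_def)
qed

text \<open>At the origin the general bound would read 0, by \<open>0 powr x = 0\<close>, but the
  pair still contains the point (0, 1). Hence the separate summand in the majorant that
  follows.\<close>

lemma dirichlet_pair_0: "norm (dirichlet_pair w (0, 0)) = 1"
  by (simp add: dirichlet_pair_def theta_term_0 norm_form_def) (simp add: theta_term_def norm_mult)

lemma dirichlet_pair_holomorphic:
  "(\<lambda>w. 1 / 4 * (\<Sum>\<^sub>\<infinity>p. dirichlet_pair w p)) holomorphic_on {w. Re w > 3/2}"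
proof (rule holomorphic_on_mult[OF holomorphic_on_const], rule holomorphic_on_infsum)
  show "open {w. Re w > 3/2}" by (rule open_halfspace_Re_gt)
  have T: "(\<lambda>w. theta_term 1 p / of_int (norm_form p) powr w) holomorphic_on S" for p S
    using norm_form_eq_0_iff[of p] by (cases "p = (0, 0)") (auto intro!: holomorphic_intros simp: theta_term_0)
  show "(\<lambda>w. dirichlet_pair w p) holomorphic_on {w. Re w > 3/2}" for p
    unfolding dirichlet_pair_def by (intro holomorphic_on_add T)
next
  fix z assume z: "z \<in> {w. Re w > 3/2}"
  define r where "r = (Re z - 3/2) / 2"
  have r: "r > 0" using z by (simp add: r_def)
  have Re: "Re w \<ge> 3/2 + r" "norm w \<le> norm z + r" if "w \<in> cball z r" for w
  proof -
    have "Re (z - w) \<le> norm (z - w)" by (rule complex_Re_le_cmod)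
    also have "\<dots> \<le> r" using that by (simp add: dist_norm)
    finally have "Re z - Re w \<le> r" by simp
    moreover have "2 * r = Re z - 3/2" by (simp add: r_def)
    ultimately show "Re w \<ge> 3/2 + r" by linarith
    show "norm w \<le> norm z + r"
      using that norm_triangle_ineq2[of w z] by (simp add: dist_norm norm_minus_commute)
  qed
  define C where "C = 2 * (1 + (norm z + r))"
  define M where "M = (\<lambda>p. (if p = (0, 0) then 1 else 0) + C * real_of_int (norm_form p) powr (- (1 + r)))"
  show "\<exists>r>0. \<exists>M. cball z r \<subseteq> {w. Re w > 3/2} \<and> M summable_on UNIV \<and>
      (\<forall>p\<in>UNIV. \<forall>w\<in>cball z r. norm (dirichlet_pair w p) \<le> M p)"
  proof (intro exI[of _ r] exI[of _ M] conjI ballI r)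
    show "cball z r \<subseteq> {w. Re w > 3/2}" using Re(1) r by force
    have "(\<lambda>p::int \<times> int. if p = (0, 0) then 1 else 0 :: real) summable_on UNIV"
      by (rule finite_nonzero_values_imp_summable_on) (rule finite_subset[of _ "{(0, 0)}"], auto)
    then show "M summable_on UNIV" unfolding M_def
      using r by (intro summable_on_add summable_on_cmult_right summable_norm_form) simp_all
    fix p w assume w: "w \<in> cball z r"
    show "norm (dirichlet_pair w p) \<le> M p"
    proof (cases "p = (0, 0)")
      case True
      then show ?thesis using r by (simp add: M_def dirichlet_pair_0 C_def)
    next
      case False
      have "norm (dirichlet_pair w p) \<le> 2 * (1 + norm w) * real_of_int (norm_form p) powr (1/2 - Re w)"
        using Re(1)[OF w] r by (intro dirichlet_pair_bound False) auto
      also have "\<dots> \<le> C * real_of_int (norm_form p) powr (- (1 + r))"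
      proof (rule mult_mono)
        show "2 * (1 + norm w) \<le> C" unfolding C_def using Re(2)[OF w] by simp
        show "0 \<le> C" unfolding C_def using r by (simp add: add_nonneg_nonneg)
        show "real_of_int (norm_form p) powr (1/2 - Re w) \<le> real_of_int (norm_form p) powr (- (1 + r))"
          using Re(1)[OF w] norm_form_ge_1[OF False] by (intro powr_mono) auto
      qed simp
      finally show ?thesis using False by (simp add: M_def)
    qed
  qed
qed

lemma even_odd_rows:
  defines "A \<equiv> (\<lambda>p::int \<times> int. (fst p, 2 * snd p))" and "B \<equiv> (\<lambda>p::int \<times> int. (fst p, 2 * snd p + 1))"
  shows "range A = {p. even (snd p)}" "range B = {p. odd (snd p)}" "inj A" "inj B"
proof -
  show "range A = {p. even (snd p)}"
  proof (intro equalityI subsetI)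
    fix p :: "int \<times> int" assume "p \<in> {p. even (snd p)}"
    then obtain k where "snd p = 2 * k" by (auto elim!: evenE)
    then show "p \<in> range A" by (intro image_eqI[of _ _ "(fst p, k)"]) (auto simp: A_def prod_eq_iff)
  qed (auto simp: A_def)
  show "range B = {p. odd (snd p)}"
  proof (intro equalityI subsetI)
    fix p :: "int \<times> int" assume "p \<in> {p. odd (snd p)}"
    then obtain k where "snd p = 2 * k + 1" by (auto elim!: oddE)
    then show "p \<in> range B" by (intro image_eqI[of _ _ "(fst p, k)"]) (auto simp: B_def prod_eq_iff)
  qed (auto simp: B_def)
  show "inj A" "inj B" by (auto simp: inj_on_def A_def B_def prod_eq_iff)
qed

text \<open>Absolute convergence permits the split into even and odd rows; the paired sum thus
  extends the original series to the larger half-plane.\<close>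

lemma infsum_dirichlet_pair:
  assumes w: "Re w > 2"
  shows "(\<Sum>\<^sub>\<infinity>p. dirichlet_pair w p) = (\<Sum>\<^sub>\<infinity>p. theta_term 1 p / of_int (norm_form p) powr w)"
proof -
  define T where "T = (\<lambda>p. theta_term 1 p / of_int (norm_form p) powr w)"
  define A where "A = (\<lambda>p::int \<times> int. (fst p, 2 * snd p))"
  define B where "B = (\<lambda>p::int \<times> int. (fst p, 2 * snd p + 1))"
  note AB = even_odd_rows[folded A_def B_def]
  have T: "T summable_on X" for X
  proof -
    have "T summable_on UNIV"
      unfolding T_def by (rule abs_summable_summable, rule dirichlet_abs_summable) (use w in auto)
    then show ?thesis by (rule summable_on_subset_banach) simp
  qed
  have a: "((\<lambda>p. T (A p)) has_sum infsum T (range A)) UNIV"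
    using has_sum_infsum[OF T, of "range A"] AB(3) by (simp add: has_sum_reindex o_def)
  have b: "((\<lambda>p. T (B p)) has_sum infsum T (range B)) UNIV"
    using has_sum_infsum[OF T, of "range B"] AB(4) by (simp add: has_sum_reindex o_def)
  have "infsum T UNIV = infsum T (range A \<union> range B)" unfolding AB by (rule arg_cong) auto
  also have "\<dots> = infsum T (range A) + infsum T (range B)"
    by (rule infsum_Un_disjoint[OF T T]) (auto simp: AB)
  also have "\<dots> = (\<Sum>\<^sub>\<infinity>p. T (A p) + T (B p))" using infsumI[OF has_sum_add[OF a b]] by simp
  also have "(\<lambda>p. T (A p) + T (B p)) = dirichlet_pair w"
    by (simp add: fun_eq_iff dirichlet_pair_def T_def A_def B_def)
  finally show ?thesis by (simp add: T_def)
qed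

lemma bij_lattice_point_wide: "bij_betw (lattice_point 2) UNIV wide_lattice"
  using inj_lattice_point[of 2] by (simp add: bij_betw_def wide_lattice_def rect_lattice_def)

text \<open>At \<open>w = 2\<close> a pair becomes
  \<open>1 / \<mu>\<^sup>2 - 1 / (\<mu> + \<i>)\<^sup>2\<close> with \<open>\<mu>\<close> in the
  wide lattice, the negative of a term of \<open>L2.wp (- \<i>)\<close>. The pairing thus supplies
  the very constants that make the Weierstrass series converge.\<close>

lemma L_function_weight_3: "L_function (theta_f 3) 2 = of_real (lemniscate\<^sup>2 / 8)"
proof -
  define F where "F = (\<lambda>w. 1 / 4 * (\<Sum>\<^sub>\<infinity>p. dirichlet_pair w p))"
  have "is_L_continuation (theta_f 3) (3/2) F"
    unfolding is_L_continuation_def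
  proof (intro conjI exI[of _ 2] allI impI)
    show "F holomorphic_on {w. 3/2 < Re w}" unfolding F_def by (rule dirichlet_pair_holomorphic)
    fix w :: complex assume w: "2 < Re w"
    have "(\<lambda>n. q_coeff (theta_f 3) (Suc n) / of_nat (Suc n) powr w) sums
        (1 / 4 * (\<Sum>\<^sub>\<infinity>p. theta_term 1 p / of_int (norm_form p) powr w))"
      by (rule dirichlet_sums) (use w in simp_all)
    then show "(\<lambda>n. q_coeff (theta_f 3) (Suc n) / of_nat (Suc n) powr w) sums F w"
      unfolding F_def infsum_dirichlet_pair[OF w] .
  qed
  then have "L_function (theta_f 3) 2 = F 2" by (rule L_function_eqI) simp
  also have "(\<Sum>\<^sub>\<infinity>p. dirichlet_pair 2 p) = - L2.wp \<i>"
  proof -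
    have term2: "theta_term 1 p / of_int (norm_form p) powr 2 = (-1) powi (snd p) * (1 / (lattice_point 1 p)\<^sup>2)" for p
    proof (cases "p = (0, 0)")
      case True
      then show ?thesis by (simp add: theta_term_0 lattice_point_def)
    next
      case False
      then have "complex_of_int (norm_form p) \<noteq> 0" using norm_form_eq_0_iff by simp
      then have "complex_of_int (norm_form p) powr of_nat 2 = of_int (norm_form p) ^ 2" by (intro powr_nat') simp
      then show ?thesis using theta_term_div_norm_form[of 1 p] by simp
    qed
    have "dirichlet_pair 2 p = - (1 / (- \<i> - lattice_point 2 p)\<^sup>2 - 1 / (lattice_point 2 p)\<^sup>2)" for p
    proof -
      have "lattice_point 1 (fst p, 2 * snd p) = lattice_point 2 p"
        "lattice_point 1 (fst p, 2 * snd p + 1) = - (- \<i> - lattice_point 2 p)"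
        by (simp_all add: complex_eq_iff)
      moreover have "(-1) powi (2 * snd p) = (1 :: complex)" "(-1) powi (2 * snd p + 1) = (- 1 :: complex)"
        by (simp_all add: power_int_minus_left_even power_int_minus_left_odd)
      ultimately show ?thesis by (simp only: dirichlet_pair_def term2 snd_conv power2_minus) simp
    qed
    moreover have "((\<lambda>p. - (1 / (- \<i> - lattice_point 2 p)\<^sup>2 - 1 / (lattice_point 2 p)\<^sup>2)) has_sum (- L2.wp (- \<i>))) UNIV"
    proof -
      define f where "f = (\<lambda>\<mu>. 1 / (- \<i> - \<mu>)\<^sup>2 - 1 / \<mu>\<^sup>2 :: complex)"
      have "(f has_sum L2.wp (- \<i>)) (lattice_point 2 ` UNIV)"
        using L2.wp_has_sum[OF ii_notin_wide(2)] bij_lattice_point_wide by (simp add: f_def bij_betw_def)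
      then have "((\<lambda>p. f (lattice_point 2 p)) has_sum L2.wp (- \<i>)) UNIV"
        using inj_lattice_point[of 2] by (simp add: has_sum_reindex o_def)
      then have "((\<lambda>p. - f (lattice_point 2 p)) has_sum (- L2.wp (- \<i>))) UNIV"
        unfolding has_sum_uminus minus_minus .
      then show ?thesis by (simp only: f_def)
    qed
    ultimately show ?thesis by (simp add: infsumI L2.wp_uminus)
  qed
  then have "F 2 = 1 / 4 * - L2.wp \<i>" by (simp only: F_def)
  finally show ?thesis by (simp add: wp_ii)
qed

section \<open>Higher weights: L-values as Eisenstein series\<close>

lemma infsum_lattice_point_eisenstein:
  "(\<Sum>\<^sub>\<infinity>p\<in>UNIV - {(0, 0)}. 1 / lattice_point 1 p ^ k) = L1.eisenstein k"
  "(\<Sum>\<^sub>\<infinity>p\<in>UNIV - {(0, 0)}. 1 / lattice_point 2 p ^ k) = L2.eisenstein k"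
proof -
  show "(\<Sum>\<^sub>\<infinity>p\<in>UNIV - {(0, 0)}. 1 / lattice_point 1 p ^ k) = L1.eisenstein k"
    unfolding L1.eisenstein_def unfolding square_lattice_def
    by (rule infsum_reindex_bij_betw[OF bij_lattice_point]) simp
  show "(\<Sum>\<^sub>\<infinity>p\<in>UNIV - {(0, 0)}. 1 / lattice_point 2 p ^ k) = L2.eisenstein k"
    unfolding L2.eisenstein_def unfolding wide_lattice_def
    by (rule infsum_reindex_bij_betw[OF bij_lattice_point]) simp
qed

lemma L_function_even:
  assumes d: "d \<ge> 2" "even d" and k: "k = 2 * d + 1"
  shows "L_function (theta_f k) (of_nat k - 1) = L1.eisenstein (2 * d) / 4"
proof -
  have "(-1) powi (m * int d) = (1 :: complex)" for m
    using d(2) by (simp add: power_int_minus_left_even)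
  then show ?thesis unfolding L_function_eisenstein[OF d(1) k] infsum_lattice_point_eisenstein(1)[symmetric] by simp
qed

lemma L_function_odd:
  assumes d: "d \<ge> 2" "odd d" and k: "k = 2 * d + 1"
  shows "L_function (theta_f k) (of_nat k - 1) = L2.eisenstein (2 * d) / 2"
proof -
  define f where "f = (\<lambda>p. 1 / lattice_point 1 p ^ (2 * d))"
  define E where "E = {p::int \<times> int. even (snd p)} - {(0, 0)}"
  define U where "U = {p::int \<times> int. odd (snd p)}"
  have un: "UNIV - {(0, 0)} = E \<union> U" "E \<inter> U = {}" by (auto simp: E_def U_def)
  have "(\<lambda>\<omega>. 1 / \<omega> ^ (2 * d)) summable_on (rect_lattice 1 - {0})"
    using L1.eisenstein_summable[of "2 * d"] d by (simp add: square_lattice_def)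
  then have "f summable_on (UNIV - {(0, 0)})"
    unfolding f_def by (subst summable_on_reindex_bij_betw[OF bij_lattice_point]) simp_all
  then have f: "f summable_on E" "f summable_on U"
    unfolding un(1) by (auto intro: summable_on_subset_banach)
  have "infsum f E + infsum f U = infsum f (UNIV - {(0, 0)})"
    unfolding un(1) by (rule infsum_Un_disjoint[OF f un(2), symmetric])
  also have "\<dots> = L1.eisenstein (2 * d)" unfolding f_def by (rule infsum_lattice_point_eisenstein)
  also have "\<dots> = 0"
  proof (rule L1.eisenstein_mult_ii[OF ii_L1])
    obtain m where "d = 2 * m + 1" using d(2) by (auto elim!: oddE)
    then show "2 * d mod 4 = 2" by presburger
  qed
  \<comment> \<open>The odd rows give the negative of the even rows; under the alternating sign the
    two reinforce each other, whence the factor 2.\<close>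
  finally have 0: "infsum f U = - infsum f E" by (simp add: eq_neg_iff_add_eq_0 add.commute)
  define g where "g = (\<lambda>p. (-1) powi (snd p * int d) * f p)"
  have gE: "(g has_sum infsum f E) E"
  proof -
    have "(g has_sum infsum f E) E \<longleftrightarrow> (f has_sum infsum f E) E"
      by (rule has_sum_cong) (simp add: g_def E_def power_int_minus_left_even)
    then show ?thesis using has_sum_infsum[OF f(1)] by blast
  qed
  have gU: "(g has_sum - infsum f U) U"
  proof -
    have "(g has_sum - infsum f U) U \<longleftrightarrow> ((\<lambda>p. - f p) has_sum - infsum f U) U"
      by (rule has_sum_cong) (use d in \<open>simp add: g_def U_def power_int_minus_left_odd\<close>)
    then show ?thesis unfolding has_sum_uminus using has_sum_infsum[OF f(2)] by simp
  qed
  have "infsum g (UNIV - {(0, 0)}) = infsum f E + - infsum f U"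
    unfolding un(1) by (rule infsumI[OF has_sum_Un_disjoint[OF gE gU un(2)]])
  also have "\<dots> = 2 * infsum f E" by (simp add: 0)
  also have "infsum f E = L2.eisenstein (2 * d)"
  proof -
    define A where "A = (\<lambda>p::int \<times> int. (fst p, 2 * snd p))"
    have inj: "inj A" "range A = {p. even (snd p)}" using even_odd_rows unfolding A_def by blast+
    have "E = A ` (UNIV - {(0, 0)})"
      using inj(2) unfolding E_def image_set_diff[OF inj(1)] by (simp add: A_def)
    then have "infsum f E = infsum (f \<circ> A) (UNIV - {(0, 0)})"
      using infsum_reindex[of A "UNIV - {(0, 0)}" f] inj(1) by (simp add: inj_on_subset)
    also have "f \<circ> A = (\<lambda>p. 1 / lattice_point 2 p ^ (2 * d))"
      by (simp add: fun_eq_iff f_def A_def lattice_point_def mult_ac)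
    finally show ?thesis by (simp only: infsum_lattice_point_eisenstein)
  qed
  finally have "infsum g (UNIV - {(0, 0)}) = 2 * L2.eisenstein (2 * d)" .
  then show ?thesis unfolding L_function_eisenstein[OF d(1) k] g_def f_def by simp
qed

subsection \<open>Dixon's sum\<close>

text \<open>Summand of the well-poised series 3F2(a, 1/2, 1/2; a + 1/2, a + 1/2; 1). The sum is
  wanted at \<open>a = 1/2\<close>; the parameter is freed to make a recursion possible.\<close>

definition dixon_term :: "real \<Rightarrow> nat \<Rightarrow> real" where
  "dixon_term a j = pochhammer a j * (pochhammer (1/2) j)\<^sup>2 / ((pochhammer (a + 1/2) j)\<^sup>2 * fact j)"

lemma dixon_term_0 [simp]: "dixon_term a 0 = 1"
  by (simp add: dixon_term_def)

lemma dixon_term_Suc: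
  assumes "a > 0"
  shows "dixon_term a (Suc j) = dixon_term a j * ((a + j) * (1/2 + j)\<^sup>2 / ((a + 1/2 + j)\<^sup>2 * (j + 1)))"
  unfolding dixon_term_def pochhammer_Suc power_mult_distrib fact_Suc
  by (simp add: mult_ac add_ac)

lemma dixon_term_nonneg: "a > 0 \<Longrightarrow> dixon_term a j \<ge> 0"
  by (induction j) (auto simp: dixon_term_Suc)

text \<open>Gives a majorant uniform in \<open>a\<close>. The ratio of consecutive terms depends on
  \<open>a\<close> through \<open>q / (q + 1/2)\<^sup>2\<close> with \<open>q = a + j\<close>, which
  decreases for \<open>q \<ge> 1/2\<close>: the difference of the cross products is
  \<open>(q - p) * (p * q - 1/4)\<close>.\<close>

lemma dixon_term_half_le:
  assumes "a \<ge> 1/2"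
  shows "dixon_term a j \<le> dixon_term (1/2) j"
proof (induction j)
  case (Suc j)
  have 1: "(a + real j) / (a + 1/2 + real j)\<^sup>2 \<le> (1/2 + real j) / (1/2 + 1/2 + real j)\<^sup>2"
  proof -
    define p where "p = 1/2 + real j"
    define q where "q = a + real j"
    have pq: "p \<ge> 1/2" "q \<ge> p" using assms by (auto simp: p_def q_def)
    have "p * (q + 1/2)\<^sup>2 - q * (p + 1/2)\<^sup>2 = (q - p) * (p * q - 1/4)"
      by (simp add: power2_eq_square field_simps)
    moreover have "p * q \<ge> (1/2) * (1/2)"
      using pq by (intro mult_mono) auto
    then have "(q - p) * (p * q - 1/4) \<ge> 0" using pq by (intro mult_nonneg_nonneg) auto
    ultimately have "q * (p + 1/2)\<^sup>2 \<le> p * (q + 1/2)\<^sup>2" by linarith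
    then have "q / (q + 1/2)\<^sup>2 \<le> p / (p + 1/2)\<^sup>2" using pq by (simp add: divide_simps)
    then show ?thesis by (simp add: p_def q_def add_ac)
  qed
  have "dixon_term a (Suc j) = dixon_term a j * ((a + j) / (a + 1/2 + j)\<^sup>2 * ((1/2 + j)\<^sup>2 / (j + 1)))"
    using assms by (simp add: dixon_term_Suc)
  also have "\<dots> \<le> dixon_term (1/2) j * ((1/2 + j) / (1/2 + 1/2 + j)\<^sup>2 * ((1/2 + j)\<^sup>2 / (j + 1)))"
    using assms 1 by (intro mult_mono Suc.IH dixon_term_nonneg mult_nonneg_nonneg) auto
  also have "\<dots> = dixon_term (1/2) (Suc j)"
    by (simp add: dixon_term_Suc)
  finally show ?case .
qed auto

text \<open>The central binomial coefficient of \<open>2 * j\<close> over \<open>j\<close>, divided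
  by \<open>4 ^ j\<close>.\<close>

definition cbin :: "nat \<Rightarrow> real" where
  "cbin j = pochhammer (1/2) j / fact j"

lemma cbin_Suc: "cbin (Suc j) = cbin j * ((2 * j + 1) / (2 * j + 2))"
  by (simp add: cbin_def pochhammer_Suc field_simps)

lemma cbin_nonneg: "cbin j \<ge> 0"
  by (simp add: cbin_def pochhammer_nonneg)

text \<open>The induction rests on
  \<open>(2 * j + 1) * (2 * j + 3) \<le> (2 * j + 2)\<^sup>2\<close>. The resulting decay of order
  1/2 makes the cubes summable.\<close>

lemma cbin_sq_le: "(cbin j)\<^sup>2 \<le> 1 / (2 * real j + 1)"
proof (induction j)
  case (Suc j)
  have "(cbin (Suc j))\<^sup>2 = (cbin j)\<^sup>2 * ((2 * real j + 1) / (2 * real j + 2))\<^sup>2"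
    by (simp only: cbin_Suc power_mult_distrib)
  also have "\<dots> \<le> 1 / (2 * real j + 1) * ((2 * real j + 1) / (2 * real j + 2))\<^sup>2"
    by (intro mult_right_mono Suc.IH) auto
  also have "\<dots> = (2 * real j + 1) / (2 * real j + 2)\<^sup>2"
    by (simp only: power_divide) (simp add: power2_eq_square)
  also have "\<dots> \<le> 1 / (2 * real (Suc j) + 1)"
  proof -
    have "(2 * real j + 1) * (2 * real (Suc j) + 1) \<le> (2 * real j + 2)\<^sup>2"
      by (simp add: power2_eq_square algebra_simps)
    then show ?thesis by (simp add: divide_simps)
  qed
  finally show ?case .
qed (simp add: cbin_def)

lemma cbin_cube_le: "cbin j ^ 3 \<le> (2 * real j + 1) powr (-3/2)"
proof -
  have "cbin j \<le> sqrt (1 / (2 * real j + 1))"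
    by (rule real_le_rsqrt[OF cbin_sq_le])
  also have "\<dots> = (2 * real j + 1) powr (-1/2)"
    by (simp add: powr_minus powr_half_sqrt real_sqrt_divide field_simps)
  finally have "cbin j ^ 3 \<le> ((2 * real j + 1) powr (-1/2)) ^ 3"
    by (intro power_mono cbin_nonneg)
  also have "\<dots> = (2 * real j + 1) powr (-3/2)"
    by (subst powr_power) auto
  finally show ?thesis .
qed

lemma dixon_term_half: "dixon_term (1/2) j = cbin j ^ 3"
  by (simp add: dixon_term_def cbin_def pochhammer_fact power2_eq_square power3_eq_cube)

lemma summable_cbin_cube: "summable (\<lambda>j. cbin j ^ 3)"
proof (rule summable_comparison_test_ev)
  show "\<forall>\<^sub>F j in sequentially. norm (cbin j ^ 3) \<le> real j powr (-3/2)"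
    using eventually_gt_at_top[of 0]
  proof eventually_elim
    case (elim j)
    have "cbin j ^ 3 \<le> (2 * real j + 1) powr (-3/2)" by (rule cbin_cube_le)
    also have "\<dots> \<le> real j powr (-3/2)" using elim by (intro powr_mono2') auto
    finally show ?case using cbin_nonneg[of j] by simp
  qed
  show "summable (\<lambda>j. real j powr (-3/2))" by (simp add: summable_real_powr_iff)
qed

lemma summable_dixon_term: "a \<ge> 1/2 \<Longrightarrow> summable (dixon_term a)"
  by (rule summable_comparison_test'[OF summable_cbin_cube, of 0])
     (use dixon_term_half_le[of a] dixon_term_nonneg[of a] in \<open>auto simp: dixon_term_half\<close>)

text \<open>The companion of \<^const>\<open>dixon_term\<close> in a WZ pair for the shift of \<open>a\<close> by \<open>2\<close>.\<close>
definition dixon_cert :: "real \<Rightarrow> nat \<Rightarrow> real" where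
  "dixon_cert a j = dixon_term a j * j * (j\<^sup>2 + (3 * a + 1) * j + 2 * a\<^sup>2 + a - 1/4)
     / (a * (a + 1/2 + j)\<^sup>2)"

lemma pochhammer_shift2:
  fixes x :: real
  assumes "x > 0"
  shows "pochhammer (x + 2) j = pochhammer x j * ((x + j) * (x + j + 1) / (x * (x + 1)))"
proof -
  have "x * (x + 1) * pochhammer (x + 2) j = pochhammer x (Suc (Suc j))"
    by (simp add: pochhammer_rec add_ac)
  also have "\<dots> = pochhammer x j * ((x + j) * (x + j + 1))"
    by (simp add: pochhammer_Suc add_ac)
  finally have "pochhammer (x + 2) j = pochhammer x j * ((x + j) * (x + j + 1)) / (x * (x + 1))"
    using assms by (intro eq_divide_imp) (auto simp: mult.commute)
  then show ?thesis by simp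
qed

text \<open>Once \<open>dixon_term a j\<close> is factored out, every member is rational with
  denominator \<open>a * (u * v)\<^sup>2\<close>, and the claim becomes the polynomial identity
  \<open>key\<close>. The factor on the left is the quotient of Dixon's closed form at
  \<open>a\<close> by that at \<open>a + 2\<close>.\<close>

lemma dixon_wz:
  assumes a: "a > 0"
  shows "(a + 1) ^ 4 / ((a + 1/2)\<^sup>2 * (a + 3/2)\<^sup>2) * dixon_term (a + 2) j - dixon_term a j
           = dixon_cert a (Suc j) - dixon_cert a j"
proof -
  define x where "x = real j"
  have x: "x \<ge> 0" by (simp add: x_def)
  define u where "u = a + 1/2 + x"
  define v where "v = a + 3/2 + x"
  have uv: "u > 0" "v > 0" using a x by (auto simp: u_def v_def)
  define q where "q = (\<lambda>y. y\<^sup>2 + (3 * a + 1) * y + 2 * a\<^sup>2 + a - 1/4 :: real)"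
  have p2: "pochhammer (a + 2 + 1/2) j = pochhammer (a + 1/2) j * (u * v / ((a + 1/2) * (a + 3/2)))"
    using pochhammer_shift2[of "a + 1/2" j] a by (simp add: add_ac x_def u_def v_def)
  have t2: "dixon_term (a + 2) j = dixon_term a j * ((a + x) * (a + x + 1) * ((a + 1/2) * (a + 3/2))\<^sup>2 / (a * (a + 1) * (u * v)\<^sup>2))"
    unfolding dixon_term_def p2 using pochhammer_shift2[of a j] a uv
    by (simp add: power_mult_distrib power_divide field_simps x_def)
  have lhs: "(a + 1) ^ 4 / ((a + 1/2)\<^sup>2 * (a + 3/2)\<^sup>2) * dixon_term (a + 2) j 
      = dixon_term a j * ((a + 1) ^ 3 * (a + x) * (a + x + 1) / (a * (u * v)\<^sup>2))"
  proof -
    have "(a + 1) ^ 4 / (P\<^sup>2 * Q\<^sup>2) * (t * (m * (P * Q)\<^sup>2 / (a * (a + 1) * w)))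
        = t * ((a + 1) ^ 3 * m / (a * w))" if "P > 0" "Q > 0" for P Q t m w :: real
      using that a by (simp add: power_mult_distrib power4_eq_xxxx power3_eq_cube)
    from this[of "a + 1/2" "a + 3/2" "dixon_term a j" "(a + x) * (a + x + 1)" "(u * v)\<^sup>2"]
    show ?thesis unfolding t2 using a by (simp add: mult.assoc)
  qed
  have c1: "dixon_cert a j = dixon_term a j * (x * q x * v\<^sup>2 / (a * (u * v)\<^sup>2))"
    using uv a by (simp add: dixon_cert_def q_def x_def[symmetric] u_def[symmetric] power_mult_distrib)
  have c2: "dixon_cert a (Suc j) = dixon_term a j * ((a + x) * (1/2 + x)\<^sup>2 * q (x + 1) / (a * (u * v)\<^sup>2))"
  proof -
    have v: "a + 1/2 + real (Suc j) = v" by (simp add: v_def x_def)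
    have "dixon_cert a (Suc j) = dixon_term a (Suc j) * (x + 1) * q (x + 1) / (a * v\<^sup>2)"
      unfolding dixon_cert_def v q_def by (simp add: x_def add_ac)
    also have "dixon_term a (Suc j) = dixon_term a j * ((a + x) * (1/2 + x)\<^sup>2 / (u\<^sup>2 * (x + 1)))"
      using a by (simp add: dixon_term_Suc x_def u_def)
    finally show ?thesis using x uv a by (simp add: power_mult_distrib mult_ac)
  qed
  have key: "(a + 1) ^ 3 * (a + x) * (a + x + 1) - a * (u * v)\<^sup>2 
      = (a + x) * (1/2 + x)\<^sup>2 * q (x + 1) - x * q x * v\<^sup>2"
    unfolding q_def u_def v_def by algebra
  have "(a + 1) ^ 3 * (a + x) * (a + x + 1) / (a * (u * v)\<^sup>2) - 1 
      = ((a + 1) ^ 3 * (a + x) * (a + x + 1) - a * (u * v)\<^sup>2) / (a * (u * v)\<^sup>2)"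
    using a uv by (simp add: diff_divide_distrib)
  also have "\<dots> = (a + x) * (1/2 + x)\<^sup>2 * q (x + 1) / (a * (u * v)\<^sup>2) - x * q x * v\<^sup>2 / (a * (u * v)\<^sup>2)"
    unfolding key by (simp add: diff_divide_distrib)
  finally have "dixon_term a j * ((a + 1) ^ 3 * (a + x) * (a + x + 1) / (a * (u * v)\<^sup>2) - 1) =
      dixon_term a j * ((a + x) * (1/2 + x)\<^sup>2 * q (x + 1) / (a * (u * v)\<^sup>2) - x * q x * v\<^sup>2 / (a * (u * v)\<^sup>2))"
    by (rule arg_cong)
  then show ?thesis unfolding lhs c1 c2 by (simp only: right_diff_distrib mult_1_right)
qed

text \<open>The terms are at most \<open>j powr (-3/2)\<close> and the rational factor of the
  certificate is at most \<open>B * j\<close>, so a negative power of \<open>j\<close>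
  remains.\<close>

lemma dixon_cert_tendsto_0:
  assumes a: "a \<ge> 1/2"
  shows "dixon_cert a \<longlonglongrightarrow> 0"
proof (rule Lim_null_comparison)
  define B where "B = (1 + (3 * a + 1) + 2 * a\<^sup>2 + a) / a"
  show "\<forall>\<^sub>F j in sequentially. norm (dixon_cert a j) \<le> B * (real j powr (-1/2))"
    using eventually_gt_at_top[of 0]
  proof eventually_elim
    case (elim j)
    have t: "dixon_term a j \<le> real j powr (-3/2)"
    proof -
      have "dixon_term a j \<le> (2 * real j + 1) powr (-3/2)"
        using dixon_term_half_le[OF a, of j] cbin_cube_le[of j] by (simp add: dixon_term_half)
      also have "\<dots> \<le> real j powr (-3/2)" using elim by (intro powr_mono2') auto
      finally show ?thesis .
    qed
    define q where "q = (real j)\<^sup>2 + (3 * a + 1) * j + 2 * a\<^sup>2 + a - 1/4"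
    have j1: "real j \<ge> 1" using elim by simp
    have j2: "real j \<le> (real j)\<^sup>2" "1 \<le> (real j)\<^sup>2"
      using j1 power_increasing[of 1 2 "real j"] by (auto simp: one_le_power)
    have "(3 * a + 1) * real j \<ge> 0" "2 * a\<^sup>2 + a \<ge> 0" using a by auto
    with j2 have q0: "q \<ge> 0" unfolding q_def by linarith
    have "q \<le> (real j)\<^sup>2 + (3 * a + 1) * j + (2 * a\<^sup>2 + a)" by (simp add: q_def)
    also have "\<dots> \<le> (real j)\<^sup>2 + (3 * a + 1) * (real j)\<^sup>2 + (2 * a\<^sup>2 + a) * (real j)\<^sup>2"
      using a j2 mult_left_mono[of 1 "(real j)\<^sup>2" "2 * a\<^sup>2 + a"] by (intro add_mono mult_left_mono order.refl) auto
    also have "\<dots> = B * a * (real j)\<^sup>2"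
    proof -
      have "B * a = 1 + (3 * a + 1) + 2 * a\<^sup>2 + a" using a by (simp add: B_def)
      then show ?thesis by (simp add: algebra_simps)
    qed
    finally have q1: "q \<le> B * a * (real j)\<^sup>2" .
    have B0: "B \<ge> 0" using a by (auto simp: B_def)
    have "norm (dixon_cert a j) = dixon_term a j * j * (q / (a * (a + 1/2 + j)\<^sup>2))"
      unfolding dixon_cert_def q_def[symmetric] using q0 a dixon_term_nonneg[of a j] by (simp add: abs_mult)
    also have "\<dots> \<le> dixon_term a j * j * (B * a * (real j)\<^sup>2 / (a * (real j)\<^sup>2))"
      using a elim q0 q1 dixon_term_nonneg[of a j]
      by (intro mult_left_mono frac_le mult_pos_pos) (auto intro!: power_mono)
    also have "\<dots> = dixon_term a j * j * B" using a elim by simp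
    also have "\<dots> \<le> real j powr (-3/2) * j * B"
      using t B0 by (intro mult_right_mono) auto
    also have "real j powr (-3/2) * j = real j powr (-1/2)"
      using elim powr_add[of "real j" "-3/2" 1] by simp
    finally show ?case by (simp add: mult.commute)
  qed
  have "(\<lambda>j. real j powr (-1/2)) \<longlonglongrightarrow> 0"
    by (rule tendsto_neg_powr[OF _ filterlim_real_sequentially]) auto
  from tendsto_mult_right_zero[OF this, of B] show "(\<lambda>j. B * real j powr (-1/2)) \<longlonglongrightarrow> 0" .
qed

section \<open>Evaluation of Dixon's sum\<close>

definition dixon_sum :: "real \<Rightarrow> real" where
  "dixon_sum a = suminf (dixon_term a)"

text \<open>The right side of the WZ equation telescopes; its boundary terms are the limit 0 and
  \<open>dixon_cert a 0\<close>, which vanishes through the factor \<open>j\<close>.\<close>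

lemma dixon_sum_rec:
  assumes a: "a \<ge> 1/2"
  shows "(a + 1) ^ 4 / ((a + 1/2)\<^sup>2 * (a + 3/2)\<^sup>2) * dixon_sum (a + 2) = dixon_sum a"
proof -
  define c where "c = (a + 1) ^ 4 / ((a + 1/2)\<^sup>2 * (a + 3/2)\<^sup>2)"
  have "(\<lambda>j. c * dixon_term (a + 2) j - dixon_term a j) sums (c * dixon_sum (a + 2) - dixon_sum a)"
    unfolding dixon_sum_def using a by (intro sums_diff sums_mult summable_sums summable_dixon_term) auto
  moreover have "(\<lambda>j. dixon_cert a (Suc j) - dixon_cert a j) sums (0 - dixon_cert a 0)"
    by (intro telescope_sums dixon_cert_tendsto_0 a)
  moreover have "dixon_cert a 0 = 0" by (simp add: dixon_cert_def)
  moreover have "c * dixon_term (a + 2) j - dixon_term a j = dixon_cert a (Suc j) - dixon_cert a j" for j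
    unfolding c_def using a by (intro dixon_wz) auto
  ultimately have "c * dixon_sum (a + 2) - dixon_sum a = 0"
    by (metis (no_types, lifting) diff_zero ext sums_unique2)
  then show ?thesis by (simp add: c_def)
qed

text \<open>Every term of positive index tends to 0, and the terms at \<open>a = 1/2\<close>
  dominate uniformly, so Tannery's theorem leaves the initial term.\<close>

lemma dixon_sum_tendsto_1: "(\<lambda>m. dixon_sum (1/2 + 2 * real m)) \<longlonglongrightarrow> 1"
proof -
  have lim: "(\<lambda>m. dixon_term (1/2 + 2 * real m) j) \<longlonglongrightarrow> (if j = 0 then 1 else 0)" for j
  proof (induction j)
    case (Suc j)
    have "(\<lambda>m. (1/2 + 2 * real m + j) * (1/2 + j)\<^sup>2 / ((1/2 + 2 * real m + 1/2 + j)\<^sup>2 * (j + 1))) \<longlonglongrightarrow> 0"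
      by real_asymp
    from tendsto_mult[OF Suc.IH this] show ?case by (subst dixon_term_Suc) (auto simp: add_ac)
  qed auto
  have "\<forall>\<^sub>F (j, m) in at_top \<times>\<^sub>F sequentially. norm (dixon_term (1/2 + 2 * real m) j) \<le> cbin j ^ 3"
    using dixon_term_half_le dixon_term_nonneg by (intro always_eventually) (auto simp: dixon_term_half)
  from tannerys_theorem[OF lim this summable_cbin_cube sequentially_bot]
  have "(\<lambda>m. \<Sum>j. dixon_term (1/2 + 2 * real m) j) \<longlonglongrightarrow> (\<Sum>j. if j = 0 then 1 else 0)"
    by (elim conjE)
  moreover have "(\<Sum>j. if j = 0 then 1 else 0) = (1 :: real)"
    using suminf_finite[of "{0::nat}" "\<lambda>j. if j = 0 then 1 else 0 :: real"] by simp
  ultimately show ?thesis by (simp add: dixon_sum_def)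
qed

text \<open>By Euler's limit formula \<open>Gamma (y + n + 1)\<close> is asymptotic to
  \<open>fact n * n powr y\<close>. In the quotient the factorials cancel, and so do the powers,
  since \<open>x + (x + 1) = 2 * (x + 1/2)\<close>.\<close>

lemma Gamma_half_ratio_tendsto_1:
  fixes x :: real
  assumes x: "x > 0"
  shows "(\<lambda>n. Gamma (x + n) * Gamma (x + n + 1) / (Gamma (x + n + 1/2))\<^sup>2) \<longlonglongrightarrow> 1"
proof -
  have lim: "(\<lambda>n. Gamma (y + (real n + 1)) / (fact n * exp (y * ln (real n)))) \<longlonglongrightarrow> 1" if y: "y > 0" for y :: real
  proof -
    have nz: "Gamma y \<noteq> 0" using y by (simp add: Gamma_real_pos less_imp_neq[symmetric])
    have "(\<lambda>n. Gamma y / Gamma_series y n) \<longlonglongrightarrow> Gamma y / Gamma y"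
      by (intro tendsto_intros Gamma_series_LIMSEQ nz)
    moreover have "Gamma y / Gamma_series y n = Gamma (y + (real n + 1)) / (fact n * exp (y * ln (real n)))" for n
    proof -
      have "pochhammer y (n + 1) = Gamma (y + of_nat (n + 1)) / Gamma y"
        using y by (intro pochhammer_Gamma) (auto dest: nonpos_Ints_nonpos)
      then have "Gamma (y + of_nat (n + 1)) = Gamma y * pochhammer y (n + 1)" using nz by simp
      then show ?thesis by (simp add: Gamma_series_def add_ac)
    qed
    ultimately show ?thesis using nz by simp
  qed
  define A where "A = (\<lambda>y n. Gamma (y + (real n + 1)) / (fact n * exp (y * ln (real n))))"
  have "(\<lambda>n. A x n * A (x + 1) n / (A (x + 1/2) n)\<^sup>2) \<longlonglongrightarrow> 1 * 1 / 1\<^sup>2"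
    unfolding A_def using x by (intro tendsto_mult tendsto_divide tendsto_power lim) simp_all
  moreover have "A x n * A (x + 1) n / (A (x + 1/2) n)\<^sup>2 
      = Gamma (x + Suc n) * Gamma (x + Suc n + 1) / (Gamma (x + Suc n + 1/2))\<^sup>2" for n
  proof -
    have "exp (x * ln (real n)) * exp ((x + 1) * ln (real n)) = (exp ((x + 1/2) * ln (real n)))\<^sup>2"
      by (simp add: power2_eq_square flip: exp_add) (simp add: algebra_simps)
    then have "(fact n * exp (x * ln (real n))) * (fact n * exp ((x + 1) * ln (real n))) = (fact n * exp ((x + 1/2) * ln (real n)))\<^sup>2"
      by (simp add: power2_eq_square mult_ac)
    then show ?thesis unfolding A_def power_divide
      by (simp add: add_ac times_divide_times_eq)
  qed
  ultimately have "(\<lambda>n. Gamma (x + Suc n) * Gamma (x + Suc n + 1) / (Gamma (x + Suc n + 1/2))\<^sup>2) \<longlonglongrightarrow> 1"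
    by simp
  then show ?thesis by (rule LIMSEQ_imp_Suc)
qed

text \<open>In these terms Dixon's closed form for the series is
  \<open>half_ratio (a / 2) / half_ratio a\<close>, so one asymptotic statement covers numerator and
  denominator.\<close>

definition half_ratio :: "real \<Rightarrow> real" where
  "half_ratio x = Gamma x * Gamma (x + 1) / (Gamma (x + 1/2))\<^sup>2"

lemma half_ratio_pos: "x > 0 \<Longrightarrow> half_ratio x > 0"
  unfolding half_ratio_def by (intro divide_pos_pos mult_pos_pos Gamma_real_pos zero_less_power) auto

lemma half_ratio_Suc:
  assumes "x > 0"
  shows "half_ratio (x + 1) = half_ratio x * (x * (x + 1) / (x + 1/2)\<^sup>2)"
proof -
  have "Gamma (x + 1) = x * Gamma x" "Gamma (x + 1 + 1) = (x + 1) * Gamma (x + 1)"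
       "Gamma (x + 1/2 + 1) = (x + 1/2) * Gamma (x + 1/2)"
    using assms by (intro Gamma_plus1; auto dest: nonpos_Ints_nonpos)+
  then show ?thesis by (simp add: half_ratio_def power_mult_distrib add_ac mult_ac)
qed

text \<open>Sum and closed form obey the same recursion, so their quotient is constant along
  \<open>a = 1/2 + 2 * m\<close>; as both tend to 1, the constant is 1.\<close>

lemma dixon_sum_eq: "dixon_sum (1/2) = half_ratio (1/4) / half_ratio (1/2)"
proof -
  define E where "E = (\<lambda>a. half_ratio (a / 2) / half_ratio a)"
  have E_pos: "E a > 0" if "a > 0" for a using that by (simp add: E_def half_ratio_pos)
  have E_rec: "(a + 1) ^ 4 / ((a + 1/2)\<^sup>2 * (a + 3/2)\<^sup>2) * E (a + 2) = E a" if a: "a > 0" for a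
  proof -
    have 1: "half_ratio ((a + 2) / 2) = half_ratio (a / 2) * (a * (a + 2) / (a + 1)\<^sup>2)"
    proof -
      have "a / 2 * (a / 2 + 1) / (a / 2 + 1/2)\<^sup>2 = a * (a + 2) / (a + 1)\<^sup>2"
      proof -
        have "a / 2 + 1/2 = (a + 1) / 2" "a / 2 + 1 = (a + 2) / 2" by auto
        then show ?thesis by (simp only: power_divide) simp
      qed
      moreover have "(a + 2) / 2 = a / 2 + 1" by auto
      ultimately show ?thesis using half_ratio_Suc[of "a / 2"] a by (simp only:) 
    qed
    have 2: "half_ratio (a + 2) = half_ratio a * (a * (a + 1) / (a + 1/2)\<^sup>2) * ((a + 1) * (a + 2) / (a + 3/2)\<^sup>2)"
      using half_ratio_Suc[of a] half_ratio_Suc[of "a + 1"] a by (simp add: add_ac)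
    have gen: "b ^ 4 / (P\<^sup>2 * Q\<^sup>2) * (h * (a * c / b\<^sup>2) / (k * (a * b / P\<^sup>2) * (b * c / Q\<^sup>2))) = h / k"
      if "b > 0" "c > 0" "P > 0" "Q > 0" "k > 0" for b c P Q h k :: real
    proof -
      have e: "b ^ 4 = (b * b) * b\<^sup>2" by (simp add: eval_nat_numeral)
      have "P\<^sup>2 > 0" "Q\<^sup>2 > 0" "b\<^sup>2 > 0" using that by simp_all
      then show ?thesis unfolding e using that a by (simp add: field_simps)
    qed
    show ?thesis
      unfolding E_def 1 2 by (rule gen) (use a half_ratio_pos in auto)
  qed
  define q where "q = (\<lambda>m. dixon_sum (1/2 + 2 * real m) / E (1/2 + 2 * real m))"
  have const: "q m = q 0" for m
  proof (induction m)
    case (Suc m)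
    define a where "a = 1/2 + 2 * real m"
    have a: "a \<ge> 1/2" by (simp add: a_def)
    define c where "c = (a + 1) ^ 4 / ((a + 1/2)\<^sup>2 * (a + 3/2)\<^sup>2)"
    have c: "c > 0" using a by (simp add: c_def)
    have "q m = (c * dixon_sum (a + 2)) / (c * E (a + 2))"
      using dixon_sum_rec[OF a, folded c_def] E_rec[of a, folded c_def] a by (simp add: q_def flip: a_def)
    also have "\<dots> = dixon_sum (a + 2) / E (a + 2)" using c by simp
    also have "a + 2 = 1/2 + 2 * real (Suc m)" by (simp add: a_def)
    finally have "q m = q (Suc m)" by (simp only: q_def)
    then show ?case using Suc.IH by (rule trans[OF sym])
  qed auto
  have lim: "q \<longlonglongrightarrow> 1"
  proof -
    have h1: "(\<lambda>n. half_ratio (1/4 + real n)) \<longlonglongrightarrow> 1" "(\<lambda>n. half_ratio (1/2 + real n)) \<longlonglongrightarrow> 1"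
      unfolding half_ratio_def by (intro Gamma_half_ratio_tendsto_1; simp)+
    have h2: "(\<lambda>m. half_ratio (1/2 + real (2 * m))) \<longlonglongrightarrow> 1"
      by (rule filterlim_compose[OF h1(2)]) (simp add: filterlim_subseq strict_mono_def)
    have "(\<lambda>m. half_ratio (1/4 + real m) / half_ratio (1/2 + real (2 * m))) \<longlonglongrightarrow> 1 / 1"
      by (intro tendsto_intros h1 h2) auto
    then have "(\<lambda>m. E (1/2 + 2 * real m)) \<longlonglongrightarrow> 1" by (simp add: E_def add_divide_distrib)
    from tendsto_divide[OF dixon_sum_tendsto_1 this] show ?thesis by (simp add: q_def)
  qed
  have "q \<longlonglongrightarrow> q 0" by (rule tendsto_eventually, rule always_eventually, rule allI, rule const)
  then have "q 0 = 1" using lim by (rule LIMSEQ_unique)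
  then have "dixon_sum (1/2) / E (1/2) = 1" by (simp add: q_def)
  then have "dixon_sum (1/2) = E (1/2)" using E_pos[of "1/2"] by (simp add: divide_eq_1_iff)
  then show ?thesis by (simp add: E_def)
qed

text \<open>To be used with \<open>Gamma (1/4)\<close>, \<open>sqrt pi\<close>,
  \<open>pi * sqrt 2\<close> and \<open>pi\<close> for \<open>G\<close>, \<open>s\<close>,
  \<open>w\<close> and \<open>p\<close>, where \<open>w / G\<close> is \<open>Gamma (3/4)\<close>.
  Both sides are \<open>G ^ 4 / (2 * w\<^sup>2 * p)\<close>.\<close>

lemma Dixon_value_algebra:
  fixes G s w p :: real
  assumes "s > 0" "w > 0" "G > 0" "s * s = p"
  shows "G * (1/4 * G) / (w / G)\<^sup>2 / (s * (1/2 * s) / 1\<^sup>2) = (G * s / (w / G))\<^sup>2 / (2 * p\<^sup>2)"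
proof -
  have "G * (1/4 * G) / (w / G)\<^sup>2 / (s * (1/2 * s) / 1\<^sup>2) = (G * G) * (G * G) / (2 * (w * w) * (s * s))"
    using assms(1-3) by (simp add: power2_eq_square)
  moreover have "(G * s / (w / G))\<^sup>2 / (2 * (s * s)\<^sup>2) = (G * G) * (G * G) / (2 * (w * w) * (s * s))"
    using assms(1-3) by (simp add: power2_eq_square)
  ultimately show ?thesis unfolding assms(4)[symmetric] by simp
qed

lemma cbin_cube_sums: "(\<lambda>j. cbin j ^ 3) sums (Beta (1/4) (1/2) ^ 2 / (2 * pi\<^sup>2))"
proof -
  \<comment> \<open>The reflection formula eliminates \<open>Gamma (3/4)\<close>, so that the sum
    and the Beta value are both expressed through \<open>Gamma (1/4)\<close>.\<close>
  have g: "Gamma (1/4) * Gamma (3/4) = pi * sqrt 2"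
  proof -
    have "complex_of_real (Gamma (1/4) * Gamma (3/4)) = of_real (pi / sin (pi / 4))"
      using Gamma_reflection_complex[of "1/4"] Gamma_complex_of_real[of "1/4"] Gamma_complex_of_real[of "3/4"]
      by (simp flip: sin_of_real)
    then have "Gamma (1/4) * Gamma (3/4) = pi / sin (pi / 4)" by (simp only: of_real_eq_iff)
    also have "\<dots> = pi * sqrt 2" unfolding sin_45 by (rule sym, rule eq_divide_imp) auto
    finally show ?thesis .
  qed
  have pos: "Gamma (1/4 :: real) > 0" "Gamma (3/4 :: real) > 0" by (auto intro: Gamma_real_pos)
  have g2: "Gamma (1/2 :: real) = sqrt pi" by (rule Gamma_one_half_real)
  have "Gamma (1/4 + 1 :: real) = 1/4 * Gamma (1/4)" "Gamma (1/2 + 1 :: real) = 1/2 * Gamma (1/2)"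
    by (intro Gamma_plus1; auto dest: nonpos_Ints_nonpos)+
  then have g5: "Gamma (5/4 :: real) = 1/4 * Gamma (1/4)" "Gamma (3/2 :: real) = 1/2 * sqrt pi"
    by (simp_all add: g2)
  define G where "G = Gamma (1/4 :: real)"
  have G3: "Gamma (3/4 :: real) = pi * sqrt 2 / G" using g pos by (intro eq_divide_imp) (auto simp: G_def mult.commute)
  have e1: "dixon_sum (1/2) = G * (1/4 * G) / (pi * sqrt 2 / G)\<^sup>2 / (sqrt pi * (1/2 * sqrt pi) / 1\<^sup>2)"
  proof -
    have "1/4 + 1 = (5/4 :: real)" "1/4 + 1/2 = (3/4 :: real)" "1/2 + 1 = (3/2 :: real)" "1/2 + 1/2 = (1 :: real)"
      by simp_all
    then show ?thesis
      by (simp only: dixon_sum_eq half_ratio_def g5 g2 G3 Gamma_1 flip: G_def)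
  qed
  have e2: "G * (1/4 * G) / (pi * sqrt 2 / G)\<^sup>2 / (sqrt pi * (1/2 * sqrt pi) / 1\<^sup>2) 
      = (G * sqrt pi / (pi * sqrt 2 / G))\<^sup>2 / (2 * pi\<^sup>2)"
  proof -
    have "sqrt pi > 0" "pi * sqrt 2 > 0" "G > 0" using pos(1) by (simp_all add: G_def)
    moreover have "sqrt pi * sqrt pi = pi" by simp
    ultimately show ?thesis by (rule Dixon_value_algebra)
  qed
  have e3: "Beta (1/4) (1/2) = G * sqrt pi / (pi * sqrt 2 / G)"
  proof -
    have "1/4 + 1/2 = (3/4 :: real)" by simp
    then show ?thesis unfolding Beta_def by (simp only: G3 g2 flip: G_def)
  qed
  have "dixon_sum (1/2) = Beta (1/4) (1/2) ^ 2 / (2 * pi\<^sup>2)"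
    unfolding e1 e2 e3 by (rule refl)
  moreover have "dixon_term (1/2) = (\<lambda>j. cbin j ^ 3)"
    using dixon_term_half by auto
  ultimately show ?thesis
    using summable_sums[OF summable_cbin_cube] by (simp add: dixon_sum_def)
qed

text \<open>Each of the three binomial factors is \<open>cbin j\<close> up to the sign
  \<open>(-1) ^ j\<close>, which occurs only squared; the series is therefore Dixon's sum at
  \<open>a = 1/2\<close>.\<close>

lemma A_sigma_half: "A_sigma N (- 1 / 2) = of_real (2 * lemniscate\<^sup>2 / pi\<^sup>2) ^ ((N - 3) div 2)"
proof -
  have "((- 1 / 2 :: complex) gchoose j)\<^sup>2 * ((- 1 / 2 + of_nat j) gchoose j) = of_real (cbin j ^ 3)" for j
  proof -
    have c: "pochhammer (1/2 :: complex) j / fact j = of_real (cbin j)"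
      by (simp add: cbin_def flip: pochhammer_of_real)
    have "((- 1 / 2 :: complex) gchoose j) = (-1) ^ j * (pochhammer (1/2) j / fact j)"
      by (simp add: gbinomial_pochhammer)
    moreover have "((- 1 / 2 + of_nat j :: complex) gchoose j) = pochhammer (1/2) j / fact j"
      by (simp add: gbinomial_pochhammer')
    ultimately show ?thesis unfolding c
      by (simp add: power_mult_distrib power2_eq_square power3_eq_cube flip: power_mult)
  qed
  moreover have "(\<lambda>j. complex_of_real (cbin j ^ 3)) sums of_real (Beta (1/4) (1/2) ^ 2 / (2 * pi\<^sup>2))"
    by (rule sums_of_real[OF cbin_cube_sums])
  moreover have "Beta (1/4) (1/2) ^ 2 / (2 * pi\<^sup>2) = 2 * lemniscate\<^sup>2 / pi\<^sup>2"
    by (simp add: lemniscate_def power_divide)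
  ultimately show ?thesis unfolding A_sigma_def by (simp only: sums_unique[symmetric])
qed

theorem theorem3p2:
  fixes N k :: nat
  assumes "N \<ge> 5" and "odd N" and "k = N - 2"
  shows "A_sigma N (- 1 / 2) =
           of_rat (alpha k) / of_real pi ^ (k - 1) * L_function (theta_f k) (of_nat k - 1)"
proof -
  obtain m where m: "N = 2 * m + 1" using assms(2) by (auto elim!: oddE)
  define d where "d = m - 1"
  have d1: "d \<ge> 1" and k: "k = 2 * d + 1" and N: "(N - 3) div 2 = d"
    using assms m by (auto simp: d_def)
  have idx: "(k + 1) div 2 = d + 1" "(k - 1) div 2 = d" "k - 1 = 2 * d" using k by auto
  define w where "w = complex_of_real lemniscate"
  define P where "P = complex_of_real pi"
  have P: "P \<noteq> 0" by (simp add: P_def)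
  have lhs: "A_sigma N (- 1 / 2) = 2 ^ d * w ^ (2 * d) / P ^ (2 * d)"
    unfolding A_sigma_half N by (simp add: w_def P_def power_divide power_mult_distrib power_mult)
  have kk: "rat_of_nat k - 2 = 2 * of_nat d - 1" using k by simp
  \<comment> \<open>The powers of 2 in \<open>alpha\<close> compensate the quarter, respectively
    half, of an Eisenstein series: \<open>2 ^ (d + 1) * 2 / 4\<close> and
    \<open>2 ^ (d + 1) / 2\<close> both equal \<open>2 ^ d\<close>.\<close>
  have "of_rat (alpha k) * L_function (theta_f k) (of_nat k - 1) = 2 ^ d * w ^ (2 * d)"
  proof (cases "even d")
    case True
    then have d2: "d \<ge> 2" using d1 by (cases "d = 1") auto
    obtain n where n: "d = 2 * n" using True by blast
    have mod: "k mod 4 = 1" by (simp add: k n)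
    have r: "r_seq d \<noteq> 0" using r_seq_pos[of n] d1 by (simp add: n)
    have a: "of_rat (alpha k) = 2 ^ (d + 1) * (2 * complex_of_nat d - 1) * (2 / of_rat (r_seq d))"
      unfolding alpha_def idx kk mod
      by (simp add: of_rat_mult of_rat_divide of_rat_diff of_rat_power)
    have "of_rat (alpha k) * L_function (theta_f k) (of_nat k - 1) =
        2 ^ d / of_rat (r_seq d) * ((2 * of_nat d - 1) * L1.eisenstein (2 * d))"
      unfolding a L_function_even[OF d2 True k] by simp
    also have "\<dots> = 2 ^ d * w ^ (2 * d)"
      unfolding eisenstein_L1[OF d2] using r by (simp add: w_def)
    finally show ?thesis .
  next
    case False
    then obtain n where n: "d = 2 * n + 1" by (auto elim!: oddE)
    have mod: "k mod 4 = 3"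
    proof -
      have "k = 4 * n + 3" by (simp add: k n)
      then show ?thesis by simp
    qed
    have s: "s_seq d \<noteq> 0" using s_seq_pos[of d] d1 by simp
    have a: "of_rat (alpha k) = 2 ^ (d + 1) * (2 * complex_of_nat d - 1) * (1 / of_rat (s_seq d))"
      unfolding alpha_def idx kk mod
      by (simp add: of_rat_mult of_rat_divide of_rat_diff of_rat_power)
    show ?thesis
    proof (cases "d = 1")
      case True
      then have "k = 3" by (simp add: k)
      then have L: "L_function (theta_f k) (of_nat k - 1) = w\<^sup>2 / 8"
        using L_function_weight_3 by (simp add: w_def)
      have "of_rat (alpha k) = (16 :: complex)" unfolding a True s_seq_values by (simp add: of_rat_divide)
      then show ?thesis unfolding L by (simp add: True)
    next
      case d_ne_1: False
      then have d2: "d \<ge> 2" using d1 by simp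
      have "of_rat (alpha k) * L_function (theta_f k) (of_nat k - 1) =
          2 ^ d / of_rat (s_seq d) * ((2 * of_nat d - 1) * L2.eisenstein (2 * d))"
        unfolding a L_function_odd[OF d2 False k] by simp
      also have "\<dots> = 2 ^ d * w ^ (2 * d)"
        unfolding eisenstein_L2[OF d2] using s by (simp add: w_def)
      finally show ?thesis .
    qed
  qed
  then show ?thesis unfolding lhs idx P_def[symmetric] by (metis times_divide_eq_left)
qed

end
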